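(* Let $n\ge2$, $\alpha\in(0,\frac{n-1}{2n})$ and $\beta\in[0,\infty)$. Then there exist a constant $C=C(\alpha)>0$ (which may also depend on $n$, but not on $\beta$) and an integer $N_0=N_0(\alpha,\beta)$ (which may also depend on $n$) such that for every integer $N\ge N_0$ there is a set $\Omega\subset\mathbb R^n$ of the form $\Omega=U_{N_1}\times\cdots\times U_{N_n}$ for some positive integers $N_1,\dots,N_n$, where $U_M=\{j/M:1\le j\le M\}$, satisfying $$N/2^n\le\#(\Omega)\le2^nN$$ and $$C^{-1}N^\alpha(\log N)^\beta\le\|H_\Omega\|_{L^2(\mathbb R^{n+1})\to L^2(\mathbb R^{n+1})}\le CN^\alpha(\log N)^\beta.$$
   Context: For $v\in\mathbb R^n$ write $\langle v,1\rangle=(v_1,\dots,v_n,1)\in\mathbb R^{n+1}$. The directional Hilbert transform on $\mathbb R^{n+1}$ is $H_vf(x)=\mathrm{p.v.}\,\frac1\pi\int_{\mathbb R}f(x-t\langle v,1\rangle)\frac{dt}{t}$, bounded on $L^2(\mathbb R^{n+1})$. For finite $\Omega\subset\mathbb R^n$, $H_\Omega f(x)=\sup_{v\in\Omega}|H_vf(x)|$, and $\|H_\Omega\|_{L^2(\mathbb R^{n+1})\to L^2(\mathbb R^{n+1})}$ is its operator norm on $L^2(\mathbb R^{n+1})$. *)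

theory Defs
  imports "HOL-Analysis.Analysis"
begin

text \<open>
  The space \<open>\<real>\<^sup>n\<^sup>+\<^sup>1\<close> is rendered as \<open>(real^'n) \<times> real\<close> with \<open>n = CARD('n)\<close>, so that the
  vector \<open>\<langle>v,1\<rangle>\<close> is the pair \<open>(v, 1)\<close>; the product type carries the Euclidean norm, and
  \<open>lborel\<close> on it is Lebesgue measure.  Functions in \<open>L\<^sup>2\<close> are complex valued and are represented
  by Borel functions.
\<close>

definition truncated_hilbert ::
  "real \<Rightarrow> real^'n \<Rightarrow> ((real^'n) \<times> real \<Rightarrow> complex) \<Rightarrow> (real^'n) \<times> real \<Rightarrow> complex"
  where "truncated_hilbert \<epsilon> v f x =
    complex_of_real (1 / pi) * (LBINT t:{t. \<bar>t\<bar> > \<epsilon>}. f (x - t *\<^sub>R (v, 1)) / complex_of_real t)"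

text \<open>
  The principal value is the pointwise limit of the truncations.  For \<open>f\<close> in \<open>L\<^sup>2\<close> the truncated
  integrals converge absolutely and the limit exists for almost every \<open>x\<close>; the value \<open>0\<close> on the
  exceptional null set is a convention without effect on any \<open>L\<^sup>2\<close> norm.
\<close>

definition directional_hilbert ::
  "real^'n \<Rightarrow> ((real^'n) \<times> real \<Rightarrow> complex) \<Rightarrow> (real^'n) \<times> real \<Rightarrow> complex"
  where "directional_hilbert v f x =
    (if \<exists>l. ((\<lambda>\<epsilon>. truncated_hilbert \<epsilon> v f x) \<longlongrightarrow> l) (at_right 0)
     then Lim (at_right 0) (\<lambda>\<epsilon>. truncated_hilbert \<epsilon> v f x)
     else 0)"

definition maximal_hilbert ::
  "(real^'n) set \<Rightarrow> ((real^'n) \<times> real \<Rightarrow> complex) \<Rightarrow> (real^'n) \<times> real \<Rightarrow> ennreal"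
  where "maximal_hilbert \<Omega> f x = (SUP v\<in>\<Omega>. ennreal (norm (directional_hilbert v f x)))"

text \<open>
  The \<open>L\<^sup>2\<close> norm of a nonnegative function, with value \<open>\<infinity>\<close> outside \<open>L\<^sup>2\<close>.
\<close>

definition L2_norm :: "('a::euclidean_space \<Rightarrow> ennreal) \<Rightarrow> ennreal"
  where "L2_norm g =
    (let I = (\<integral>\<^sup>+ x. (g x)\<^sup>2 \<partial>lborel) in if I = \<infinity> then \<infinity> else ennreal (sqrt (enn2real I)))"

definition L2_operator_norm ::
  "(('a::euclidean_space \<Rightarrow> complex) \<Rightarrow> 'a \<Rightarrow> ennreal) \<Rightarrow> ennreal"
  where "L2_operator_norm T =
    (SUP f\<in>{f \<in> borel_measurable lborel. L2_norm (\<lambda>x. ennreal (norm (f x))) \<le> 1}. L2_norm (T f))"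

definition uniform_points :: "nat \<Rightarrow> real set"
  where "uniform_points M = {real j / real M | j. 1 \<le> j \<and> j \<le> M}"

definition uniform_grid :: "('n \<Rightarrow> nat) \<Rightarrow> (real^'n) set"
  where "uniform_grid M = {v. \<forall>i. v $ i \<in> uniform_points (M i)}"

end

theory Submission
  imports Defs "HOL-Probability.Probability"
begin

text \<open>
  Take one long side \<open>N\<^sub>1\<close> and \<open>d = n - 1\<close> equal short sides \<open>K\<close>, with \<open>K L\<^sup>2 \<le> N\<^sub>1\<close> for a power \<open>L\<close> of \<open>N\<close>; then
  \<open>\<parallel>H\<^sub>\<Omega>\<parallel>\<close> is comparable to \<open>K\<^bsup>d/2\<^esup> log N\<close>, and \<open>K\<close> is chosen so that this is \<open>N\<^bsup>\<alpha>\<^esup> (log N)\<^bsup>\<beta>\<^esup>\<close>.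

  Upper bound: for fixed values of the short coordinates the directions form an arithmetic
  progression, so for each frequency the multipliers of the Hilbert transforms sample a function of
  bounded variation at monotone points.  By Plancherel, the increments over the dyadic blocks of one
  generation have square-summable norms, and the Rademacher--Menshov argument bounds the supremum over the
  progression by \<open>log N\<^sub>1\<close>.  The \<open>K\<^bsup>d\<^esup>\<close> progressions are summed in \<open>\<ell>\<^sup>2\<close>.
  The argument is run for the kernels \<open>(exp (- t\<^sup>2 / 2b\<^sup>2) - exp (- t\<^sup>2 / 2a\<^sup>2)) / (\<pi> t)\<close>; Fatou's lemma passes
  to arbitrary \<open>L\<^sup>2\<close> functions and to the principal value, whose existence is not needed.

  Lower bound: test on \<open>f (y, -s) = 1 / s\<close> for \<open>1 \<le> s \<le> L\<close>, with \<open>y\<close> in a box of half-width \<open>2 s\<close> in the long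
  coordinate and \<open>2 L\<close> in the short ones.  At height \<open>r \<in> [K L, N\<^sub>1]\<close> some direction gives a value of size
  \<open>log L / r\<close> on \<open>K\<^bsup>d\<^esup>\<close> disjoint boxes of volume \<open>r L\<^bsup>d\<^esup>\<close>.
\<close>

subsection \<open>The Plancherel identity\<close>

text \<open>The range of \<alpha> is the room that the lower bound needs. With
  \<open>N1 * K ^ d\<close> comparable to N, the condition \<open>K * L\<^sup>2 \<le> N1\<close>
  keeps \<open>K ^ (d + 1)\<close> below N by a power of N, so K^(d/2) stays below the power d / (2
  (d + 1)) = (n - 1) / (2 n) of N. The square of the lower bound contains two logarithms, log L from
  the test function and log (N1 / (K L)) from the heights r. Both are comparable to log N because L
  is a fixed power of N; this is where the constant depends on \<alpha>. The norm thus carries one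
  factor log N by itself, so K^d is taken of size N^(2 \<alpha>) (log N)^(2 \<beta> - 2), and
  \<beta> affects only how large N must be. The obstacle in the upper bound is that multipliers must
  be compared at many points uniformly in the truncation. A difference of Gaussians divided by t is
  integrable, and its Fourier transform is a difference of two dilates of one bounded monotone
  function, so its variation is bounded independently of the truncation parameters.\<close>

lemma gaussian_fourier_real:
  fixes s :: real
  shows "integrable lborel (\<lambda>t. iexp (s * t) * complex_of_real (exp (- t\<^sup>2 / 2)))"
    and "(\<integral>t. iexp (s * t) * complex_of_real (exp (- t\<^sup>2 / 2)) \<partial>lborel)
      = complex_of_real (sqrt (2 * pi) * exp (- s\<^sup>2 / 2))"
proof -
  have int: "integrable lborel std_normal_density"
    using integrable_std_normal_moment[of 0] by simp
  have e: "exp (- t\<^sup>2 / 2) = sqrt (2 * pi) * std_normal_density t" for t :: real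
    by (simp add: std_normal_density_def)
  have "integrable lborel (\<lambda>t. exp (- t\<^sup>2 / 2) :: real)"
    unfolding e using int by simp
  then show i: "integrable lborel (\<lambda>t. iexp (s * t) * complex_of_real (exp (- t\<^sup>2 / 2)))"
    by (rule Bochner_Integration.integrable_bound) (auto simp: norm_mult)
  \<comment> \<open>The characteristic function of the standard normal law supplies the transform;
    the constant sqrt (2 pi) only undoes the normalisation of the density.\<close>
  have "char std_normal_distribution s
      = (\<integral>t. std_normal_density t *\<^sub>R iexp (s * t) \<partial>lborel)"
    unfolding char_def
    by (subst integral_density) auto
  then have "complex_of_real (exp (- s\<^sup>2 / 2)) = (\<integral>t. std_normal_density t *\<^sub>R iexp (s * t) \<partial>lborel)"
    by (simp add: char_std_normal_distribution)
  moreover have "(\<integral>t. iexp (s * t) * complex_of_real (exp (- t\<^sup>2 / 2)) \<partial>lborel)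
      = (\<integral>t. complex_of_real (sqrt (2 * pi)) * (std_normal_density t *\<^sub>R iexp (s * t)) \<partial>lborel)"
    unfolding e by (intro Bochner_Integration.integral_cong) (auto simp: scaleR_conv_of_real)
  ultimately show "(\<integral>t. iexp (s * t) * complex_of_real (exp (- t\<^sup>2 / 2)) \<partial>lborel)
      = complex_of_real (sqrt (2 * pi) * exp (- s\<^sup>2 / 2))"
    by (simp only: integral_mult_right_zero of_real_mult)
qed

text \<open>Character and Gaussian both factor over \<open>Basis\<close>, and Lebesgue measure is
  the image of a product measure, so the one-dimensional formula is multiplied up over the
  coordinates.\<close>

lemma gaussian_fourier:
  fixes x :: "'a::euclidean_space"
  shows "integrable lborel (\<lambda>\<xi>::'a. iexp (x \<bullet> \<xi>) * complex_of_real (exp (- (norm \<xi>)\<^sup>2 / 2)))"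
    and "(\<integral>\<xi>. iexp (x \<bullet> \<xi>) * complex_of_real (exp (- (norm \<xi>)\<^sup>2 / 2)) \<partial>lborel)
      = complex_of_real (sqrt (2 * pi) ^ DIM('a) * exp (- (norm x)\<^sup>2 / 2))"
proof -
  interpret product_sigma_finite "\<lambda>_::'a. lborel :: real measure" by standard
  define g where "g b t = iexp ((x \<bullet> b) * t) * complex_of_real (exp (- t\<^sup>2 / 2))" for b :: 'a and t :: real
  have g: "integrable lborel (g b)" for b unfolding g_def by (rule gaussian_fourier_real)
  have gi: "(\<integral>t. g b t \<partial>lborel) = complex_of_real (sqrt (2 * pi) * exp (- (x \<bullet> b)\<^sup>2 / 2))" for b
    unfolding g_def by (rule gaussian_fourier_real)
  have n: "(norm \<xi>)\<^sup>2 = (\<Sum>b\<in>Basis. (\<xi> \<bullet> b)\<^sup>2)" for \<xi> :: 'a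
    unfolding power2_norm_eq_inner by (subst euclidean_inner) (simp add: power2_eq_square)
  have prod: "iexp (x \<bullet> \<xi>) * complex_of_real (exp (- (norm \<xi>)\<^sup>2 / 2)) = (\<Prod>b\<in>Basis. g b (\<xi> \<bullet> b))" for \<xi> :: 'a
    unfolding g_def prod.distrib n euclidean_inner[of x \<xi>]
    by (simp add: exp_sum sum_distrib_left mult.assoc flip: sum_divide_distrib sum_negf of_real_prod)
       (simp add: exp_sum[symmetric] sum_divide_distrib sum_negf)
  have s: "(\<Sum>b\<in>Basis. f b *\<^sub>R b) \<bullet> c = f c" if "c \<in> Basis" for f and c :: 'a
    using that by simp
  have prod': "(\<Prod>b\<in>Basis. g b ((\<Sum>b\<in>Basis. f b *\<^sub>R b) \<bullet> b)) = (\<Prod>b\<in>Basis. g b (f b))" for f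
    by (intro prod.cong refl) (simp add: s)
  have mg [measurable]: "g b \<in> borel_measurable borel" for b
    using g[of b] by (simp add: borel_measurable_integrable)
  define F where "F \<xi> = (\<Prod>b\<in>Basis. g b (\<xi> \<bullet> b))" for \<xi> :: 'a
  have mF [measurable]: "F \<in> borel_measurable borel" unfolding F_def by measurable
  have F: "F (\<Sum>b\<in>Basis. f b *\<^sub>R b) = (\<Prod>b\<in>Basis. g b (f b))" for f
    unfolding F_def by (rule prod')
  have m [measurable]: "(\<lambda>f. \<Sum>b\<in>Basis. f b *\<^sub>R b) \<in> (\<Pi>\<^sub>M b\<in>(Basis::'a set). lborel) \<rightarrow>\<^sub>M borel"
    by measurable
  have "integrable lborel F"
    by (subst lborel_eq, subst integrable_distr_eq[OF m mF], unfold F)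
       (intro product_integrable_prod g finite_Basis)
  then show "integrable lborel (\<lambda>\<xi>::'a. iexp (x \<bullet> \<xi>) * complex_of_real (exp (- (norm \<xi>)\<^sup>2 / 2)))"
    unfolding prod F_def .
  have "(\<integral>\<xi>. F \<xi> \<partial>lborel) = (\<Prod>b\<in>(Basis::'a set). (\<integral>t. g b t \<partial>lborel))"
    by (subst lborel_eq, subst integral_distr[OF m mF], unfold F)
       (intro product_integral_prod g finite_Basis)
  also have "\<dots> = complex_of_real (\<Prod>b\<in>(Basis::'a set). sqrt (2 * pi) * exp (- (x \<bullet> b)\<^sup>2 / 2))"
    unfolding gi by simp
  also have "\<dots> = complex_of_real (sqrt (2 * pi) ^ DIM('a) * exp (- (norm x)\<^sup>2 / 2))"
    unfolding n prod.distrib exp_sum[OF finite_Basis, symmetric]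
    by (simp add: sum_divide_distrib sum_negf)
  finally show "(\<integral>\<xi>. iexp (x \<bullet> \<xi>) * complex_of_real (exp (- (norm \<xi>)\<^sup>2 / 2)) \<partial>lborel)
      = complex_of_real (sqrt (2 * pi) ^ DIM('a) * exp (- (norm x)\<^sup>2 / 2))"
    unfolding prod F_def .
qed

section \<open>Product domination, affine changes of variables and the Fourier transform\<close>

lemma integrable_fst_times_snd:
  fixes f :: "'a \<Rightarrow> real" and g :: "'b \<Rightarrow> real"
  assumes "sigma_finite_measure M" "sigma_finite_measure N" "integrable M f" "integrable N g"
  shows "integrable (M \<Otimes>\<^sub>M N) (\<lambda>(x, y). f x * g y)"
proof -
  interpret pair_sigma_finite M N using assms by (simp add: pair_sigma_finite_def)
  note [measurable] = borel_measurable_integrable[OF assms(3)] borel_measurable_integrable[OF assms(4)]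
  show ?thesis
    by (rule Fubini_integrable) (use assms in \<open>auto simp: abs_mult\<close>)
qed

lemma integrable_pair_lborel_bound:
  fixes h :: "'a::euclidean_space \<times> 'b::euclidean_space \<Rightarrow> complex"
  assumes "h \<in> borel_measurable borel" "integrable lborel f" "integrable lborel g"
    and "\<And>x y. norm (h (x, y)) \<le> f x * (g y :: real)"
  shows "integrable (lborel \<Otimes>\<^sub>M lborel) h"
  using integrable_fst_times_snd[OF sigma_finite_lborel sigma_finite_lborel assms(2,3)]
  by (rule Bochner_Integration.integrable_bound)
     (use assms(1,4) in \<open>auto simp: lborel_prod split_beta' intro!: AE_I2 order_trans[OF _ abs_ge_self]\<close>)

lemma borel_measurable_cnj [measurable (raw)]:
  "f \<in> borel_measurable M \<Longrightarrow> (\<lambda>x. cnj (f x)) \<in> borel_measurable M"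
  by (rule borel_measurable_continuous_on[OF continuous_on_cnj[OF continuous_on_id]])

lemma lborel_integral_affine:
  fixes h :: "'a::euclidean_space \<Rightarrow> complex"
  assumes [measurable]: "h \<in> borel_measurable borel" and "c \<noteq> 0"
  shows "(\<integral>x. h x \<partial>lborel) = complex_of_real (\<bar>c\<bar> ^ DIM('a)) * (\<integral>x. h (t + c *\<^sub>R x) \<partial>lborel)"
  by (subst lborel_affine[OF assms(2), of t])
     (simp add: integral_density integral_distr scaleR_conv_of_real)

lemma lborel_integrable_affine:
  fixes h :: "'a::euclidean_space \<Rightarrow> complex"
  assumes "integrable lborel h" and "c \<noteq> 0"
  shows "integrable lborel (\<lambda>x. h (t + c *\<^sub>R x))"
proof -
  have [measurable]: "h \<in> borel_measurable borel" using assms by simp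
  have "integrable (density (distr lborel borel (\<lambda>x. t + c *\<^sub>R x)) (\<lambda>_. ennreal (\<bar>c\<bar> ^ DIM('a)))) h"
    using assms by (simp add: ennreal_power flip: lborel_affine)
  then have "integrable lborel (\<lambda>x. \<bar>c\<bar> ^ DIM('a) *\<^sub>R h (t + c *\<^sub>R x))"
    by (simp add: integrable_density integrable_distr_eq)
  then have "integrable lborel (\<lambda>x. inverse (\<bar>c\<bar> ^ DIM('a)) *\<^sub>R (\<bar>c\<bar> ^ DIM('a) *\<^sub>R h (t + c *\<^sub>R x)))"
    by (rule integrable_scaleR_right)
  then show ?thesis using assms(2) by simp
qed

text \<open>No constant is put into the exponent or in front of the integral; the price is the
  factor \<open>(2 * pi) ^ DIM('a)\<close> in \<open>plancherel\<close>, which cancels whenever two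
  norms are compared.\<close>

definition fourier :: "('a::euclidean_space \<Rightarrow> complex) \<Rightarrow> 'a \<Rightarrow> complex"
  where "fourier f \<xi> = (\<integral>x. iexp (- (x \<bullet> \<xi>)) * f x \<partial>lborel)"

lemma norm_iexp [simp]: "norm (iexp x) = 1"
  by simp

lemma integrable_iexp_mult:
  fixes f :: "'a::euclidean_space \<Rightarrow> complex"
  assumes "integrable lborel f" "g \<in> borel_measurable borel"
  shows "integrable lborel (\<lambda>x. iexp (g x) * f x)"
  by (rule Bochner_Integration.integrable_bound[OF assms(1)])
     (use assms in \<open>auto simp: norm_mult\<close>)

lemma fourier_measurable [measurable]:
  fixes f :: "'a::euclidean_space \<Rightarrow> complex"
  assumes [measurable]: "f \<in> borel_measurable borel"
  shows "fourier f \<in> borel_measurable borel"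
proof -
  have [measurable]: "(\<lambda>p. iexp (- (snd p \<bullet> fst p)) * f (snd p)) \<in> borel_measurable (borel \<Otimes>\<^sub>M (lborel::'a measure))"
    by measurable
  have "(\<lambda>\<xi>. \<integral>x. iexp (- (x \<bullet> \<xi>)) * f x \<partial>lborel) \<in> borel_measurable borel"
    by (rule lborel.borel_measurable_lebesgue_integral) (simp add: case_prod_beta')
  then show ?thesis by (simp add: fourier_def[abs_def])
qed

lemma norm_fourier_le:
  assumes "integrable lborel f"
  shows "norm (fourier f \<xi>) \<le> (\<integral>x. norm (f x) \<partial>lborel)"
proof -
  have "norm (fourier f \<xi>) \<le> (\<integral>x. norm (iexp (- (x \<bullet> \<xi>)) * f x) \<partial>lborel)"
    unfolding fourier_def by (rule integral_norm_bound)
  then show ?thesis by (simp add: norm_mult)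
qed

lemma gaussian_fourier_scaled:
  fixes x :: "'a::euclidean_space"
  assumes a: "a > 0"
  shows "integrable lborel (\<lambda>\<xi>::'a. iexp (x \<bullet> \<xi>) * complex_of_real (exp (- (norm (a *\<^sub>R \<xi>))\<^sup>2 / 2)))"
    and "(\<integral>\<xi>. iexp (x \<bullet> \<xi>) * complex_of_real (exp (- (norm (a *\<^sub>R \<xi>))\<^sup>2 / 2)) \<partial>lborel)
      = complex_of_real (inverse a ^ DIM('a) * sqrt (2 * pi) ^ DIM('a) * exp (- (norm (x /\<^sub>R a))\<^sup>2 / 2))"
proof -
  let ?h = "\<lambda>\<xi>::'a. iexp ((x /\<^sub>R a) \<bullet> \<xi>) * complex_of_real (exp (- (norm \<xi>)\<^sup>2 / 2))"
  have e: "iexp (x \<bullet> \<xi>) * complex_of_real (exp (- (norm (a *\<^sub>R \<xi>))\<^sup>2 / 2)) = ?h (0 + a *\<^sub>R \<xi>)" for \<xi>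
  proof -
    have "(x /\<^sub>R a) \<bullet> (0 + a *\<^sub>R \<xi>) = x \<bullet> \<xi>" using a by simp
    then show ?thesis by (simp only: add_0_left)
  qed
  show "integrable lborel (\<lambda>\<xi>::'a. iexp (x \<bullet> \<xi>) * complex_of_real (exp (- (norm (a *\<^sub>R \<xi>))\<^sup>2 / 2)))"
    unfolding e by (rule lborel_integrable_affine[OF gaussian_fourier(1)]) (use a in simp)
  have "(\<integral>\<xi>. ?h \<xi> \<partial>lborel) = complex_of_real (a ^ DIM('a)) * (\<integral>\<xi>. ?h (0 + a *\<^sub>R \<xi>) \<partial>lborel)"
    using a by (subst lborel_integral_affine[of ?h a 0]) auto
  then have "(\<integral>\<xi>. ?h (0 + a *\<^sub>R \<xi>) \<partial>lborel) = (\<integral>\<xi>. ?h \<xi> \<partial>lborel) / complex_of_real (a ^ DIM('a))"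
    using a by (simp add: field_simps)
  then show "(\<integral>\<xi>. iexp (x \<bullet> \<xi>) * complex_of_real (exp (- (norm (a *\<^sub>R \<xi>))\<^sup>2 / 2)) \<partial>lborel)
      = complex_of_real (inverse a ^ DIM('a) * sqrt (2 * pi) ^ DIM('a) * exp (- (norm (x /\<^sub>R a))\<^sup>2 / 2))"
    unfolding e gaussian_fourier(2) by (simp add: field_simps)
qed

text \<open>The Gaussian weight makes the integrals over x, y and \<xi> absolutely convergent, so
  Fubini is allowed although the transform of an integrable function need not be integrable. Doing
  the \<xi> integral turns the weight into a Gaussian in (y - x) / a, and y = x + a z makes the
  remaining kernel independent of a: an approximate identity acting on f.\<close>

lemma fourier_gaussian_regularised:
  fixes f :: "'a::euclidean_space \<Rightarrow> complex"
  assumes f: "integrable lborel f" and a: "a > 0"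
  shows "(\<integral>\<xi>. complex_of_real ((norm (fourier f \<xi>))\<^sup>2 * exp (- (norm (a *\<^sub>R \<xi>))\<^sup>2 / 2)) \<partial>lborel)
    = (\<integral>x. f x * (\<integral>z. complex_of_real (sqrt (2 * pi) ^ DIM('a) * exp (- (norm z)\<^sup>2 / 2))
          * cnj (f (x + a *\<^sub>R z)) \<partial>lborel) \<partial>lborel)"
proof -
  have [measurable]: "f \<in> borel_measurable borel" using f by simp
  define w where "w \<xi> = exp (- (norm (a *\<^sub>R \<xi>))\<^sup>2 / 2)" for \<xi> :: 'a
  have [measurable]: "w \<in> borel_measurable borel" unfolding w_def by measurable
  have w: "integrable lborel w"
    using gaussian_fourier_scaled(1)[OF a, of 0] unfolding w_def
    by (simp only: inner_zero_left of_real_0 mult_zero_right exp_zero mult_1_left complex_of_real_integrable_eq)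
  have fn: "integrable lborel (\<lambda>x. norm (f x))" using f by simp
  define B where "B = (\<integral>x. norm (f x) \<partial>lborel)"
  have B: "norm (fourier f \<xi>) \<le> B" for \<xi> unfolding B_def by (rule norm_fourier_le[OF f])
  have "(\<integral>\<xi>. complex_of_real ((norm (fourier f \<xi>))\<^sup>2 * w \<xi>) \<partial>lborel)
      = (\<integral>\<xi>. (\<integral>x. w \<xi> * cnj (fourier f \<xi>) * iexp (- (x \<bullet> \<xi>)) * f x \<partial>lborel) \<partial>lborel)"
  proof (intro Bochner_Integration.integral_cong refl)
    fix \<xi>
    have "(\<integral>x. w \<xi> * cnj (fourier f \<xi>) * iexp (- (x \<bullet> \<xi>)) * f x \<partial>lborel) = w \<xi> * cnj (fourier f \<xi>) * fourier f \<xi>"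
      by (simp add: fourier_def mult.assoc)
    then show "complex_of_real ((norm (fourier f \<xi>))\<^sup>2 * w \<xi>) =
        (\<integral>x. w \<xi> * cnj (fourier f \<xi>) * iexp (- (x \<bullet> \<xi>)) * f x \<partial>lborel)"
      by (simp only: of_real_mult complex_norm_square mult_ac)
  qed
  also have "\<dots> = (\<integral>x. (\<integral>\<xi>. w \<xi> * cnj (fourier f \<xi>) * iexp (- (x \<bullet> \<xi>)) * f x \<partial>lborel) \<partial>lborel)"
  proof (rule lborel_pair.Fubini_integral)
    have [measurable]: "(\<lambda>p::'a\<times>'a. w (snd p) * cnj (fourier f (snd p)) * iexp (- (fst p \<bullet> snd p)) * f (fst p)) \<in> borel_measurable (borel \<Otimes>\<^sub>M borel)"
      by measurable
    show "integrable (lborel \<Otimes>\<^sub>M lborel) (\<lambda>(x, \<xi>). w \<xi> * cnj (fourier f \<xi>) * iexp (- (x \<bullet> \<xi>)) * f x)"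
    proof (rule integrable_pair_lborel_bound[OF _ integrable_mult_right[OF fn, of B] w])
      fix x \<xi> :: 'a
      have "norm (w \<xi> * cnj (fourier f \<xi>) * iexp (- (x \<bullet> \<xi>)) * f x) = norm (fourier f \<xi>) * (norm (f x) * w \<xi>)"
        by (simp add: norm_mult w_def)
      also have "\<dots> \<le> B * (norm (f x) * w \<xi>)"
        by (intro mult_right_mono B) (simp add: w_def)
      finally show "norm (case (x, \<xi>) of (x, \<xi>) \<Rightarrow> w \<xi> * cnj (fourier f \<xi>) * iexp (- (x \<bullet> \<xi>)) * f x)
          \<le> B * norm (f x) * w \<xi>"
        by (simp add: mult.assoc)
    qed (simp add: case_prod_beta' borel_prod[symmetric])
  qed
  also have "\<dots> = (\<integral>x. f x * (\<integral>z. complex_of_real (sqrt (2 * pi) ^ DIM('a) * exp (- (norm z)\<^sup>2 / 2))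
          * cnj (f (x + a *\<^sub>R z)) \<partial>lborel) \<partial>lborel)"
  proof (intro Bochner_Integration.integral_cong refl)
    fix x
    have c: "cnj (fourier f \<xi>) = (\<integral>y. iexp (y \<bullet> \<xi>) * cnj (f y) \<partial>lborel)" for \<xi>
      unfolding fourier_def Bochner_Integration.integral_cnj[symmetric] by (simp add: exp_cnj)
    have "(\<integral>\<xi>. w \<xi> * cnj (fourier f \<xi>) * iexp (- (x \<bullet> \<xi>)) \<partial>lborel)
        = (\<integral>\<xi>. (\<integral>y. w \<xi> * iexp ((y - x) \<bullet> \<xi>) * cnj (f y) \<partial>lborel) \<partial>lborel)"
    proof (intro Bochner_Integration.integral_cong refl)
      fix \<xi>
      have e: "w \<xi> * iexp ((y - x) \<bullet> \<xi>) * cnj (f y) = (w \<xi> * iexp (- (x \<bullet> \<xi>))) * (iexp (y \<bullet> \<xi>) * cnj (f y))" for y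
        by (simp add: exp_add[symmetric] algebra_simps inner_diff_left flip: exp_add)
      show "w \<xi> * cnj (fourier f \<xi>) * iexp (- (x \<bullet> \<xi>)) = (\<integral>y. w \<xi> * iexp ((y - x) \<bullet> \<xi>) * cnj (f y) \<partial>lborel)"
        unfolding c e integral_mult_right_zero by (simp only: mult_ac)
    qed
    also have "\<dots> = (\<integral>y. (\<integral>\<xi>. w \<xi> * iexp ((y - x) \<bullet> \<xi>) * cnj (f y) \<partial>lborel) \<partial>lborel)"
    proof (rule lborel_pair.Fubini_integral)
      have [measurable]: "(\<lambda>p::'a\<times>'a. w (snd p) * iexp ((fst p - x) \<bullet> snd p) * cnj (f (fst p))) \<in> borel_measurable (borel \<Otimes>\<^sub>M borel)"
        by measurable
      show "integrable (lborel \<Otimes>\<^sub>M lborel) (\<lambda>(y, \<xi>). w \<xi> * iexp ((y - x) \<bullet> \<xi>) * cnj (f y))"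
        by (rule integrable_pair_lborel_bound[OF _ fn w])
           (auto simp: norm_mult case_prod_beta' borel_prod[symmetric] w_def)
    qed
    also have "\<dots> = (\<integral>y. complex_of_real (inverse a ^ DIM('a) * sqrt (2 * pi) ^ DIM('a) * exp (- (norm ((y - x) /\<^sub>R a))\<^sup>2 / 2)) * cnj (f y) \<partial>lborel)"
      unfolding gaussian_fourier_scaled(2)[OF a, symmetric] w_def by (simp add: mult.commute)
    also have "\<dots> = complex_of_real (\<bar>a\<bar> ^ DIM('a)) * (\<integral>z. complex_of_real (inverse a ^ DIM('a) * sqrt (2 * pi) ^ DIM('a) * exp (- (norm (((x + a *\<^sub>R z) - x) /\<^sub>R a))\<^sup>2 / 2)) * cnj (f (x + a *\<^sub>R z)) \<partial>lborel)"
      by (rule lborel_integral_affine) (use a in auto)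
    also have "\<dots> = (\<integral>z. complex_of_real (sqrt (2 * pi) ^ DIM('a) * exp (- (norm z)\<^sup>2 / 2)) * cnj (f (x + a *\<^sub>R z)) \<partial>lborel)"
      unfolding integral_mult_right_zero[symmetric]
      by (intro Bochner_Integration.integral_cong refl) (use a in \<open>simp add: field_simps\<close>)
    finally show "(\<integral>\<xi>. w \<xi> * cnj (fourier f \<xi>) * iexp (- (x \<bullet> \<xi>)) * f x \<partial>lborel) =
       f x * (\<integral>z. complex_of_real (sqrt (2 * pi) ^ DIM('a) * exp (- (norm z)\<^sup>2 / 2)) * cnj (f (x + a *\<^sub>R z)) \<partial>lborel)"
      by (simp add: mult.commute)
  qed
  finally show ?thesis unfolding w_def .
qed

text \<open>The regularised identity is passed to a = 0 by two different limits. In x it is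
  dominated convergence, where continuity and boundedness of f give the pointwise limit and the
  majorant; in \<xi> it is monotone convergence, which also yields the integrability of the squared
  transform.\<close>

lemma plancherel:
  fixes f :: "'a::euclidean_space \<Rightarrow> complex"
  assumes f: "integrable lborel f" and cont: "continuous_on UNIV f" and bd: "\<And>x. norm (f x) \<le> M"
  shows "has_bochner_integral lborel (\<lambda>\<xi>. (norm (fourier f \<xi>))\<^sup>2)
    ((2 * pi) ^ DIM('a) * (\<integral>x. (norm (f x))\<^sup>2 \<partial>lborel))"
proof -
  have [measurable]: "f \<in> borel_measurable borel" using f by simp
  have M: "M \<ge> 0" using bd[of 0] norm_ge_zero order_trans by blast
  define a where "a n = inverse (real (Suc n))" for n
  have a0: "a n > 0" for n by (simp add: a_def)
  have lim_a: "a \<longlonglongrightarrow> 0" unfolding a_def by (rule LIMSEQ_inverse_real_of_nat)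
  define G where "G z = sqrt (2 * pi) ^ DIM('a) * exp (- (norm z)\<^sup>2 / 2)" for z :: 'a
  have [measurable]: "G \<in> borel_measurable borel" unfolding G_def by measurable
  have G_pos: "G z \<ge> 0" for z by (simp add: G_def)
  have Gi: "integrable lborel G"
    using gaussian_fourier(1)[of "0::'a"] unfolding G_def
    by (intro integrable_mult_right)
      (simp only: inner_zero_left of_real_0 mult_zero_right exp_zero mult_1_left complex_of_real_integrable_eq)
  have "complex_of_real (\<integral>z. exp (- (norm z)\<^sup>2 / 2) \<partial>(lborel::'a measure)) = complex_of_real (sqrt (2 * pi) ^ DIM('a))"
    using gaussian_fourier(2)[of "0::'a"] by simp
  then have "(\<integral>z. G z \<partial>lborel) = sqrt (2 * pi) ^ DIM('a) * sqrt (2 * pi) ^ DIM('a)"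
    unfolding G_def of_real_eq_iff by simp
  also have "\<dots> = (2 * pi) ^ DIM('a)" unfolding power_mult_distrib[symmetric] real_sqrt_mult_self by simp
  finally have Gint: "(\<integral>z. G z \<partial>lborel) = (2 * pi) ^ DIM('a)" .
  \<comment> \<open>\<open>G\<close> has total mass \<open>(2 * pi) ^ DIM('a)\<close>, so
    \<open>S n\<close> is that multiple of a Gaussian average of \<open>cnj f\<close> at scale
    \<open>a n\<close>.\<close>
  define S where "S n x = (\<integral>z. complex_of_real (G z) * cnj (f (x + a n *\<^sub>R z)) \<partial>lborel)" for n x
  have [measurable]: "S n \<in> borel_measurable borel" for n
  proof -
    have [measurable]: "(\<lambda>p::'a\<times>'a. complex_of_real (G (snd p)) * cnj (f (fst p + a n *\<^sub>R snd p))) \<in> borel_measurable (borel \<Otimes>\<^sub>M (lborel::'a measure))"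
      by measurable
    have "(\<lambda>x. \<integral>z. complex_of_real (G z) * cnj (f (x + a n *\<^sub>R z)) \<partial>lborel) \<in> borel_measurable borel"
      by (rule lborel.borel_measurable_lebesgue_integral) (simp add: case_prod_beta')
    then show ?thesis by (simp add: S_def[abs_def])
  qed
  have Slim: "(\<lambda>n. S n x) \<longlonglongrightarrow> (2 * pi) ^ DIM('a) * cnj (f x)" for x
  proof -
    have "(\<lambda>n. S n x) \<longlonglongrightarrow> (\<integral>z. complex_of_real (G z) * cnj (f x) \<partial>lborel)"
      unfolding S_def
    proof (rule integral_dominated_convergence)
      show "integrable lborel (\<lambda>z. G z * M)" using Gi by simp
      have "(\<lambda>n. f (x + a n *\<^sub>R z)) \<longlonglongrightarrow> f (x + 0 *\<^sub>R z)" for z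
      proof (rule isCont_tendsto_compose[of _ f])
        show "isCont f (x + 0 *\<^sub>R z)" using cont by (simp add: continuous_on_eq_continuous_at)
        show "(\<lambda>n. x + a n *\<^sub>R z) \<longlonglongrightarrow> x + 0 *\<^sub>R z" by (intro tendsto_intros lim_a)
      qed
      then show "AE z in lborel. (\<lambda>n. complex_of_real (G z) * cnj (f (x + a n *\<^sub>R z))) \<longlonglongrightarrow> complex_of_real (G z) * cnj (f x)"
        by (intro AE_I2 tendsto_intros) simp
      show "AE z in lborel. norm (complex_of_real (G z) * cnj (f (x + a n *\<^sub>R z))) \<le> G z * M" for n
        using bd G_pos by (auto simp: norm_mult intro!: AE_I2 mult_left_mono)
    qed auto
    then show ?thesis by (simp add: Gint integral_complex_of_real)
  qed
  have Sbd: "norm (S n x) \<le> (2 * pi) ^ DIM('a) * M" for n x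
  proof -
    have b: "integrable lborel (\<lambda>z. complex_of_real (G z) * cnj (f (x + a n *\<^sub>R z)))"
      by (rule Bochner_Integration.integrable_bound[OF integrable_mult_left[OF Gi, of M]])
         (use bd G_pos M in \<open>auto simp: norm_mult abs_mult intro!: AE_I2 mult_left_mono\<close>)
    have "norm (S n x) \<le> (\<integral>z. G z * M \<partial>lborel)"
      unfolding S_def
      by (rule Bochner_Integration.integral_norm_bound_integral)
         (use Gi bd G_pos b in \<open>auto simp: norm_mult intro: mult_left_mono\<close>)
    then show ?thesis by (simp add: Gint)
  qed
  define P where "P n \<xi> = (norm (fourier f \<xi>))\<^sup>2 * exp (- (norm (a n *\<^sub>R \<xi>))\<^sup>2 / 2)" for n \<xi>
  have Pint: "integrable lborel (P n)" for n
  proof -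
    have w: "integrable lborel (\<lambda>\<xi>::'a. exp (- (norm (a n *\<^sub>R \<xi>))\<^sup>2 / 2))"
      using gaussian_fourier_scaled(1)[OF a0[of n], of "0::'a"]
      by (simp only: inner_zero_left of_real_0 mult_zero_right exp_zero mult_1_left complex_of_real_integrable_eq)
    show ?thesis unfolding P_def
      by (rule Bochner_Integration.integrable_bound[OF integrable_mult_right[OF w, of "(\<integral>x. norm (f x) \<partial>lborel)\<^sup>2"]])
         (auto simp: abs_mult intro!: mult_right_mono power_mono norm_fourier_le f)
  qed
  have Peq: "complex_of_real (\<integral>\<xi>. P n \<xi> \<partial>lborel) = (\<integral>x. f x * S n x \<partial>lborel)" for n
    using fourier_gaussian_regularised[OF f a0[of n]]
    unfolding integral_complex_of_real[symmetric] P_def S_def G_def .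
  have "(\<lambda>n. \<integral>x. f x * S n x \<partial>lborel) \<longlonglongrightarrow> (\<integral>x. f x * ((2 * pi) ^ DIM('a) * cnj (f x)) \<partial>lborel)"
    by (rule integral_dominated_convergence[where w = "\<lambda>x. norm (f x) * ((2 * pi) ^ DIM('a) * M)"])
       (use f in \<open>auto simp only: norm_mult borel_measurable_integrable
          intro!: AE_I2 tendsto_mult tendsto_const Slim mult_left_mono Sbd norm_ge_zero integrable_norm
            integrable_mult_left borel_measurable_times \<open>S _ \<in> _\<close>\<close>, measurable)
  also have "(\<integral>x. f x * ((2 * pi) ^ DIM('a) * cnj (f x)) \<partial>lborel)
      = (\<integral>x. complex_of_real ((2 * pi) ^ DIM('a) * (norm (f x))\<^sup>2) \<partial>lborel)"
  proof (intro Bochner_Integration.integral_cong refl)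
    fix x
    have "f x * ((2 * pi) ^ DIM('a) * cnj (f x)) = (2 * pi) ^ DIM('a) * (f x * cnj (f x))"
      by (simp only: mult_ac)
    then show "f x * ((2 * pi) ^ DIM('a) * cnj (f x)) = complex_of_real ((2 * pi) ^ DIM('a) * (norm (f x))\<^sup>2)"
      unfolding complex_norm_square[symmetric] by simp
  qed
  also have "\<dots> = complex_of_real ((2 * pi) ^ DIM('a) * (\<integral>x. (norm (f x))\<^sup>2 \<partial>lborel))"
    unfolding integral_complex_of_real by simp
  finally have lim: "(\<lambda>n. \<integral>\<xi>. P n \<xi> \<partial>lborel) \<longlonglongrightarrow> (2 * pi) ^ DIM('a) * (\<integral>x. (norm (f x))\<^sup>2 \<partial>lborel)"
    unfolding Peq[symmetric] tendsto_of_real_iff .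
  \<comment> \<open>Since \<open>a n\<close> decreases, the Gaussian weights increase to 1.\<close>
  have mono: "mono (\<lambda>n. P n \<xi>)" for \<xi>
  proof (rule incseq_SucI)
    fix n
    have "a (Suc n) \<le> a n" by (simp add: a_def field_simps)
    then have "(norm (a (Suc n) *\<^sub>R \<xi>))\<^sup>2 \<le> (norm (a n *\<^sub>R \<xi>))\<^sup>2"
      using a0[of n] a0[of "Suc n"] by (intro power_mono) (auto intro!: mult_right_mono)
    then show "P n \<xi> \<le> P (Suc n) \<xi>" unfolding P_def by (intro mult_left_mono) auto
  qed
  have Plim: "(\<lambda>n. P n \<xi>) \<longlonglongrightarrow> (norm (fourier f \<xi>))\<^sup>2" for \<xi>
  proof -
    have "(\<lambda>n. P n \<xi>) \<longlonglongrightarrow> (norm (fourier f \<xi>))\<^sup>2 * exp (- (norm (0 *\<^sub>R \<xi>))\<^sup>2 / 2)"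
      unfolding P_def by (intro tendsto_intros lim_a) simp
    then show ?thesis by simp
  qed
  show ?thesis
    by (rule has_bochner_integral_monotone_convergence[OF Pint _ _ lim]) (use mono Plim in auto)
qed

subsection \<open>The smoothly truncated Hilbert kernel\<close>

text \<open>The kernel 1 / (pi t), smoothly cut off below scale a and above scale b. The numerator
  vanishes to second order at 0, so no singularity is left.\<close>

definition hilbert_kernel :: "real \<Rightarrow> real \<Rightarrow> real \<Rightarrow> real"
  where "hilbert_kernel a b t = (exp (- (t / b)\<^sup>2 / 2) - exp (- (t / a)\<^sup>2 / 2)) / (pi * t)"

lemma hilbert_kernel_measurable [measurable]: "hilbert_kernel a b \<in> borel_measurable borel"
  unfolding hilbert_kernel_def by measurable

text \<open>The derivative in \<sigma> of exp (- (t / \<sigma>)^2 / 2) / (pi t). Integrating it over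
  [a, b] recovers the kernel, and each slice is a Gaussian times t, with an explicit
  transform.\<close>

definition kernel_slice :: "real \<Rightarrow> real \<Rightarrow> real"
  where "kernel_slice \<sigma> t = t / (pi * \<sigma> ^ 3) * exp (- (t / \<sigma>)\<^sup>2 / 2)"

text \<open>Integration by parts: g(t) = exp (- i s t - t^2 / 2) has derivative - i s g - h with h =
  t g, and the integral of this derivative is 0 because g tends to 0 at both ends.\<close>

lemma gaussian_first_moment_fourier:
  fixes s :: real
  shows "integrable lborel (\<lambda>t. iexp (- (s * t)) * complex_of_real (t * exp (- t\<^sup>2 / 2)))"
    and "(\<integral>t. iexp (- (s * t)) * complex_of_real (t * exp (- t\<^sup>2 / 2)) \<partial>lborel)
      = - \<i> * s * complex_of_real (sqrt (2 * pi) * exp (- s\<^sup>2 / 2))"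
proof -
  define g where "g t = iexp (- (s * t)) * complex_of_real (exp (- t\<^sup>2 / 2))" for t
  define h where "h t = iexp (- (s * t)) * complex_of_real (t * exp (- t\<^sup>2 / 2))" for t
  have g: "integrable lborel g" "(\<integral>t. g t \<partial>lborel) = complex_of_real (sqrt (2 * pi) * exp (- s\<^sup>2 / 2))"
    using gaussian_fourier_real[of "- s"] unfolding g_def by simp_all
  have "integrable lborel (\<lambda>t. t * std_normal_density t)"
    using integrable_std_normal_moment[of 1] by (simp add: mult.commute)
  then have "integrable lborel (\<lambda>t. sqrt (2 * pi) * (t * std_normal_density t))"
    by (rule integrable_mult_right)
  then have "integrable lborel (\<lambda>t. t * exp (- t\<^sup>2 / 2) :: real)"
    by (simp add: std_normal_density_def field_simps)
  then show i: "integrable lborel (\<lambda>t. iexp (- (s * t)) * complex_of_real (t * exp (- t\<^sup>2 / 2)))"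
    by (rule Bochner_Integration.integrable_bound) (auto simp: norm_mult)
  then have h: "integrable lborel h" unfolding h_def .
  have "(LBINT t=-\<infinity>..\<infinity>. - \<i> * s * g t - h t) = 0 - 0"
  proof (rule interval_integral_FTC_integrable)
    show "(g has_vector_derivative - \<i> * s * g t - h t) (at t)" for t
    proof -
      have g': "g = (\<lambda>t. exp (- \<i> * s * of_real t - (of_real t)\<^sup>2 / 2))"
        by (simp add: fun_eq_iff g_def exp_of_real[symmetric] exp_add[symmetric] mult.assoc del: exp_of_real)
      have h': "h t = t * g t" by (simp add: g_def h_def)
      have "((\<lambda>z. exp (- \<i> * s * z - z\<^sup>2 / 2)) has_field_derivative
          (- \<i> * s - of_real t) * exp (- \<i> * s * of_real t - (of_real t)\<^sup>2 / 2)) (at (of_real t))"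
        by (auto intro!: derivative_eq_intros)
      then have "((\<lambda>t. exp (- \<i> * s * of_real t - (of_real t)\<^sup>2 / 2)) has_vector_derivative
          (- \<i> * s - of_real t) * exp (- \<i> * s * of_real t - (of_real t)\<^sup>2 / 2)) (at t)"
        by (rule has_vector_derivative_real_field)
      then show ?thesis unfolding h' unfolding g' by (simp add: algebra_simps)
    qed
    show "isCont (\<lambda>t. - \<i> * s * g t - h t) t" for t
      unfolding g_def h_def by (intro continuous_intros) auto
    show "set_integrable lborel (einterval (- \<infinity>) \<infinity>) (\<lambda>t. - \<i> * s * g t - h t)"
      using g(1) h by (simp add: set_integrable_def)
    have "((\<lambda>t. exp (- t\<^sup>2 / 2)) \<longlongrightarrow> (0::real)) at_top" "((\<lambda>t. exp (- t\<^sup>2 / 2)) \<longlongrightarrow> (0::real)) at_bot"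
      by real_asymp+
    then have "(g \<longlongrightarrow> 0) at_top" "(g \<longlongrightarrow> 0) at_bot"
      by (auto intro!: tendsto_norm_zero_cancel[of g] simp: g_def norm_mult)
    then show "((g \<circ> real_of_ereal) \<longlongrightarrow> 0) (at_right (- \<infinity>))" "((g \<circ> real_of_ereal) \<longlongrightarrow> 0) (at_left \<infinity>)"
      by (simp_all add: ereal_tendsto_simps)
  qed auto
  then have "(\<integral>t. - \<i> * s * g t - h t \<partial>lborel) = 0"
    by (simp add: interval_lebesgue_integral_def set_lebesgue_integral_def)
  then have "- \<i> * s * (\<integral>t. g t \<partial>lborel) - (\<integral>t. h t \<partial>lborel) = 0"
    using g(1) h by (subst (asm) Bochner_Integration.integral_diff) auto
  then show "(\<integral>t. iexp (- (s * t)) * complex_of_real (t * exp (- t\<^sup>2 / 2)) \<partial>lborel)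
      = - \<i> * s * complex_of_real (sqrt (2 * pi) * exp (- s\<^sup>2 / 2))"
    unfolding h_def[symmetric] g(2) by simp
qed

lemma kernel_slice_fourier:
  assumes "\<sigma> > 0"
  shows "integrable lborel (\<lambda>t. iexp (- (s * t)) * complex_of_real (kernel_slice \<sigma> t))"
    and "(\<integral>t. iexp (- (s * t)) * complex_of_real (kernel_slice \<sigma> t) \<partial>lborel)
     = - \<i> * complex_of_real (sqrt (2 / pi) * (s * exp (- (\<sigma> * s)\<^sup>2 / 2)))"
proof -
  define h where "h t = iexp (- (s * \<sigma> * t)) * complex_of_real (t * exp (- t\<^sup>2 / 2))" for t
  have e: "iexp (- (s * t)) * complex_of_real (kernel_slice \<sigma> t) = complex_of_real (1 / (pi * \<sigma>\<^sup>2)) * h (0 + (1 / \<sigma>) *\<^sub>R t)" for t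
    using assms by (simp add: h_def kernel_slice_def power2_eq_square power3_eq_cube)
  have h: "integrable lborel h"
    "(\<integral>t. h t \<partial>lborel) = - \<i> * (s * \<sigma>) * complex_of_real (sqrt (2 * pi) * exp (- (s * \<sigma>)\<^sup>2 / 2))"
    using gaussian_first_moment_fourier[of "s * \<sigma>"] unfolding h_def by simp_all
  show "integrable lborel (\<lambda>t. iexp (- (s * t)) * complex_of_real (kernel_slice \<sigma> t))"
    unfolding e by (intro integrable_mult_right lborel_integrable_affine h) (use assms in simp)
  have "(\<integral>t. h t \<partial>lborel) = complex_of_real (1 / \<sigma>) * (\<integral>t. h (0 + (1 / \<sigma>) *\<^sub>R t) \<partial>lborel)"
    using h(1) assms by (subst lborel_integral_affine[of h "1 / \<sigma>" 0]) auto
  then have "(\<integral>t. h (0 + (1 / \<sigma>) *\<^sub>R t) \<partial>lborel) = \<sigma> * (\<integral>t. h t \<partial>lborel)"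
    using assms by (simp add: field_simps)
  then have "(\<integral>t. iexp (- (s * t)) * complex_of_real (kernel_slice \<sigma> t) \<partial>lborel)
     = complex_of_real (1 / (pi * \<sigma>\<^sup>2)) * (\<sigma> * (\<integral>t. h t \<partial>lborel))"
    unfolding e by (simp only: integral_mult_right_zero)
  also have "\<dots> = - \<i> * complex_of_real ((1 / (pi * \<sigma>\<^sup>2)) * \<sigma> * (s * \<sigma>) * (sqrt (2 * pi) * exp (- (\<sigma> * s)\<^sup>2 / 2)))"
    unfolding h(2) by (simp add: mult_ac)
  also have "(1 / (pi * \<sigma>\<^sup>2)) * \<sigma> * (s * \<sigma>) * (sqrt (2 * pi) * exp (- (\<sigma> * s)\<^sup>2 / 2))
      = (sqrt (2 * pi) / pi) * (s * exp (- (\<sigma> * s)\<^sup>2 / 2))"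
    using assms by (simp add: power2_eq_square)
  also have "sqrt (2 * pi) / pi = sqrt (2 / pi)"
    by (simp add: real_sqrt_mult real_sqrt_divide real_div_sqrt field_simps)
  finally show "(\<integral>t. iexp (- (s * t)) * complex_of_real (kernel_slice \<sigma> t) \<partial>lborel)
     = - \<i> * complex_of_real (sqrt (2 / pi) * (s * exp (- (\<sigma> * s)\<^sup>2 / 2)))" .
qed

lemma hilbert_kernel_eq_integral:
  assumes "0 < a" "a \<le> b"
  shows "(\<integral>\<sigma>. indicator {a..b} \<sigma> * kernel_slice \<sigma> t \<partial>lborel) = hilbert_kernel a b t"
proof (cases "t = 0")
  case True then show ?thesis by (simp add: hilbert_kernel_def kernel_slice_def)
next
  case False
  have "(\<integral>\<sigma>. indicator {a..b} \<sigma> *\<^sub>R kernel_slice \<sigma> t \<partial>lborel)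
      = exp (- (t / b)\<^sup>2 / 2) / (pi * t) - exp (- (t / a)\<^sup>2 / 2) / (pi * t)"
  proof (rule integral_FTC_Icc)
    fix \<sigma> assume \<sigma>: "a \<le> \<sigma>" "\<sigma> \<le> b"
    have "((\<lambda>\<sigma>. exp (- (t / \<sigma>)\<^sup>2 / 2) / (pi * t)) has_real_derivative kernel_slice \<sigma> t) (at \<sigma>)"
      unfolding kernel_slice_def using \<sigma> assms False
      by (auto intro!: derivative_eq_intros simp: field_simps power2_eq_square power3_eq_cube)
    then show "((\<lambda>\<sigma>. exp (- (t / \<sigma>)\<^sup>2 / 2) / (pi * t)) has_vector_derivative kernel_slice \<sigma> t) (at \<sigma> within {a..b})"
      by (simp add: has_real_derivative_iff_has_vector_derivative has_vector_derivative_at_within)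
  next
    show "continuous_on {a..b} (\<lambda>\<sigma>. kernel_slice \<sigma> t)"
      unfolding kernel_slice_def using assms by (intro continuous_intros) auto
  qed (use assms in auto)
  then show ?thesis by (simp add: hilbert_kernel_def diff_divide_distrib)
qed

text \<open>E plays the role of the error function. The multiplier estimates use its monotonicity
  and its total oscillation, at most the Gaussian mass sqrt (2 pi); the additive constant is left
  free.\<close>

lemma exists_gaussian_antiderivative:
  obtains E :: "real \<Rightarrow> real" where "\<And>x. (E has_real_derivative exp (- x\<^sup>2 / 2)) (at x)" "mono E"
    "\<And>x y. x \<le> y \<Longrightarrow> E y - E x \<le> sqrt (2 * pi)"
proof -
  have "\<exists>E. \<forall>x::real. -\<infinity> < ereal x \<longrightarrow> ereal x < \<infinity> \<longrightarrow> (E has_vector_derivative exp (- x\<^sup>2 / 2)) (at x)"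
    by (rule einterval_antiderivative) auto
  then obtain E where E: "\<And>x. (E has_real_derivative exp (- x\<^sup>2 / 2)) (at x)"
    by (auto simp: has_real_derivative_iff_has_vector_derivative)
  have mono: "mono E"
  proof (rule monoI)
    fix x y :: real assume "x \<le> y"
    then show "E x \<le> E y"
      by (rule DERIV_nonneg_imp_nondecreasing[of x y E]) (use E in force)
  qed
  have "E y - E x \<le> sqrt (2 * pi)" if "x \<le> y" for x y
  proof -
    have g: "integrable lborel (\<lambda>t. exp (- t\<^sup>2 / 2) :: real)" "(\<integral>t. exp (- t\<^sup>2 / 2) \<partial>lborel) = sqrt (2 * pi)"
      using gaussian_fourier_real[of 0]
      by (simp_all add: complex_of_real_integrable_eq of_real_mult[symmetric] del: of_real_mult)
    have "E y - E x = (\<integral>t. indicator {x..y} t *\<^sub>R exp (- t\<^sup>2 / 2) \<partial>lborel)"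
      by (rule integral_FTC_Icc[symmetric])
         (use E that in \<open>auto simp: has_real_derivative_iff_has_vector_derivative has_vector_derivative_at_within intro!: continuous_intros\<close>)
    also have "\<dots> \<le> (\<integral>t. exp (- t\<^sup>2 / 2) \<partial>lborel)"
      by (rule integral_mono)
         (use integrable_mult_indicator[OF _ g(1), of "{x..y}"] g in \<open>auto simp: indicator_def\<close>)
    finally show ?thesis using g by simp
  qed
  with E mono that show thesis by blast
qed

lemma integrable_abs_gaussian:
  fixes b :: real
  assumes "b > 0"
  shows "integrable lborel (\<lambda>t. \<bar>t\<bar> * exp (- (t / b)\<^sup>2 / 2))"
proof -
  define h where "h t = complex_of_real (t * exp (- t\<^sup>2 / 2))" for t
  have "integrable lborel h"
    using gaussian_first_moment_fourier(1)[of 0] unfolding h_def by simp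
  then have "integrable lborel (\<lambda>t. h (0 + (1 / b) *\<^sub>R t))"
    by (rule lborel_integrable_affine) (use assms in simp)
  then have "integrable lborel (\<lambda>t. b * norm (h (0 + (1 / b) *\<^sub>R t)))" by simp
  moreover have "b * norm (h (0 + (1 / b) *\<^sub>R t)) = \<bar>t\<bar> * exp (- (t / b)\<^sup>2 / 2)" for t
    using assms unfolding h_def norm_of_real by (simp add: abs_mult)
  ultimately show ?thesis by (simp only:)
qed

text \<open>For \<sigma> in [a, b] the Gaussian is largest at \<sigma> = b and the power 1 /
  \<sigma>^3 at \<sigma> = a; combining the two extremes gives a majorant that is a product of a
  function of t and one of \<sigma>.\<close>

lemma kernel_slice_pair_integrable:
  assumes "0 < a" "a \<le> b"
  shows "integrable (lborel \<Otimes>\<^sub>M lborel)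
    (\<lambda>(t, \<sigma>). iexp (- (s * t)) * complex_of_real (indicator {a..b} \<sigma> * kernel_slice \<sigma> t))"
proof (rule integrable_pair_lborel_bound)
  show "(\<lambda>(t, \<sigma>). iexp (- (s * t)) * complex_of_real (indicator {a..b} \<sigma> * kernel_slice \<sigma> t)) \<in> borel_measurable borel"
    unfolding kernel_slice_def case_prod_beta' borel_prod[symmetric] by measurable
  show "integrable lborel (\<lambda>t. 1 / (pi * a ^ 3) * (\<bar>t\<bar> * exp (- (t / b)\<^sup>2 / 2)))"
    by (rule integrable_mult_right[OF integrable_abs_gaussian]) (use assms in simp)
  show "integrable lborel (indicator {a..b} :: real \<Rightarrow> real)"
    by (rule integrable_real_indicator) (auto simp: emeasure_lborel_Icc_eq)
  fix t \<sigma>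
  show "norm (case (t, \<sigma>) of (t, \<sigma>) \<Rightarrow> iexp (- (s * t)) * complex_of_real (indicator {a..b} \<sigma> * kernel_slice \<sigma> t))
    \<le> 1 / (pi * a ^ 3) * (\<bar>t\<bar> * exp (- (t / b)\<^sup>2 / 2)) * indicator {a..b} \<sigma>"
  proof (cases "\<sigma> \<in> {a..b}")
    case True
    then have \<sigma>: "a \<le> \<sigma>" "\<sigma> \<le> b" "0 < \<sigma>" using assms by auto
    have "(t / b)\<^sup>2 \<le> (t / \<sigma>)\<^sup>2"
      unfolding power_divide using \<sigma> assms by (intro divide_left_mono power_mono) auto
    moreover have "1 / \<sigma> ^ 3 \<le> 1 / a ^ 3" using \<sigma> assms by (intro divide_left_mono power_mono) auto
    ultimately have "(1 / \<sigma> ^ 3) * (\<bar>t\<bar> / pi) * exp (- (t / \<sigma>)\<^sup>2 / 2) \<le> (1 / a ^ 3) * (\<bar>t\<bar> / pi) * exp (- (t / b)\<^sup>2 / 2)"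
      using \<sigma> assms by (intro mult_mono) auto
    moreover have "norm (iexp (- (s * t)) * complex_of_real (indicator {a..b} \<sigma> * kernel_slice \<sigma> t)) = \<bar>kernel_slice \<sigma> t\<bar>"
      using True unfolding norm_mult norm_iexp norm_of_real by simp
    ultimately show ?thesis using True \<sigma> by (simp add: kernel_slice_def abs_mult mult_ac)
  qed simp
qed

lemma hilbert_kernel_integrable:
  assumes "0 < a" "a \<le> b"
  shows "integrable lborel (hilbert_kernel a b)"
proof -
  have "integrable lborel (\<lambda>t. \<integral>\<sigma>. complex_of_real (indicator {a..b} \<sigma> * kernel_slice \<sigma> t) \<partial>lborel)"
    using lborel_pair.integrable_fst[OF kernel_slice_pair_integrable[OF assms, of 0]] by simp
  then show ?thesis
    unfolding integral_complex_of_real hilbert_kernel_eq_integral[OF assms]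
    by (simp add: complex_of_real_integrable_eq)
qed

lemma hilbert_kernel_fourier_integral:
  assumes "0 < a" "a \<le> b"
  shows "fourier (\<lambda>t. complex_of_real (hilbert_kernel a b t)) s
    = - \<i> * complex_of_real (sqrt (2 / pi) * (\<integral>\<sigma>. indicator {a..b} \<sigma> * (s * exp (- (\<sigma> * s)\<^sup>2 / 2)) \<partial>lborel))"
proof -
  have "fourier (\<lambda>t. complex_of_real (hilbert_kernel a b t)) s
    = (\<integral>t. (\<integral>\<sigma>. iexp (- (s * t)) * complex_of_real (indicator {a..b} \<sigma> * kernel_slice \<sigma> t) \<partial>lborel) \<partial>lborel)"
    unfolding fourier_def integral_mult_right_zero integral_complex_of_real hilbert_kernel_eq_integral[OF assms]
    by (simp add: mult.commute)
  also have "\<dots> = (\<integral>\<sigma>. (\<integral>t. iexp (- (s * t)) * complex_of_real (indicator {a..b} \<sigma> * kernel_slice \<sigma> t) \<partial>lborel) \<partial>lborel)"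
    by (rule lborel_pair.Fubini_integral[symmetric, OF kernel_slice_pair_integrable[OF assms]])
  also have "\<dots> = (\<integral>\<sigma>. - \<i> * complex_of_real (sqrt (2 / pi) * (indicator {a..b} \<sigma> * (s * exp (- (\<sigma> * s)\<^sup>2 / 2)))) \<partial>lborel)"
  proof (intro Bochner_Integration.integral_cong refl)
    fix \<sigma>
    have "(\<integral>t. iexp (- (s * t)) * complex_of_real (indicator {a..b} \<sigma> * kernel_slice \<sigma> t) \<partial>lborel)
      = complex_of_real (indicator {a..b} \<sigma>) * (\<integral>t. iexp (- (s * t)) * complex_of_real (kernel_slice \<sigma> t) \<partial>lborel)"
      unfolding integral_mult_right_zero[symmetric] by (simp only: of_real_mult mult_ac)
    then show "(\<integral>t. iexp (- (s * t)) * complex_of_real (indicator {a..b} \<sigma> * kernel_slice \<sigma> t) \<partial>lborel)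
      = - \<i> * complex_of_real (sqrt (2 / pi) * (indicator {a..b} \<sigma> * (s * exp (- (\<sigma> * s)\<^sup>2 / 2))))"
      using kernel_slice_fourier(2)[of \<sigma> s] assms by (cases "\<sigma> \<in> {a..b}") (simp_all add: mult_ac)
  qed
  finally show ?thesis
    by (simp only: integral_mult_right_zero integral_complex_of_real)
qed

text \<open>The \<sigma>-integral is the increment of E between a s and b s. The result is a smooth
  form of - i sgn s, to which it converges as a tends to 0 and b to infinity.\<close>

lemma hilbert_kernel_fourier_eq:
  assumes "0 < a" "a \<le> b" and E: "\<And>x. (E has_real_derivative exp (- x\<^sup>2 / 2)) (at x)"
  shows "fourier (\<lambda>t. complex_of_real (hilbert_kernel a b t)) s
    = - \<i> * complex_of_real (sqrt (2 / pi) * (E (b * s) - E (a * s)))"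
proof -
  have "(\<integral>\<sigma>. indicator {a..b} \<sigma> *\<^sub>R (s * exp (- (\<sigma> * s)\<^sup>2 / 2)) \<partial>lborel) = E (b * s) - E (a * s)"
  proof (rule integral_FTC_Icc)
    fix \<sigma>
    have "((\<lambda>\<sigma>. E (\<sigma> * s)) has_real_derivative exp (- (\<sigma> * s)\<^sup>2 / 2) * s) (at \<sigma>)"
      by (rule DERIV_chain2[OF E]) (auto intro!: derivative_eq_intros)
    then show "((\<lambda>\<sigma>. E (\<sigma> * s)) has_vector_derivative s * exp (- (\<sigma> * s)\<^sup>2 / 2)) (at \<sigma> within {a..b})"
      by (simp add: has_real_derivative_iff_has_vector_derivative has_vector_derivative_at_within mult.commute)
  qed (use assms in \<open>auto intro!: continuous_intros\<close>)
  then show ?thesis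
    unfolding hilbert_kernel_fourier_integral[OF assms(1,2)] by simp
qed

text \<open>The sum of squares is at most the largest increment times the total variation; for a
  monotone sequence the total variation telescopes to a single difference, so both factors are at
  most \<open>D\<close>.\<close>

lemma sum_squares_increments_le:
  fixes u :: "nat \<Rightarrow> real"
  assumes "mono u \<or> antimono u" and D: "\<And>i j. u i - u j \<le> D"
  shows "(\<Sum>j<n. (u (Suc j) - u j)\<^sup>2) \<le> D\<^sup>2"
proof -
  have D0: "D \<ge> 0" using D[of 0 0] by simp
  have aD: "\<bar>u i - u j\<bar> \<le> D" for i j using D[of i j] D[of j i] by linarith
  have "(\<Sum>j<n. (u (Suc j) - u j)\<^sup>2) \<le> (\<Sum>j<n. D * \<bar>u (Suc j) - u j\<bar>)"
  proof (intro sum_mono)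
    fix j
    have "(u (Suc j) - u j)\<^sup>2 = \<bar>u (Suc j) - u j\<bar> * \<bar>u (Suc j) - u j\<bar>"
      by (simp add: power2_eq_square)
    also have "\<dots> \<le> D * \<bar>u (Suc j) - u j\<bar>" by (intro mult_right_mono aD) simp
    finally show "(u (Suc j) - u j)\<^sup>2 \<le> D * \<bar>u (Suc j) - u j\<bar>" .
  qed
  also have "\<dots> = D * \<bar>u n - u 0\<bar>"
  proof -
    have "(\<Sum>j<n. \<bar>u (Suc j) - u j\<bar>) = \<bar>u n - u 0\<bar>"
      using assms(1)
    proof
      assume m: "mono u"
      then have "(\<Sum>j<n. \<bar>u (Suc j) - u j\<bar>) = (\<Sum>j<n. u (Suc j) - u j)"
        by (intro sum.cong) (auto simp: mono_iff_le_Suc)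
      with m show ?thesis by (simp add: sum_lessThan_telescope monoD)
    next
      assume m: "antimono u"
      then have "(\<Sum>j<n. \<bar>u (Suc j) - u j\<bar>) = (\<Sum>j<n. u j - u (Suc j))"
        by (intro sum.cong) (auto simp: antimono_iff_le_Suc)
      with m show ?thesis by (simp add: sum_lessThan_telescope' antimonoD)
    qed
    then show ?thesis by (simp flip: sum_distrib_left)
  qed
  also have "\<dots> \<le> D * D" using aD D0 by (intro mult_left_mono) auto
  finally show ?thesis by (simp add: power2_eq_square)
qed

text \<open>Up to the factor sqrt (2 / pi) the multiplier is a difference of two monotone functions
  of oscillation at most sqrt (2 pi), whatever a and b. Each has square variation at most 2 pi;
  splitting the square of the difference doubles both, and (2 / pi) (4 pi + 4 pi) = 16. The
  pointwise bound comes out as 4 and is stated with 16 so that one constant serves both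
  uses.\<close>

lemma hilbert_kernel_fourier_bounds:
  assumes ab: "0 < a" "a \<le> b"
  defines "m \<equiv> fourier (\<lambda>t. complex_of_real (hilbert_kernel a b t))"
  shows "(norm (m s))\<^sup>2 \<le> 16"
    and "mono u \<or> antimono u \<Longrightarrow> (\<Sum>j<n. (norm (m (u (Suc j)) - m (u j)))\<^sup>2) \<le> 16"
proof -
  obtain E :: "real \<Rightarrow> real" where E: "\<And>x. (E has_real_derivative exp (- x\<^sup>2 / 2)) (at x)" "mono E"
    "\<And>x y. x \<le> y \<Longrightarrow> E y - E x \<le> sqrt (2 * pi)"
    using exists_gaussian_antiderivative by blast
  have D: "E y - E x \<le> sqrt (2 * pi)" for x y
  proof (cases "x \<le> y")
    case False
    then have "E y - E x \<le> 0" using monoD[OF E(2), of y x] by simp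
    then show ?thesis by (rule order_trans) simp
  qed (rule E(3))
  have m: "m s = - \<i> * complex_of_real (sqrt (2 / pi) * (E (b * s) - E (a * s)))" for s
    unfolding m_def by (rule hilbert_kernel_fourier_eq[OF ab E(1)])
  have "\<bar>E (b * s) - E (a * s)\<bar> \<le> sqrt (2 * pi)" using D[of "b * s" "a * s"] D[of "a * s" "b * s"] by linarith
  then have "\<bar>E (b * s) - E (a * s)\<bar>\<^sup>2 \<le> (sqrt (2 * pi))\<^sup>2" by (rule power_mono) simp
  then have "(E (b * s) - E (a * s))\<^sup>2 \<le> 2 * pi" by simp
  moreover have "(norm (m s))\<^sup>2 = 2 / pi * (E (b * s) - E (a * s))\<^sup>2"
    unfolding m norm_mult norm_of_real by (simp add: power_mult_distrib)
  moreover have "2 / pi * (2 * pi) = 4" by simp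
  ultimately show "(norm (m s))\<^sup>2 \<le> 16"
    using mult_left_mono[of "(E (b * s) - E (a * s))\<^sup>2" "2 * pi" "2 / pi"] by simp
  assume u: "mono u \<or> antimono u"
  \<comment> \<open>A positive dilation keeps the sampling points monotone, hence also the values of
    E at them.\<close>
  have V: "(\<Sum>j<n. (E (c * u (Suc j)) - E (c * u j))\<^sup>2) \<le> 2 * pi" if c: "c > 0" for c
  proof -
    have "mono (\<lambda>j. E (c * u j)) \<or> antimono (\<lambda>j. E (c * u j))"
      using u
    proof
      assume "mono u"
      then show ?thesis using c by (intro disjI1 monoI monoD[OF E(2)] mult_left_mono) (auto dest: monoD)
    next
      assume "antimono u"
      then show ?thesis using c by (intro disjI2 antimonoI monoD[OF E(2)] mult_left_mono) (auto dest: antimonoD)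
    qed
    from sum_squares_increments_le[OF this D, of n] show ?thesis by simp
  qed
  have "(\<Sum>j<n. (norm (m (u (Suc j)) - m (u j)))\<^sup>2)
      = (\<Sum>j<n. 2 / pi * ((E (b * u (Suc j)) - E (b * u j)) - (E (a * u (Suc j)) - E (a * u j)))\<^sup>2)"
  proof (intro sum.cong refl)
    fix j
    have "m (u (Suc j)) - m (u j)
        = - \<i> * complex_of_real (sqrt (2 / pi) * ((E (b * u (Suc j)) - E (b * u j)) - (E (a * u (Suc j)) - E (a * u j))))"
      unfolding m by (simp add: algebra_simps)
    then show "(norm (m (u (Suc j)) - m (u j)))\<^sup>2
        = 2 / pi * ((E (b * u (Suc j)) - E (b * u j)) - (E (a * u (Suc j)) - E (a * u j)))\<^sup>2"
      by (simp only: norm_mult norm_of_real) (simp add: power_mult_distrib)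
  qed
  also have "\<dots> \<le> (\<Sum>j<n. 2 / pi * (2 * (E (b * u (Suc j)) - E (b * u j))\<^sup>2 + 2 * (E (a * u (Suc j)) - E (a * u j))\<^sup>2))"
  proof (intro sum_mono mult_left_mono)
    have "(x - y)\<^sup>2 \<le> 2 * x\<^sup>2 + 2 * y\<^sup>2" for x y :: real
      using zero_le_power2[of "x + y"] by (simp add: power2_eq_square algebra_simps)
    then show "((E (b * u (Suc j)) - E (b * u j)) - (E (a * u (Suc j)) - E (a * u j)))\<^sup>2
      \<le> 2 * (E (b * u (Suc j)) - E (b * u j))\<^sup>2 + 2 * (E (a * u (Suc j)) - E (a * u j))\<^sup>2" for j .
  qed simp
  also have "\<dots> = 2 / pi * (2 * (\<Sum>j<n. (E (b * u (Suc j)) - E (b * u j))\<^sup>2) + 2 * (\<Sum>j<n. (E (a * u (Suc j)) - E (a * u j))\<^sup>2))"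
    by (simp only: sum_distrib_left sum.distrib distrib_left)
  also have "\<dots> \<le> 2 / pi * (2 * (2 * pi) + 2 * (2 * pi))"
    by (intro mult_left_mono add_mono V) (use ab in auto)
  finally show "(\<Sum>j<n. (norm (m (u (Suc j)) - m (u j)))\<^sup>2) \<le> 16" by simp
qed

subsection \<open>Maximal convolutions along arithmetic progressions of directions\<close>

text \<open>The direction is an arbitrary vector rather than one of the form (v, 1), so that
  multiples of the step of a progression, whose last coordinate is 0, can be added to it.\<close>

definition line_conv :: "(real \<Rightarrow> real) \<Rightarrow> 'a::euclidean_space \<Rightarrow> ('a \<Rightarrow> complex) \<Rightarrow> 'a \<Rightarrow> complex"
  where "line_conv k w f x = (\<integral>t. complex_of_real (k t) * f (x - t *\<^sub>R w) \<partial>lborel)"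

lemma line_conv_measurable [measurable]:
  fixes f :: "'a::euclidean_space \<Rightarrow> complex"
  assumes [measurable]: "k \<in> borel_measurable borel" "f \<in> borel_measurable borel"
  shows "line_conv k w f \<in> borel_measurable borel"
proof -
  have [measurable]: "(\<lambda>p. complex_of_real (k (snd p)) * f (fst p - snd p *\<^sub>R w)) \<in> borel_measurable (borel \<Otimes>\<^sub>M (lborel :: real measure))"
    by measurable
  have "(\<lambda>x. \<integral>t. complex_of_real (k t) * f (x - t *\<^sub>R w) \<partial>lborel) \<in> borel_measurable borel"
    by (rule lborel.borel_measurable_lebesgue_integral) (simp add: case_prod_beta')
  then show ?thesis by (simp add: line_conv_def[abs_def])
qed

lemma
  fixes h :: "'a::euclidean_space \<Rightarrow> 'b::{banach, second_countable_topology}"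
  assumes [measurable]: "h \<in> borel_measurable borel"
  shows lborel_integral_translate: "(\<integral>x. h (x - c) \<partial>lborel) = (\<integral>x. h x \<partial>lborel)"
    and lborel_integrable_translate: "integrable lborel (\<lambda>x. h (x - c)) \<longleftrightarrow> integrable lborel h"
proof -
  have "distr lborel borel (\<lambda>x. x - c) = lborel"
    using lborel_distr_plus[of "- c"] unfolding add_uminus_conv_diff[symmetric] by (simp only: add.commute[of _ "- c"])
  then show "(\<integral>x. h (x - c) \<partial>lborel) = (\<integral>x. h x \<partial>lborel)" "integrable lborel (\<lambda>x. h (x - c)) \<longleftrightarrow> integrable lborel h"
    using integral_distr[of "\<lambda>x. x - c" lborel borel h] integrable_distr_eq[of "\<lambda>x. x - c" lborel borel h] by auto
qed

lemma lborel_nn_integral_translate: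
  fixes h :: "'a::euclidean_space \<Rightarrow> ennreal"
  assumes [measurable]: "h \<in> borel_measurable borel"
  shows "(\<integral>\<^sup>+x. h (x - c) \<partial>lborel) = (\<integral>\<^sup>+x. h x \<partial>lborel)"
proof -
  have "distr lborel borel (\<lambda>x. x - c) = lborel"
    using lborel_distr_plus[of "- c"] unfolding add_uminus_conv_diff[symmetric] by (simp only: add.commute[of _ "- c"])
  then show ?thesis
    using nn_integral_distr[of "\<lambda>x. x - c" lborel borel h] by simp
qed

text \<open>The class on which \<open>plancherel\<close> applies. It is stable under differences and
  under \<open>line_conv\<close> with integrable kernel, as the chaining argument requires.\<close>

definition test_function :: "('a::euclidean_space \<Rightarrow> complex) \<Rightarrow> bool"
  where "test_function f \<longleftrightarrow> integrable lborel f \<and> continuous_on UNIV f \<and> (\<exists>M. \<forall>x. norm (f x) \<le> M)"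

lemma test_functionD:
  assumes "test_function f"
  shows "integrable lborel f" "continuous_on UNIV f" "f \<in> borel_measurable borel"
  using assms by (auto simp: test_function_def)

lemma test_function_diff: "test_function f \<Longrightarrow> test_function g \<Longrightarrow> test_function (\<lambda>x. f x - g x)"
proof -
  assume f: "test_function f" and g: "test_function g"
  then obtain M M' where "\<And>x. norm (f x) \<le> M" "\<And>x. norm (g x) \<le> M'" by (auto simp: test_function_def)
  then have "norm (f x - g x) \<le> M + M'" for x
    by (intro order_trans[OF norm_triangle_ineq4] add_mono)
  with f g show ?thesis unfolding test_function_def by (auto intro!: continuous_intros)
qed

lemma test_function_integrable_square:
  assumes "test_function f"
  shows "integrable lborel (\<lambda>x. (norm (f x))\<^sup>2)"
proof -
  from assms obtain M where M: "\<And>x. norm (f x) \<le> M" and f: "integrable lborel f" by (auto simp: test_function_def)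
  show ?thesis
    by (rule Bochner_Integration.integrable_bound[OF integrable_mult_right[OF integrable_norm[OF f], of M]])
       (use f M in \<open>auto simp: power2_eq_square abs_mult intro!: AE_I2 mult_right_mono intro: order_trans[OF _ abs_ge_self]\<close>)
qed

text \<open>The phase is carried along so that one Fubini argument serves both the integrability of
  the convolution, with phase 0, and the computation of its transform.\<close>

lemma line_conv_pair_integrable:
  fixes f :: "'a::euclidean_space \<Rightarrow> complex"
  assumes k: "integrable lborel k" and f: "integrable lborel f" and c: "c \<in> borel_measurable borel"
  shows "integrable (lborel \<Otimes>\<^sub>M lborel) (\<lambda>(t, x). iexp (c x) * (complex_of_real (k t) * f (x - t *\<^sub>R w)))"
proof (rule lborel_pair.Fubini_integrable)
  note [measurable] = borel_measurable_integrable[OF k] borel_measurable_integrable[OF f] c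
  show "(\<lambda>(t, x). iexp (c x) * (complex_of_real (k t) * f (x - t *\<^sub>R w))) \<in> borel_measurable (lborel \<Otimes>\<^sub>M lborel)"
    by measurable
  have tr: "(\<integral>x. norm (f (x - t *\<^sub>R w)) \<partial>lborel) = (\<integral>x. norm (f x) \<partial>lborel)" for t
    by (rule lborel_integral_translate[of "\<lambda>x. norm (f x)"]) measurable
  show "integrable lborel (\<lambda>t. \<integral>x. norm (case (t, x) of (t, x) \<Rightarrow> iexp (c x) * (complex_of_real (k t) * f (x - t *\<^sub>R w))) \<partial>lborel)"
    using k by (simp add: norm_mult tr)
  have "integrable lborel (\<lambda>x. iexp (c x) * (complex_of_real (k t) * f (x - t *\<^sub>R w)))" for t
    by (rule integrable_iexp_mult[OF integrable_mult_right c]) (use f in \<open>simp add: lborel_integrable_translate\<close>)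
  then show "AE t in lborel. integrable lborel (\<lambda>x. case (t, x) of (t, x) \<Rightarrow> iexp (c x) * (complex_of_real (k t) * f (x - t *\<^sub>R w)))"
    by simp
qed

lemma test_function_line_conv:
  fixes f :: "'a::euclidean_space \<Rightarrow> complex"
  assumes k: "integrable lborel k" and nf: "test_function f"
  shows "test_function (line_conv k w f)"
proof -
  note f = test_functionD[OF nf]
  note [measurable] = f(3) borel_measurable_integrable[OF k]
  from nf obtain M where M: "\<And>x. norm (f x) \<le> M" by (auto simp: test_function_def)
  have dom: "norm (complex_of_real (k t) * f x) \<le> M * \<bar>k t\<bar>" for t x
    using mult_right_mono[OF M, of "\<bar>k t\<bar>"] by (simp add: norm_mult mult.commute)
  have int: "integrable lborel (line_conv k w f)"
    using lborel_pair.integrable_snd[OF line_conv_pair_integrable[OF k f(1), of "\<lambda>_. 0" w]]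
    by (simp add: line_conv_def[abs_def])
  moreover have "continuous_on UNIV (line_conv k w f)"
    unfolding continuous_on_sequentially
  proof (intro allI ballI impI, elim conjE)
    fix x X assume X: "X \<longlonglongrightarrow> (x::'a)"
    show "(line_conv k w f \<circ> X) \<longlonglongrightarrow> line_conv k w f x"
      unfolding line_conv_def comp_def
    proof (rule integral_dominated_convergence)
      show "integrable lborel (\<lambda>t. M * \<bar>k t\<bar>)" using k by simp
      have "(\<lambda>n. f (X n - t *\<^sub>R w)) \<longlonglongrightarrow> f (x - t *\<^sub>R w)" for t
      proof (rule isCont_tendsto_compose[of _ f])
        show "isCont f (x - t *\<^sub>R w)" using f(2) by (simp add: continuous_on_eq_continuous_at)
        show "(\<lambda>n. X n - t *\<^sub>R w) \<longlonglongrightarrow> x - t *\<^sub>R w" by (intro tendsto_intros X)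
      qed
      then show "AE t in lborel. (\<lambda>n. complex_of_real (k t) * f (X n - t *\<^sub>R w)) \<longlonglongrightarrow> complex_of_real (k t) * f (x - t *\<^sub>R w)"
        by (intro AE_I2 tendsto_intros)
    qed (use dom in auto)
  qed
  moreover have "norm (line_conv k w f x) \<le> (\<integral>t. M * \<bar>k t\<bar> \<partial>lborel)" for x
    unfolding line_conv_def
  proof (rule Bochner_Integration.integral_norm_bound_integral)
    show i: "integrable lborel (\<lambda>t. M * \<bar>k t\<bar>)" using k by simp
    show "integrable lborel (\<lambda>t. complex_of_real (k t) * f (x - t *\<^sub>R w))"
      by (rule Bochner_Integration.integrable_bound[OF i])
         (use dom in \<open>auto intro!: AE_I2 intro: order_trans[OF _ abs_ge_self]\<close>)
  qed (use dom in auto)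
  ultimately show ?thesis unfolding test_function_def by blast
qed

lemma fourier_line_conv:
  fixes f :: "'a::euclidean_space \<Rightarrow> complex"
  assumes k: "integrable lborel k" and f: "integrable lborel f"
  shows "fourier (line_conv k w f) \<xi> = fourier (\<lambda>t. complex_of_real (k t)) (w \<bullet> \<xi>) * fourier f \<xi>"
proof -
  note [measurable] = borel_measurable_integrable[OF k] borel_measurable_integrable[OF f]
  have "fourier (line_conv k w f) \<xi> = (\<integral>x. (\<integral>t. iexp (- (x \<bullet> \<xi>)) * (complex_of_real (k t) * f (x - t *\<^sub>R w)) \<partial>lborel) \<partial>lborel)"
    unfolding fourier_def line_conv_def integral_mult_right_zero ..
  also have "\<dots> = (\<integral>t. (\<integral>x. iexp (- (x \<bullet> \<xi>)) * (complex_of_real (k t) * f (x - t *\<^sub>R w)) \<partial>lborel) \<partial>lborel)"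
    by (rule lborel_pair.Fubini_integral, rule line_conv_pair_integrable[OF k f]) measurable
  also have "\<dots> = (\<integral>t. iexp (- (t * (w \<bullet> \<xi>))) * complex_of_real (k t) * fourier f \<xi> \<partial>lborel)"
  proof (intro Bochner_Integration.integral_cong refl)
    fix t
    have "(\<integral>x. iexp (- (x \<bullet> \<xi>)) * (complex_of_real (k t) * f (x - t *\<^sub>R w)) \<partial>lborel)
       = (\<integral>x. (iexp (- ((x - t *\<^sub>R w) \<bullet> \<xi>)) * f (x - t *\<^sub>R w)) * (iexp (- (t * (w \<bullet> \<xi>))) * complex_of_real (k t)) \<partial>lborel)"
    proof (intro Bochner_Integration.integral_cong refl)
      fix x
      have "iexp (- (x \<bullet> \<xi>)) = iexp (- ((x - t *\<^sub>R w) \<bullet> \<xi>)) * iexp (- (t * (w \<bullet> \<xi>)))"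
        by (simp add: exp_add[symmetric] inner_diff_left algebra_simps)
      then show "iexp (- (x \<bullet> \<xi>)) * (complex_of_real (k t) * f (x - t *\<^sub>R w)) =
        (iexp (- ((x - t *\<^sub>R w) \<bullet> \<xi>)) * f (x - t *\<^sub>R w)) * (iexp (- (t * (w \<bullet> \<xi>))) * complex_of_real (k t))"
        by (simp only: mult_ac)
    qed
    also have "\<dots> = (\<integral>x. iexp (- ((x - t *\<^sub>R w) \<bullet> \<xi>)) * f (x - t *\<^sub>R w) \<partial>lborel) * (iexp (- (t * (w \<bullet> \<xi>))) * complex_of_real (k t))"
      by (rule integral_mult_left_zero)
    also have "(\<integral>x. iexp (- ((x - t *\<^sub>R w) \<bullet> \<xi>)) * f (x - t *\<^sub>R w) \<partial>lborel) = fourier f \<xi>"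
      unfolding fourier_def by (rule lborel_integral_translate[of "\<lambda>x. iexp (- (x \<bullet> \<xi>)) * f x"]) measurable
    finally show "(\<integral>x. iexp (- (x \<bullet> \<xi>)) * (complex_of_real (k t) * f (x - t *\<^sub>R w)) \<partial>lborel)
       = iexp (- (t * (w \<bullet> \<xi>))) * complex_of_real (k t) * fourier f \<xi>"
      by (simp only: mult_ac)
  qed
  also have "\<dots> = fourier (\<lambda>t. complex_of_real (k t)) (w \<bullet> \<xi>) * fourier f \<xi>"
    unfolding fourier_def[of "\<lambda>t. complex_of_real (k t)"] integral_mult_left_zero[symmetric] by simp
  finally show ?thesis .
qed

text \<open>Almost orthogonality: the hypothesis bounds the sum of the squared multipliers at each
  frequency, so by Plancherel the total squared norm of the family is at most C times that of f,
  however many members the family has.\<close>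

lemma sum_multiplier_bound:
  fixes f :: "'a::euclidean_space \<Rightarrow> complex"
  assumes f: "test_function f" and g: "\<And>j. j \<in> J \<Longrightarrow> test_function (g j)"
    and m: "\<And>j \<xi>. j \<in> J \<Longrightarrow> fourier (g j) \<xi> = m j \<xi> * fourier f \<xi>"
    and C: "\<And>\<xi>. (\<Sum>j\<in>J. (norm (m j \<xi>))\<^sup>2) \<le> C"
  shows "(\<Sum>j\<in>J. (\<integral>x. (norm (g j x))\<^sup>2 \<partial>lborel)) \<le> C * (\<integral>x. (norm (f x))\<^sup>2 \<partial>lborel)"
proof -
  have pl: "integrable lborel (\<lambda>\<xi>. (norm (fourier h \<xi>))\<^sup>2)"
    "(2 * pi) ^ DIM('a) * (\<integral>x. (norm (h x))\<^sup>2 \<partial>lborel) = (\<integral>\<xi>. (norm (fourier h \<xi>))\<^sup>2 \<partial>lborel)"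
    if "test_function h" for h :: "'a \<Rightarrow> complex"
    using that plancherel[of h] unfolding test_function_def has_bochner_integral_iff by metis+
  have "(2 * pi) ^ DIM('a) * (\<Sum>j\<in>J. (\<integral>x. (norm (g j x))\<^sup>2 \<partial>lborel)) = (\<Sum>j\<in>J. (\<integral>\<xi>. (norm (fourier (g j) \<xi>))\<^sup>2 \<partial>lborel))"
    unfolding sum_distrib_left by (intro sum.cong refl pl(2) g)
  also have "\<dots> = (\<integral>\<xi>. (\<Sum>j\<in>J. (norm (fourier (g j) \<xi>))\<^sup>2) \<partial>lborel)"
    by (rule Bochner_Integration.integral_sum[symmetric]) (rule pl(1)[OF g])
  also have "\<dots> \<le> (\<integral>\<xi>. C * (norm (fourier f \<xi>))\<^sup>2 \<partial>lborel)"
  proof (rule integral_mono)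
    fix \<xi>
    have "(\<Sum>j\<in>J. (norm (fourier (g j) \<xi>))\<^sup>2) = (\<Sum>j\<in>J. (norm (m j \<xi>))\<^sup>2) * (norm (fourier f \<xi>))\<^sup>2"
      unfolding sum_distrib_right by (intro sum.cong refl) (simp add: m norm_mult power_mult_distrib)
    also have "\<dots> \<le> C * (norm (fourier f \<xi>))\<^sup>2" by (intro mult_right_mono C) simp
    finally show "(\<Sum>j\<in>J. (norm (fourier (g j) \<xi>))\<^sup>2) \<le> C * (norm (fourier f \<xi>))\<^sup>2" .
  qed (auto intro!: pl(1) g f)
  also have "\<dots> = (2 * pi) ^ DIM('a) * (C * (\<integral>x. (norm (f x))\<^sup>2 \<partial>lborel))"
    by (simp flip: pl(2)[OF f])
  finally show ?thesis by (simp add: mult_le_cancel_left)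
qed

text \<open>Increments over the blocks of length \<open>2 ^ l\<close> between 0 and
  \<open>2 ^ m\<close>. The last block ends at \<open>2 ^ m\<close> itself, one past the indices
  that are estimated.\<close>

definition dyadic_energy :: "nat \<Rightarrow> (nat \<Rightarrow> complex) \<Rightarrow> nat \<Rightarrow> real"
  where "dyadic_energy m a l = (\<Sum>k<2 ^ (m - l). (norm (a (Suc k * 2 ^ l) - a (k * 2 ^ l)))\<^sup>2)"

text \<open>Chaining along the binary digits of j: rounding j down to an even number costs at most
  one increment of length 1, and the even indices form a sequence of the same kind with m smaller by
  1. The single increment used at each scale is bounded by the square root of the whole energy of
  that scale, which no longer depends on j.\<close>

lemma norm_diff_le_dyadic:
  assumes "j < 2 ^ m"
  shows "norm (a j - a 0) \<le> (\<Sum>l<m. sqrt (dyadic_energy m a l))"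
  using assms
proof (induction m arbitrary: a j)
  case 0
  then show ?case by simp
next
  case (Suc m)
  define b where "b i = a (2 * i)" for i
  have j: "j div 2 < 2 ^ m" using Suc.prems by simp
  have "norm (a j - a (2 * (j div 2))) \<le> sqrt (dyadic_energy (Suc m) a 0)"
  proof (cases "even j")
    case True
    then show ?thesis by (simp add: dyadic_energy_def sum_nonneg)
  next
    case False
    then have jj: "j = Suc (2 * (j div 2))" by presburger
    then have "2 * (j div 2) \<in> {..<2 ^ Suc m}" using Suc.prems by simp
    then have "(norm (a (Suc (2 * (j div 2))) - a (2 * (j div 2))))\<^sup>2 \<le> dyadic_energy (Suc m) a 0"
      unfolding dyadic_energy_def
      by (intro order_trans[OF _ member_le_sum[of "2 * (j div 2)"]]) auto
    then show ?thesis using jj by (metis real_le_rsqrt)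
  qed
  moreover have "norm (a (2 * (j div 2)) - a 0) \<le> (\<Sum>l<m. sqrt (dyadic_energy (Suc m) a (Suc l)))"
  proof -
    \<comment> \<open>Doubling the index moves every block up by one generation.\<close>
    have eq: "dyadic_energy m b l = dyadic_energy (Suc m) a (Suc l)" for l
      by (simp add: dyadic_energy_def b_def mult.left_commute)
    show ?thesis using Suc.IH[OF j, of b] unfolding eq by (simp add: b_def)
  qed
  moreover have "norm (a j - a 0) \<le> norm (a j - a (2 * (j div 2))) + norm (a (2 * (j div 2)) - a 0)"
    using norm_triangle_ineq[of "a j - a (2 * (j div 2))" "a (2 * (j div 2)) - a 0"] by simp
  ultimately show ?case by (simp add: sum.lessThan_Suc_shift del: sum.lessThan_Suc)
qed

text \<open>Cauchy-Schwarz over the m scales gives one factor m; the sum over the scales gives a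
  second one when all energies obey the same bound, hence m^2 in the maximal estimate.\<close>

lemma norm_square_le_dyadic:
  assumes "j < 2 ^ m"
  shows "(norm (a j))\<^sup>2 \<le> 2 * (norm (a 0))\<^sup>2 + 2 * real m * (\<Sum>l<m. dyadic_energy m a l)"
proof -
  have "(norm (a j - a 0))\<^sup>2 \<le> (\<Sum>l<m. sqrt (dyadic_energy m a l))\<^sup>2"
    using norm_diff_le_dyadic[OF assms] by (intro power_mono) auto
  also have "\<dots> \<le> (\<Sum>l<m. (sqrt (dyadic_energy m a l))\<^sup>2) * real (card {..<m})"
    by (rule sum_squared_le_sum_of_squares)
  also have "\<dots> = real m * (\<Sum>l<m. dyadic_energy m a l)"
    by (simp add: dyadic_energy_def sum_nonneg)
  finally have 1: "(norm (a j - a 0))\<^sup>2 \<le> real m * (\<Sum>l<m. dyadic_energy m a l)" .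
  have "(norm (a j))\<^sup>2 \<le> (norm (a 0) + norm (a j - a 0))\<^sup>2"
    using norm_triangle_ineq[of "a 0" "a j - a 0"] by (intro power_mono) auto
  also have "\<dots> \<le> 2 * (norm (a 0))\<^sup>2 + 2 * (norm (a j - a 0))\<^sup>2"
    using zero_le_power2[of "norm (a 0) - norm (a j - a 0)"] by (simp add: power2_eq_square algebra_simps)
  finally show ?thesis using 1 by simp
qed

text \<open>The dyadic energies do not depend on the maximising j, so the supremum is gone before
  the integration. The constant is 2 * 16 from the term j = 0 and 2 m * m * 16 from the m
  generations.\<close>

lemma maximal_line_conv_test_function:
  fixes f :: "'a::euclidean_space \<Rightarrow> complex" and w e :: 'a
  assumes ab: "0 < a" "a \<le> b" and f: "test_function f"
  defines "T \<equiv> \<lambda>j::nat. line_conv (hilbert_kernel a b) (w + real j *\<^sub>R e) f"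
  shows "(\<integral>\<^sup>+x. (SUP j\<in>{..<2 ^ m}. ennreal ((norm (T j x))\<^sup>2)) \<partial>lborel)
    \<le> ennreal (32 * (1 + (real m)\<^sup>2)) * (\<integral>\<^sup>+x. ennreal ((norm (f x))\<^sup>2) \<partial>lborel)"
proof -
  note k = hilbert_kernel_integrable[OF ab]
  have T: "test_function (T j)" for j unfolding T_def by (rule test_function_line_conv[OF k f])
  define \<mu> where "\<mu> = fourier (\<lambda>t. complex_of_real (hilbert_kernel a b t))"
  have fT: "fourier (T j) \<xi> = \<mu> ((w + real j *\<^sub>R e) \<bullet> \<xi>) * fourier f \<xi>" for j \<xi>
    unfolding T_def \<mu>_def by (rule fourier_line_conv[OF k test_functionD(1)[OF f]])
  define I where "I = (\<integral>x. (norm (f x))\<^sup>2 \<partial>lborel)"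
  have T0: "(\<integral>x. (norm (T 0 x))\<^sup>2 \<partial>lborel) \<le> 16 * I"
    using sum_multiplier_bound[OF f, of "{0::nat}" T "\<lambda>j \<xi>. \<mu> ((w + real j *\<^sub>R e) \<bullet> \<xi>)" 16] T fT
      hilbert_kernel_fourier_bounds(1)[OF ab] by (simp add: I_def \<mu>_def)
  have D: "(\<Sum>k<2 ^ (m - l). (\<integral>x. (norm (T (Suc k * 2 ^ l) x - T (k * 2 ^ l) x))\<^sup>2 \<partial>lborel)) \<le> 16 * I" for l
    unfolding I_def
  proof (rule sum_multiplier_bound[OF f, where m = "\<lambda>k \<xi>. \<mu> ((w + real (Suc k * 2 ^ l) *\<^sub>R e) \<bullet> \<xi>) - \<mu> ((w + real (k * 2 ^ l) *\<^sub>R e) \<bullet> \<xi>)"])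
    show "test_function (\<lambda>x. T (Suc k * 2 ^ l) x - T (k * 2 ^ l) x)" for k by (intro test_function_diff T)
    show "fourier (\<lambda>x. T (Suc k * 2 ^ l) x - T (k * 2 ^ l) x) \<xi>
      = (\<mu> ((w + real (Suc k * 2 ^ l) *\<^sub>R e) \<bullet> \<xi>) - \<mu> ((w + real (k * 2 ^ l) *\<^sub>R e) \<bullet> \<xi>)) * fourier f \<xi>" for k \<xi>
      unfolding left_diff_distrib fT[symmetric]
      unfolding fourier_def right_diff_distrib
      by (intro Bochner_Integration.integral_diff integrable_iexp_mult test_functionD(1)[OF T]) measurable
    fix \<xi>
    let ?u = "\<lambda>k. (w + real (k * 2 ^ l) *\<^sub>R e) \<bullet> \<xi>"
    \<comment> \<open>For a fixed frequency the sampling points are affine in k, increasing or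
      decreasing with the sign of \<open>e \<bullet> \<xi>\<close>.\<close>
    have "mono ?u \<or> antimono ?u"
    proof (cases "e \<bullet> \<xi> \<ge> 0")
      case True
      then show ?thesis by (intro disjI1 monoI) (auto simp: inner_add_left intro!: mult_right_mono)
    next
      case False
      then show ?thesis by (intro disjI2 antimonoI) (auto simp: inner_add_left intro!: mult_right_mono_neg)
    qed
    then show "(\<Sum>k<2 ^ (m - l). (norm (\<mu> (?u (Suc k)) - \<mu> (?u k)))\<^sup>2) \<le> 16"
      unfolding \<mu>_def by (rule hilbert_kernel_fourier_bounds(2)[OF ab])
  qed
  \<comment> \<open>A majorant for all j at once, integrable as a finite combination of squares of
    test functions.\<close>
  define R where "R x = 2 * (norm (T 0 x))\<^sup>2 + 2 * real m * (\<Sum>l<m. dyadic_energy m (\<lambda>j. T j x) l)" for x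
  have R: "integrable lborel R" unfolding R_def dyadic_energy_def
    by (intro Bochner_Integration.integrable_add integrable_mult_right Bochner_Integration.integrable_sum
        test_function_integrable_square test_function_diff T)
  have "(\<integral>x. R x \<partial>lborel) = 2 * (\<integral>x. (norm (T 0 x))\<^sup>2 \<partial>lborel)
      + 2 * real m * (\<Sum>l<m. (\<Sum>k<2 ^ (m - l). (\<integral>x. (norm (T (Suc k * 2 ^ l) x - T (k * 2 ^ l) x))\<^sup>2 \<partial>lborel)))"
  proof -
    have "integrable lborel (\<lambda>x. (norm (T (Suc k * 2 ^ l) x - T (k * 2 ^ l) x))\<^sup>2)" for k l
      by (intro test_function_integrable_square test_function_diff T)
    moreover have "integrable lborel (\<lambda>x. (norm (T 0 x))\<^sup>2)" by (intro test_function_integrable_square T)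
    ultimately show ?thesis unfolding R_def dyadic_energy_def
      by (subst Bochner_Integration.integral_add) (auto simp del: mult_Suc of_nat_Suc intro!: Bochner_Integration.integrable_sum)
  qed
  also have "\<dots> \<le> 2 * (16 * I) + 2 * real m * (\<Sum>l<m. 16 * I)"
    by (intro add_mono mult_left_mono T0 sum_mono D) auto
  also have "\<dots> = 32 * (1 + (real m)\<^sup>2) * I" by (simp add: power2_eq_square algebra_simps)
  finally have RI: "(\<integral>x. R x \<partial>lborel) \<le> 32 * (1 + (real m)\<^sup>2) * I" .
  have R0: "R x \<ge> 0" for x by (simp add: R_def dyadic_energy_def sum_nonneg)
  have "(\<integral>\<^sup>+x. (SUP j\<in>{..<2 ^ m}. ennreal ((norm (T j x))\<^sup>2)) \<partial>lborel) \<le> (\<integral>\<^sup>+x. ennreal (R x) \<partial>lborel)"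
  proof (intro nn_integral_mono SUP_least ennreal_leI)
    fix x j assume "j \<in> {..<2 ^ m :: nat}"
    then show "(norm (T j x))\<^sup>2 \<le> R x" unfolding R_def by (intro norm_square_le_dyadic) simp
  qed
  also have "\<dots> = ennreal (\<integral>x. R x \<partial>lborel)" using R R0 by (intro nn_integral_eq_integral) auto
  also have "\<dots> \<le> ennreal (32 * (1 + (real m)\<^sup>2) * I)" using RI by (rule ennreal_leI)
  also have "\<dots> = ennreal (32 * (1 + (real m)\<^sup>2)) * ennreal I" by (rule ennreal_mult') simp
  also have "ennreal I = (\<integral>\<^sup>+x. ennreal ((norm (f x))\<^sup>2) \<partial>lborel)"
    unfolding I_def using test_function_integrable_square[OF f] by (intro nn_integral_eq_integral[symmetric]) auto
  finally show ?thesis .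
qed

subsection \<open>Extension to square-integrable functions\<close>

text \<open>Fubini for the indicator of a null set: by translation invariance every t contributes
  measure zero in x, so almost every x has only a null set of bad t.\<close>

lemma AE_lborel_lines:
  fixes w :: "'a::euclidean_space"
  assumes "AE y in lborel. P y"
  shows "AE x in lborel. AE t in lborel. P (x - t *\<^sub>R w)"
proof -
  from assms obtain N where N: "N \<in> null_sets lborel" "{y. \<not> P y} \<subseteq> N"
    by (auto simp: eventually_ae_filter)
  then have [measurable]: "N \<in> sets borel" by auto
  have "(\<integral>\<^sup>+x. (\<integral>\<^sup>+t. indicator N (x - t *\<^sub>R w) \<partial>lborel) \<partial>lborel)
      = (\<integral>\<^sup>+t. (\<integral>\<^sup>+x. indicator N (x - t *\<^sub>R w) \<partial>lborel) \<partial>(lborel :: real measure))"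
    by (rule lborel_pair.Fubini') measurable
  also have "\<dots> = (\<integral>\<^sup>+t. 0 \<partial>(lborel :: real measure))"
    using N(1) by (intro nn_integral_cong) (subst lborel_nn_integral_translate, auto)
  finally have "(\<integral>\<^sup>+x. (\<integral>\<^sup>+t. indicator N (x - t *\<^sub>R w) \<partial>(lborel :: real measure)) \<partial>lborel) = 0" by simp
  then have "AE x in lborel. (\<integral>\<^sup>+t. indicator N (x - t *\<^sub>R w) \<partial>(lborel :: real measure)) = 0"
    by (subst (asm) nn_integral_0_iff_AE) measurable
  then show ?thesis
  proof eventually_elim
    case (elim x)
    then have "AE t in (lborel :: real measure). indicator N (x - t *\<^sub>R w) = (0::ennreal)"
      by (subst (asm) nn_integral_0_iff_AE) measurable
    then show ?case
      by eventually_elim (use N(2) in \<open>auto simp: indicator_def split: if_splits\<close>)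
  qed
qed

text \<open>By |y| \<le> 1 + y^2 it is enough to integrate |k| and |k| h^2 along the line. The
  latter is finite for almost every x by Tonelli, its integral over x being the product of the
  integrals of |k| and h^2.\<close>

lemma AE_integrable_along_lines:
  fixes w :: "'a::euclidean_space" and h :: "'a \<Rightarrow> real"
  assumes k: "integrable lborel k" and [measurable]: "h \<in> borel_measurable borel"
    and h: "(\<integral>\<^sup>+x. ennreal ((h x)\<^sup>2) \<partial>lborel) < \<infinity>"
  shows "AE x in lborel. integrable lborel (\<lambda>t. k t * h (x - t *\<^sub>R w))"
proof -
  note [measurable] = borel_measurable_integrable[OF k]
  have "(\<integral>\<^sup>+x. (\<integral>\<^sup>+t. ennreal (\<bar>k t\<bar> * (h (x - t *\<^sub>R w))\<^sup>2) \<partial>lborel) \<partial>lborel)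
     = (\<integral>\<^sup>+t. (\<integral>\<^sup>+x. ennreal (\<bar>k t\<bar> * (h (x - t *\<^sub>R w))\<^sup>2) \<partial>lborel) \<partial>lborel)"
    by (rule lborel_pair.Fubini') measurable
  also have "\<dots> = (\<integral>\<^sup>+t. ennreal \<bar>k t\<bar> * (\<integral>\<^sup>+x. ennreal ((h x)\<^sup>2) \<partial>lborel) \<partial>lborel)"
  proof (intro nn_integral_cong)
    fix t
    have "(\<integral>\<^sup>+x. ennreal (\<bar>k t\<bar> * (h (x - t *\<^sub>R w))\<^sup>2) \<partial>lborel) = (\<integral>\<^sup>+x. ennreal (\<bar>k t\<bar> * (h x)\<^sup>2) \<partial>lborel)"
      by (rule lborel_nn_integral_translate[of "\<lambda>x. ennreal (\<bar>k t\<bar> * (h x)\<^sup>2)"]) measurable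
    then show "(\<integral>\<^sup>+x. ennreal (\<bar>k t\<bar> * (h (x - t *\<^sub>R w))\<^sup>2) \<partial>lborel) = ennreal \<bar>k t\<bar> * (\<integral>\<^sup>+x. ennreal ((h x)\<^sup>2) \<partial>lborel)"
      by (simp add: ennreal_mult' nn_integral_cmult)
  qed
  also have "\<dots> = (\<integral>\<^sup>+t. ennreal \<bar>k t\<bar> \<partial>lborel) * (\<integral>\<^sup>+x. ennreal ((h x)\<^sup>2) \<partial>lborel)"
    by (rule nn_integral_multc) measurable
  also have "\<dots> < \<infinity>"
    using k h unfolding integrable_iff_bounded by (simp add: ennreal_mult_less_top less_top)
  finally have "AE x in lborel. (\<integral>\<^sup>+t. ennreal (\<bar>k t\<bar> * (h (x - t *\<^sub>R w))\<^sup>2) \<partial>lborel) \<noteq> \<infinity>"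
    by (intro nn_integral_PInf_AE) auto
  then show ?thesis
  proof eventually_elim
    case (elim x)
    have "integrable lborel (\<lambda>t. \<bar>k t\<bar> * (h (x - t *\<^sub>R w))\<^sup>2)"
      unfolding integrable_iff_bounded using elim by (auto simp: less_top abs_mult)
    then have "integrable lborel (\<lambda>t. \<bar>k t\<bar> + \<bar>k t\<bar> * (h (x - t *\<^sub>R w))\<^sup>2)"
      using k by (intro Bochner_Integration.integrable_add) auto
    then show ?case
    proof (rule Bochner_Integration.integrable_bound)
      have b: "\<bar>y\<bar> \<le> 1 + y\<^sup>2" for y :: real
        using zero_le_power2[of "\<bar>y\<bar> - 1"] by (simp add: power2_eq_square algebra_simps abs_if split: if_splits)
      have "norm (k t * h (x - t *\<^sub>R w)) \<le> norm (\<bar>k t\<bar> + \<bar>k t\<bar> * (h (x - t *\<^sub>R w))\<^sup>2)" for t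
      proof -
        have "\<bar>k t\<bar> * \<bar>h (x - t *\<^sub>R w)\<bar> \<le> \<bar>k t\<bar> * (1 + (h (x - t *\<^sub>R w))\<^sup>2)"
          by (intro mult_left_mono b) simp
        then show ?thesis by (simp add: abs_mult algebra_simps)
      qed
      then show "AE t in lborel. norm (k t * h (x - t *\<^sub>R w)) \<le> norm (\<bar>k t\<bar> + \<bar>k t\<bar> * (h (x - t *\<^sub>R w))\<^sup>2)" by simp
    qed measurable
  qed
qed

text \<open>A common square-integrable majorant makes the line integrals converge for almost every
  x, direction by direction. Fatou then handles the supremum on the left, and dominated convergence
  the norms on the right. The lemma is applied with a multiple of the indicator of a ball as
  majorant, and with |f| itself.\<close>

lemma maximal_line_conv_closure:
  fixes w :: "'i \<Rightarrow> 'a::euclidean_space" and F :: "nat \<Rightarrow> 'a \<Rightarrow> complex"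
  assumes J: "finite J" and k: "integrable lborel k"
    and [measurable]: "f \<in> borel_measurable borel" "\<And>n. F n \<in> borel_measurable borel" "h \<in> borel_measurable borel"
    and lim: "AE x in lborel. (\<lambda>n. F n x) \<longlonglongrightarrow> f x"
    and dom: "\<And>n x. norm (F n x) \<le> h x"
    and h: "(\<integral>\<^sup>+x. ennreal ((h x)\<^sup>2) \<partial>lborel) < \<infinity>"
    and F: "\<And>n. (\<integral>\<^sup>+x. (SUP j\<in>J. ennreal ((norm (line_conv k (w j) (F n) x))\<^sup>2)) \<partial>lborel)
      \<le> ennreal C * (\<integral>\<^sup>+x. ennreal ((norm (F n x))\<^sup>2) \<partial>lborel)"
  shows "(\<integral>\<^sup>+x. (SUP j\<in>J. ennreal ((norm (line_conv k (w j) f x))\<^sup>2)) \<partial>lborel)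
      \<le> ennreal C * (\<integral>\<^sup>+x. ennreal ((norm (f x))\<^sup>2) \<partial>lborel)"
proof -
  note [measurable] = borel_measurable_integrable[OF k]
  have J' [measurable]: "countable J" using J by (rule countable_finite)
  have conv: "AE x in lborel. (\<lambda>n. line_conv k (w j) (F n) x) \<longlonglongrightarrow> line_conv k (w j) f x" for j
    using AE_integrable_along_lines[OF k assms(5) h, of "w j"] AE_lborel_lines[OF lim, of "w j"]
  proof eventually_elim
    case (elim x)
    show ?case unfolding line_conv_def
    proof (rule integral_dominated_convergence)
      show "integrable lborel (\<lambda>t. norm (k t * h (x - t *\<^sub>R w j)))" using elim(1) by (rule integrable_norm)
      show "AE t in lborel. (\<lambda>n. complex_of_real (k t) * F n (x - t *\<^sub>R w j)) \<longlonglongrightarrow> complex_of_real (k t) * f (x - t *\<^sub>R w j)"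
        using elim(2) by eventually_elim (intro tendsto_intros)
      have "norm (complex_of_real (k t) * F n (x - t *\<^sub>R w j)) \<le> norm (k t * h (x - t *\<^sub>R w j))" for n t
        using mult_left_mono[OF order_trans[OF dom abs_ge_self] abs_ge_zero] by (simp add: norm_mult abs_mult)
      then show "AE t in lborel. norm (complex_of_real (k t) * F n (x - t *\<^sub>R w j)) \<le> norm (k t * h (x - t *\<^sub>R w j))" for n
        by simp
    qed measurable
  qed
  define S where "S n x = (SUP j\<in>J. ennreal ((norm (line_conv k (w j) (F n) x))\<^sup>2))" for n x
  have [measurable]: "S n \<in> borel_measurable borel" for n
    unfolding S_def by measurable
  have "AE x in lborel. \<forall>j\<in>J. (\<lambda>n. line_conv k (w j) (F n) x) \<longlonglongrightarrow> line_conv k (w j) f x"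
    using conv by (intro AE_finite_allI J)
  then have "AE x in lborel. (SUP j\<in>J. ennreal ((norm (line_conv k (w j) f x))\<^sup>2)) \<le> liminf (\<lambda>n. S n x)"
  proof eventually_elim
    case (elim x)
    show ?case
    proof (rule SUP_least)
      fix j assume j: "j \<in> J"
      with elim have "(\<lambda>n. ennreal ((norm (line_conv k (w j) (F n) x))\<^sup>2)) \<longlonglongrightarrow> ennreal ((norm (line_conv k (w j) f x))\<^sup>2)"
        by (intro tendsto_intros) auto
      then have "ennreal ((norm (line_conv k (w j) f x))\<^sup>2) = liminf (\<lambda>n. ennreal ((norm (line_conv k (w j) (F n) x))\<^sup>2))"
        by (intro lim_imp_Liminf[symmetric]) auto
      also have "\<dots> \<le> liminf (\<lambda>n. S n x)"
        unfolding S_def by (intro Liminf_mono always_eventually allI SUP_upper j)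
      finally show "ennreal ((norm (line_conv k (w j) f x))\<^sup>2) \<le> liminf (\<lambda>n. S n x)" .
    qed
  qed
  then have "(\<integral>\<^sup>+x. (SUP j\<in>J. ennreal ((norm (line_conv k (w j) f x))\<^sup>2)) \<partial>lborel) \<le> (\<integral>\<^sup>+x. liminf (\<lambda>n. S n x) \<partial>lborel)"
    by (rule nn_integral_mono_AE)
  also have "\<dots> \<le> liminf (\<lambda>n. \<integral>\<^sup>+x. S n x \<partial>lborel)"
    by (rule nn_integral_liminf) measurable
  also have "\<dots> \<le> liminf (\<lambda>n. ennreal C * (\<integral>\<^sup>+x. ennreal ((norm (F n x))\<^sup>2) \<partial>lborel))"
    unfolding S_def by (intro Liminf_mono always_eventually allI F)
  also have "\<dots> = ennreal C * (\<integral>\<^sup>+x. ennreal ((norm (f x))\<^sup>2) \<partial>lborel)"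
  proof (rule lim_imp_Liminf)
    have "(\<lambda>n. \<integral>\<^sup>+x. ennreal ((norm (F n x))\<^sup>2) \<partial>lborel) \<longlonglongrightarrow> (\<integral>\<^sup>+x. ennreal ((norm (f x))\<^sup>2) \<partial>lborel)"
    proof (rule nn_integral_dominated_convergence[OF _ _ _ _ h])
      show "AE x in lborel. (\<lambda>n. ennreal ((norm (F n x))\<^sup>2)) \<longlonglongrightarrow> ennreal ((norm (f x))\<^sup>2)"
        using lim by eventually_elim (intro tendsto_intros)
      show "AE x in lborel. ennreal ((norm (F n x))\<^sup>2) \<le> ennreal ((h x)\<^sup>2)" for n
        by (intro AE_I2 ennreal_leI power_mono dom) auto
    qed measurable
    then show "(\<lambda>n. ennreal C * (\<integral>\<^sup>+x. ennreal ((norm (F n x))\<^sup>2) \<partial>lborel)) \<longlonglongrightarrow> ennreal C * (\<integral>\<^sup>+x. ennreal ((norm (f x))\<^sup>2) \<partial>lborel)"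
      by (intro ennreal_tendsto_cmult) auto
  qed simp
  finally show ?thesis .
qed

lemma nn_integral_square_ball_less_top:
  "(\<integral>\<^sup>+x. ennreal ((B * indicator (cball (0::'a::euclidean_space) R) x)\<^sup>2) \<partial>lborel) < \<infinity>"
proof -
  have "ennreal ((B * indicator (cball 0 R) x)\<^sup>2) = ennreal (B\<^sup>2) * indicator (cball 0 R) x" for x :: 'a
    by (simp add: indicator_def)
  then show ?thesis
    using emeasure_bounded_finite[OF bounded_cball, of "0::'a" R]
    by (simp add: nn_integral_cmult_indicator ennreal_mult_less_top)
qed

text \<open>Measurability provides continuous functions converging to f almost everywhere; cutting
  them off in value and in space turns them into test functions under a common majorant.\<close>

lemma maximal_line_conv_extend_bounded:
  fixes w :: "'i \<Rightarrow> 'a::euclidean_space" and f :: "'a \<Rightarrow> complex"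
  assumes J: "finite J" and k: "integrable lborel k"
    and test_function: "\<And>g. test_function g \<Longrightarrow> (\<integral>\<^sup>+x. (SUP j\<in>J. ennreal ((norm (line_conv k (w j) g x))\<^sup>2)) \<partial>lborel)
      \<le> ennreal C * (\<integral>\<^sup>+x. ennreal ((norm (g x))\<^sup>2) \<partial>lborel)"
    and [measurable]: "f \<in> borel_measurable borel"
    and B: "\<And>x. norm (f x) \<le> B" and R: "\<And>x. norm x > R \<Longrightarrow> f x = 0"
  shows "(\<integral>\<^sup>+x. (SUP j\<in>J. ennreal ((norm (line_conv k (w j) f x))\<^sup>2)) \<partial>lborel)
      \<le> ennreal C * (\<integral>\<^sup>+x. ennreal ((norm (f x))\<^sup>2) \<partial>lborel)"
proof -
  have B0: "B + 1 > 0" using order_trans[OF norm_ge_zero B[of 0]] by simp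
  have "f \<in> borel_measurable (lebesgue_on UNIV)"
    unfolding lebesgue_on_UNIV_eq by (rule measurable_completion) simp
  then have "f measurable_on UNIV" by (simp add: measurable_on_iff_borel_measurable)
  then obtain N g where N: "negligible N" and g: "\<And>n. continuous_on UNIV (g n)"
    and gl: "\<And>x. x \<notin> N \<Longrightarrow> (\<lambda>n::nat. g n x) \<longlonglongrightarrow> f x"
    unfolding measurable_on_def by auto
  \<comment> \<open>Radial retraction onto the ball of radius B + 1, the identity on the values of
    f. The added 1 keeps the radius positive when B = 0.\<close>
  define clip where "clip z = z /\<^sub>R max 1 (norm z / (B + 1))" for z :: complex
  have clip_cont: "continuous_on UNIV clip" unfolding clip_def
    by (intro continuous_intros) (use B0 in auto)
  have clip_f: "clip (f x) = f x" for x using B[of x] B0 by (simp add: clip_def max_def divide_le_eq)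
  have clip_bd: "norm (clip z) \<le> B + 1" for z
  proof -
    have "(B + 1) * (norm z / (B + 1)) \<le> (B + 1) * max 1 (norm z / (B + 1))"
      using B0 by (intro mult_left_mono) auto
    then have "norm z / max 1 (norm z / (B + 1)) \<le> B + 1"
      using B0 by (subst pos_divide_le_eq) auto
    then show ?thesis by (simp add: clip_def divide_inverse_commute)
  qed
  \<comment> \<open>A continuous cutoff, 1 on the ball of radius R and 0 outside radius R + 1, so
    that multiplying f by it changes nothing.\<close>
  define \<eta> where "\<eta> x = max 0 (min 1 (R + 1 - norm x))" for x :: 'a
  have \<eta>: "0 \<le> \<eta> x" "\<eta> x \<le> indicator (cball 0 (R + 1)) x" for x by (auto simp: \<eta>_def indicator_def)
  have f\<eta>: "\<eta> x *\<^sub>R f x = f x" for x using R[of x] by (cases "norm x > R") (auto simp: \<eta>_def)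
  define F where "F n x = \<eta> x *\<^sub>R clip (g n x)" for n x
  have Fc: "continuous_on UNIV (F n)" for n
    unfolding F_def \<eta>_def
    by (intro continuous_intros continuous_on_compose2[OF clip_cont g]) auto
  have [measurable]: "F n \<in> borel_measurable borel" for n
    by (rule borel_measurable_continuous_onI[OF Fc])
  define h where "h x = (B + 1) * indicator (cball (0::'a) (R + 1)) x" for x
  have dom: "norm (F n x) \<le> h x" for n x
  proof -
    have "norm (F n x) = \<eta> x * norm (clip (g n x))" using \<eta> by (simp add: F_def)
    also have "\<dots> \<le> indicator (cball 0 (R + 1)) x * (B + 1)" by (intro mult_mono \<eta> clip_bd) auto
    finally show ?thesis by (simp add: h_def mult.commute)
  qed
  have hi: "integrable lborel h" unfolding h_def
    by (intro integrable_mult_right integrable_real_indicator emeasure_bounded_finite) auto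
  have nF: "test_function (F n)" for n
    unfolding test_function_def
  proof (intro conjI exI allI)
    show "integrable lborel (F n)"
      by (rule Bochner_Integration.integrable_bound[OF hi])
         (auto intro!: AE_I2 order_trans[OF dom abs_ge_self])
    show "norm (F n x) \<le> B + 1" for x
      using dom[of n x] B0 by (cases "norm x \<le> R + 1") (auto simp: h_def)
  qed (rule Fc)
  have lim: "AE x in lborel. (\<lambda>n. F n x) \<longlonglongrightarrow> f x"
  proof -
    have "AE x in lebesgue. x \<notin> N" using N by (simp add: negligible_iff_null_sets AE_not_in)
    then have "AE x in lborel. x \<notin> N" by (simp add: AE_completion_iff)
    then show ?thesis
    proof eventually_elim
      case (elim x)
      have "(\<lambda>n. \<eta> x *\<^sub>R clip (g n x)) \<longlonglongrightarrow> \<eta> x *\<^sub>R clip (f x)"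
        by (intro tendsto_intros isCont_tendsto_compose[of _ clip] gl[OF elim])
           (use clip_cont in \<open>auto simp: continuous_on_eq_continuous_at\<close>)
      then show ?case by (simp add: F_def clip_f f\<eta>)
    qed
  qed
  show ?thesis
  proof (rule maximal_line_conv_closure[OF J k _ _ _ lim dom _ test_function[OF nF]])
    show "(\<integral>\<^sup>+x. ennreal ((h x)\<^sup>2) \<partial>lborel) < \<infinity>"
      unfolding h_def by (rule nn_integral_square_ball_less_top)
    show "h \<in> borel_measurable borel" using hi by simp
  qed measurable
qed

text \<open>Truncating f both in space and in value reduces to the bounded case, with |f| as the
  common majorant.\<close>

lemma maximal_line_conv_extend:
  fixes w :: "'i \<Rightarrow> 'a::euclidean_space" and f :: "'a \<Rightarrow> complex"
  assumes J: "finite J" and k: "integrable lborel k"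
    and test_function: "\<And>g. test_function g \<Longrightarrow> (\<integral>\<^sup>+x. (SUP j\<in>J. ennreal ((norm (line_conv k (w j) g x))\<^sup>2)) \<partial>lborel)
      \<le> ennreal C * (\<integral>\<^sup>+x. ennreal ((norm (g x))\<^sup>2) \<partial>lborel)"
    and [measurable]: "f \<in> borel_measurable borel"
    and f: "(\<integral>\<^sup>+x. ennreal ((norm (f x))\<^sup>2) \<partial>lborel) < \<infinity>"
  shows "(\<integral>\<^sup>+x. (SUP j\<in>J. ennreal ((norm (line_conv k (w j) f x))\<^sup>2)) \<partial>lborel)
      \<le> ennreal C * (\<integral>\<^sup>+x. ennreal ((norm (f x))\<^sup>2) \<partial>lborel)"
proof -
  define F where "F n x = (if norm x \<le> real n \<and> norm (f x) \<le> real n then f x else 0)" for n x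
  have [measurable]: "F n \<in> borel_measurable borel" for n unfolding F_def by measurable
  show ?thesis
  proof (rule maximal_line_conv_closure[OF J k _ _ _ _ _ f])
    have "(\<lambda>n. F n x) \<longlonglongrightarrow> f x" for x
    proof (rule tendsto_eventually)
      show "eventually (\<lambda>n. F n x = f x) sequentially"
        using eventually_ge_at_top[of "nat \<lceil>max (norm x) (norm (f x))\<rceil>"]
        by eventually_elim (auto simp: F_def)
    qed
    then show "AE x in lborel. (\<lambda>n. F n x) \<longlonglongrightarrow> f x" by simp
    show "norm (F n x) \<le> norm (f x)" for n x by (simp add: F_def)
    show "(\<integral>\<^sup>+x. (SUP j\<in>J. ennreal ((norm (line_conv k (w j) (F n) x))\<^sup>2)) \<partial>lborel)
      \<le> ennreal C * (\<integral>\<^sup>+x. ennreal ((norm (F n x))\<^sup>2) \<partial>lborel)" for n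
      by (rule maximal_line_conv_extend_bounded[OF J k test_function, where B = n and R = n]) (auto simp: F_def)
  qed measurable
qed

subsection \<open>Principal values\<close>

text \<open>The interval is half-open to match the strict inequality in the sharp truncation sets;
  the endpoint is a null set.\<close>

lemma rayleigh_integral:
  fixes r :: real
  assumes "0 \<le> r"
  shows "has_bochner_integral lborel (\<lambda>\<tau>. indicator {0..<r} \<tau> * (\<tau> * exp (- \<tau>\<^sup>2 / 2))) (1 - exp (- r\<^sup>2 / 2))"
proof -
  have i: "integrable lborel (\<lambda>\<tau>::real. indicator {0..r} \<tau> *\<^sub>R (\<tau> * exp (- \<tau>\<^sup>2 / 2)))"
    by (rule borel_integrable_atLeastAtMost'[unfolded set_integrable_def]) (auto intro!: continuous_intros)
  have "(\<integral>\<tau>. indicator {0..r} \<tau> *\<^sub>R (\<tau> * exp (- \<tau>\<^sup>2 / 2)) \<partial>lborel) = - exp (- r\<^sup>2 / 2) - - exp (- 0\<^sup>2 / 2)"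
  proof (rule integral_FTC_Icc)
    show "((\<lambda>\<tau>. - exp (- \<tau>\<^sup>2 / 2)) has_vector_derivative \<tau> * exp (- \<tau>\<^sup>2 / 2)) (at \<tau> within {0..r})" for \<tau> :: real
    proof -
      have "((\<lambda>\<tau>. - exp (- \<tau>\<^sup>2 / 2)) has_real_derivative \<tau> * exp (- \<tau>\<^sup>2 / 2)) (at \<tau>)"
        by (auto intro!: derivative_eq_intros)
      then show ?thesis
        by (simp add: has_real_derivative_iff_has_vector_derivative has_vector_derivative_at_within)
    qed
  qed (use assms in \<open>auto intro!: continuous_intros\<close>)
  with i have "has_bochner_integral lborel (\<lambda>\<tau>. indicator {0..r} \<tau> * (\<tau> * exp (- \<tau>\<^sup>2 / 2))) (1 - exp (- r\<^sup>2 / 2))"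
    by (simp add: has_bochner_integral_iff)
  then show ?thesis
    by (rule has_bochner_integral_cong_AE[THEN iffD1, rotated -1])
       (use AE_lborel_singleton[of r] in \<open>auto simp: indicator_def elim!: eventually_mono\<close>)
qed

lemma rayleigh_total:
  "has_bochner_integral lborel (\<lambda>\<tau>::real. indicator {0..} \<tau> * (\<tau> * exp (- \<tau>\<^sup>2 / 2))) 1"
proof -
  define g where "g n \<tau> = indicator {0..<real n} \<tau> * (\<tau> * exp (- \<tau>\<^sup>2 / 2))" for n :: nat and \<tau> :: real
  have g: "has_bochner_integral lborel (g n) (1 - exp (- (real n)\<^sup>2 / 2))" for n
    unfolding g_def by (rule rayleigh_integral) simp
  then have gi: "integrable lborel (g n)" for n by (simp add: has_bochner_integral_iff)
  show ?thesis
  proof (rule has_bochner_integral_monotone_convergence[OF gi])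
    show "AE \<tau> in lborel. mono (\<lambda>n. g n \<tau>)"
      by (intro AE_I2 monoI) (auto simp: g_def indicator_def)
    have "(\<lambda>n. g n \<tau>) \<longlonglongrightarrow> indicator {0..} \<tau> * (\<tau> * exp (- \<tau>\<^sup>2 / 2))" for \<tau>
    proof (rule tendsto_eventually)
      show "eventually (\<lambda>n. g n \<tau> = indicator {0..} \<tau> * (\<tau> * exp (- \<tau>\<^sup>2 / 2))) sequentially"
        using eventually_gt_at_top[of "nat \<lceil>\<tau>\<rceil>"]
      proof eventually_elim
        case (elim n)
        then have "\<tau> < real n" using real_nat_ceiling_ge[of \<tau>] by linarith
        then show ?case by (simp add: g_def indicator_def)
      qed
    qed
    then show "AE \<tau> in lborel. (\<lambda>n. g n \<tau>) \<longlonglongrightarrow> indicator {0..} \<tau> * (\<tau> * exp (- \<tau>\<^sup>2 / 2))" by simp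
    show "(\<lambda>n. \<integral>\<tau>. g n \<tau> \<partial>lborel) \<longlonglongrightarrow> 1"
      unfolding has_bochner_integral_integral_eq[OF g] by real_asymp
  qed measurable
qed

text \<open>The smooth truncation \<open>1 - exp (- (t/a)\<^sup>2 / 2)\<close> is the average of the sharp truncations at
  height \<open>a \<tau>\<close> against the Rayleigh density \<open>\<tau> exp (- \<tau>\<^sup>2 / 2)\<close>.\<close>

lemma smooth_truncation_average:
  fixes \<psi> :: "real \<Rightarrow> complex"
  assumes a: "a > 0" and [measurable]: "\<psi> \<in> borel_measurable borel"
    and int: "integrable lborel (\<lambda>t. \<psi> t * complex_of_real (1 - exp (- (t / a)\<^sup>2 / 2)))"
  shows "(\<integral>t. \<psi> t * complex_of_real (1 - exp (- (t / a)\<^sup>2 / 2)) \<partial>lborel)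
     = (\<integral>\<tau>. complex_of_real (indicator {0..} \<tau> * (\<tau> * exp (- \<tau>\<^sup>2 / 2))) * (LBINT t:{t. \<bar>t\<bar> > a * \<tau>}. \<psi> t) \<partial>lborel)"
proof -
  define H where "H t \<tau> = \<psi> t * complex_of_real (indicator {0..<\<bar>t\<bar> / a} \<tau> * (\<tau> * exp (- \<tau>\<^sup>2 / 2)))" for t \<tau>
  \<comment> \<open>One region of the (t, \<tau>) plane, read for fixed t as an interval of \<tau>
    and for fixed \<tau> as a truncation set; Fubini compares the two readings.\<close>
  have i: "indicator {0..<\<bar>t\<bar> / a} \<tau> = (indicator {0..} \<tau> :: real) * indicator {t. \<bar>t\<bar> > a * \<tau>} t" for t \<tau>
    using a by (auto simp: indicator_def field_simps)
  have [measurable]: "(\<lambda>p. H (fst p) (snd p)) \<in> borel_measurable (borel \<Otimes>\<^sub>M borel)"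
    unfolding H_def i by (simp add: indicator_def) measurable
  have ray: "has_bochner_integral lborel (\<lambda>\<tau>. indicator {0..<\<bar>t\<bar> / a} \<tau> * (\<tau> * exp (- \<tau>\<^sup>2 / 2))) (1 - exp (- (t / a)\<^sup>2 / 2))" for t
    using rayleigh_integral[of "\<bar>t\<bar> / a"] a by (simp add: power_divide)
  note tail = has_bochner_integral_integral_eq[OF ray]
  have gi: "integrable lborel (\<lambda>\<tau>::real. indicator {0..<\<bar>t\<bar> / a} \<tau> * (\<tau> * exp (- \<tau>\<^sup>2 / 2)))" for t
    using ray[of t] by (simp add: has_bochner_integral_iff)
  have "integrable (lborel \<Otimes>\<^sub>M lborel) (\<lambda>(t, \<tau>). H t \<tau>)"
  proof (rule lborel_pair.Fubini_integrable)
    have "norm (H t \<tau>) = norm (\<psi> t) * (indicator {0..<\<bar>t\<bar> / a} \<tau> * (\<tau> * exp (- \<tau>\<^sup>2 / 2)))" for t \<tau>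
      unfolding H_def norm_mult norm_of_real by (auto simp: indicator_def abs_mult)
    then have "(\<integral>\<tau>. norm (H t \<tau>) \<partial>lborel) = norm (\<psi> t) * (1 - exp (- (t / a)\<^sup>2 / 2))" for t
      by (simp only: integral_mult_right_zero tail)
    also have "norm (\<psi> t) * (1 - exp (- (t / a)\<^sup>2 / 2)) = norm (\<psi> t * complex_of_real (1 - exp (- (t / a)\<^sup>2 / 2)))" for t
      unfolding norm_mult norm_of_real by simp
    finally show "integrable lborel (\<lambda>t. \<integral>\<tau>. norm (case (t, \<tau>) of (t, \<tau>) \<Rightarrow> H t \<tau>) \<partial>lborel)"
      using int by simp
    show "AE t in lborel. integrable lborel (\<lambda>\<tau>. case (t, \<tau>) of (t, \<tau>) \<Rightarrow> H t \<tau>)"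
      unfolding H_def prod.case
      by (intro AE_I2 integrable_mult_right integrable_of_real gi)
  qed (simp add: case_prod_beta')
  then have "(\<integral>\<tau>. (\<integral>t. H t \<tau> \<partial>lborel) \<partial>lborel) = (\<integral>t. (\<integral>\<tau>. H t \<tau> \<partial>lborel) \<partial>lborel)"
    by (rule lborel_pair.Fubini_integral)
  moreover have "(\<integral>\<tau>. H t \<tau> \<partial>lborel) = \<psi> t * complex_of_real (1 - exp (- (t / a)\<^sup>2 / 2))" for t
    unfolding H_def integral_mult_right_zero integral_complex_of_real tail ..
  moreover have "(\<integral>t. H t \<tau> \<partial>lborel) = complex_of_real (indicator {0..} \<tau> * (\<tau> * exp (- \<tau>\<^sup>2 / 2))) * (LBINT t:{t. \<bar>t\<bar> > a * \<tau>}. \<psi> t)" for \<tau>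
    unfolding set_lebesgue_integral_def integral_mult_right_zero[symmetric] H_def i
    by (intro Bochner_Integration.integral_cong refl) (simp add: scaleR_conv_of_real mult_ac)
  ultimately show ?thesis by simp
qed

text \<open>The kernel is 1 / pi times the difference of two smooth truncations of 1 / t, at heights
  1 / (n + 1) and n + 1. The former is an average of sharp truncations at heights tending to 0, so
  it inherits their limit; the latter tends to 0.\<close>

lemma kernel_integral_tendsto_principal_value:
  fixes \<phi> :: "real \<Rightarrow> complex"
  assumes [measurable]: "\<phi> \<in> borel_measurable borel"
    and loc: "set_integrable lborel {-1..1} \<phi>"
    and tails: "\<And>\<epsilon>. \<epsilon> > 0 \<Longrightarrow> set_integrable lborel {t. \<bar>t\<bar> > \<epsilon>} (\<lambda>t. \<phi> t / complex_of_real t)"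
    and lim: "((\<lambda>\<epsilon>. LBINT t:{t. \<bar>t\<bar> > \<epsilon>}. \<phi> t / complex_of_real t) \<longlongrightarrow> L) (at_right 0)"
  shows "(\<lambda>n. \<integral>t. complex_of_real (hilbert_kernel (1 / real (Suc n)) (real (Suc n)) t) * \<phi> t \<partial>lborel)
     \<longlonglongrightarrow> complex_of_real (1 / pi) * L"
proof -
  define \<psi> where "\<psi> t = \<phi> t / complex_of_real t" for t
  have [measurable]: "\<psi> \<in> borel_measurable borel" unfolding \<psi>_def by measurable
  define D where "D a t = \<psi> t * complex_of_real (1 - exp (- (t / a)\<^sup>2 / 2))" for a t
  have [measurable]: "D a \<in> borel_measurable borel" for a unfolding D_def by measurable
  define I where "I \<epsilon> = (LBINT t:{t. \<bar>t\<bar> > \<epsilon>}. \<psi> t)" for \<epsilon> :: real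
  have Ilim: "(I \<longlongrightarrow> L) (at_right 0)" using lim by (simp add: I_def[abs_def] \<psi>_def[abs_def])
  have \<psi>: "integrable lborel (\<lambda>t. indicator {t. \<bar>t\<bar> > \<epsilon>} t *\<^sub>R \<psi> t)" if "\<epsilon> > 0" for \<epsilon>
    using tails[OF that] by (simp add: set_integrable_def \<psi>_def)
  have \<phi>: "integrable lborel (\<lambda>t. indicator {-1..1} t *\<^sub>R \<phi> t)" using loc by (simp add: set_integrable_def)
  have Dnorm: "norm (D a t) = norm (\<psi> t) * (1 - exp (- (t / a)\<^sup>2 / 2))" for a t
    unfolding D_def norm_mult norm_of_real by simp
  have Dint: "integrable lborel (D a)" if a: "a > 0" for a
  proof -
    \<comment> \<open>For |t| \<le> 1 the bound 1 - exp (- u) \<le> u compensates the factor 1 / t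
      and leaves the locally integrable \<phi>; for |t| > 1 the weight is at most 1.\<close>
    have "integrable lborel (\<lambda>t. norm (indicator {-1..1} t *\<^sub>R \<phi> t) * (1 / (2 * a\<^sup>2)) + norm (indicator {t. \<bar>t\<bar> > 1} t *\<^sub>R \<psi> t))"
      by (intro Bochner_Integration.integrable_add integrable_mult_left integrable_norm \<phi> \<psi>) simp
    then show ?thesis
    proof (rule Bochner_Integration.integrable_bound)
      have "norm (D a t) \<le> norm (indicator {-1..1} t *\<^sub>R \<phi> t) * (1 / (2 * a\<^sup>2)) + norm (indicator {t. \<bar>t\<bar> > 1} t *\<^sub>R \<psi> t)" for t
      proof (cases "\<bar>t\<bar> > 1")
        case True
        then have "norm (D a t) \<le> norm (\<psi> t) * 1" unfolding Dnorm by (intro mult_left_mono) auto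
        then show ?thesis using True by (auto simp: indicator_def)
      next
        case False
        have "1 - exp (- (t / a)\<^sup>2 / 2) \<le> (t / a)\<^sup>2 / 2" using exp_ge_add_one_self[of "- (t / a)\<^sup>2 / 2"] by simp
        then have "norm (D a t) \<le> norm (\<psi> t) * ((t / a)\<^sup>2 / 2)" unfolding Dnorm by (intro mult_left_mono) auto
        also have "\<dots> = \<bar>t\<bar> * (norm (\<phi> t) * (1 / (2 * a\<^sup>2)))"
          by (simp add: \<psi>_def norm_divide power_divide power2_eq_square divide_simps flip: abs_mult)
        also have "\<dots> \<le> 1 * (norm (\<phi> t) * (1 / (2 * a\<^sup>2)))" using False by (intro mult_right_mono) auto
        finally show ?thesis using False by (auto simp: indicator_def abs_le_iff)
      qed
      then show "AE t in lborel. norm (D a t) \<le> norm (norm (indicator {-1..1} t *\<^sub>R \<phi> t) * (1 / (2 * a\<^sup>2)) + norm (indicator {t. \<bar>t\<bar> > 1} t *\<^sub>R \<psi> t))"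
        unfolding real_norm_def by (intro AE_I2) (rule order_trans[OF _ abs_ge_self])
    qed measurable
  qed
  define \<rho> where "\<rho> \<tau> = indicator {0..} \<tau> * (\<tau> * exp (- \<tau>\<^sup>2 / 2))" for \<tau> :: real
  have \<rho>: "integrable lborel \<rho>" "(\<integral>\<tau>. \<rho> \<tau> \<partial>lborel) = 1" "\<And>\<tau>. \<rho> \<tau> \<ge> 0"
    using rayleigh_total unfolding \<rho>_def[abs_def] has_bochner_integral_iff by (auto simp: indicator_def)
  \<comment> \<open>The average over \<tau> samples truncations of every height. Those near 0 are
    bounded because they converge, the others by the integral of |\<psi>| over one fixed
    tail.\<close>
  obtain M where M: "\<And>\<epsilon>. \<epsilon> > 0 \<Longrightarrow> norm (I \<epsilon>) \<le> M"
  proof -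
    have "eventually (\<lambda>\<epsilon>. norm (I \<epsilon>) < norm L + 1) (at_right 0)"
      by (rule order_tendstoD[OF tendsto_norm[OF Ilim]]) simp
    then obtain \<delta> where \<delta>: "\<delta> > 0" "\<And>\<epsilon>. \<epsilon> > 0 \<Longrightarrow> \<epsilon> < \<delta> \<Longrightarrow> norm (I \<epsilon>) < norm L + 1"
      unfolding eventually_at_right_field by auto
    define M where "M = max (norm L + 1) (\<integral>t. norm (indicator {t. \<bar>t\<bar> > \<delta> / 2} t *\<^sub>R \<psi> t) \<partial>lborel)"
    have "norm (I \<epsilon>) \<le> M" if "\<epsilon> > 0" for \<epsilon>
    proof (cases "\<epsilon> < \<delta>")
      case True then show ?thesis using \<delta>(2)[OF that] by (simp add: M_def)
    next
      case False
      have "norm (I \<epsilon>) \<le> (\<integral>t. norm (indicator {t. \<bar>t\<bar> > \<epsilon>} t *\<^sub>R \<psi> t) \<partial>lborel)"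
        unfolding I_def set_lebesgue_integral_def by (rule integral_norm_bound)
      also have "\<dots> \<le> (\<integral>t. norm (indicator {t. \<bar>t\<bar> > \<delta> / 2} t *\<^sub>R \<psi> t) \<partial>lborel)"
        using that \<delta>(1) False by (intro integral_mono integrable_norm \<psi>) (auto simp: indicator_def)
      finally show ?thesis by (simp add: M_def)
    qed
    then show thesis by (rule that)
  qed
  have [measurable]: "I \<in> borel_measurable borel"
  proof -
    have [measurable]: "(\<lambda>p::real\<times>real. indicator {t. \<bar>t\<bar> > fst p} (snd p) *\<^sub>R \<psi> (snd p)) \<in> borel_measurable (borel \<Otimes>\<^sub>M (lborel::real measure))"
      by (simp add: indicator_def) measurable
    have "(\<lambda>\<epsilon>. \<integral>t. indicator {t. \<bar>t\<bar> > \<epsilon>} t *\<^sub>R \<psi> t \<partial>lborel) \<in> borel_measurable borel"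
      by (rule lborel.borel_measurable_lebesgue_integral) (simp add: case_prod_beta')
    then show ?thesis by (simp add: I_def[abs_def] set_lebesgue_integral_def)
  qed
  define a where "a n = 1 / real (Suc n)" for n
  have a0: "a n > 0" for n by (simp add: a_def)
  have alim: "a \<longlonglongrightarrow> 0" unfolding a_def using LIMSEQ_inverse_real_of_nat by (simp add: inverse_eq_divide)
  have 1: "(\<lambda>n. \<integral>t. D (a n) t \<partial>lborel) \<longlonglongrightarrow> L"
  proof -
    have e: "(\<integral>t. D (a n) t \<partial>lborel) = (\<integral>\<tau>. complex_of_real (\<rho> \<tau>) * I (a n * \<tau>) \<partial>lborel)" for n
      unfolding D_def \<rho>_def I_def
      by (rule smooth_truncation_average[OF a0]) (use Dint[OF a0[of n]] in \<open>simp_all add: D_def[abs_def]\<close>)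
    have "(\<lambda>n. \<integral>\<tau>. complex_of_real (\<rho> \<tau>) * I (a n * \<tau>) \<partial>lborel) \<longlonglongrightarrow> (\<integral>\<tau>. complex_of_real (\<rho> \<tau>) * L \<partial>lborel)"
    proof (rule integral_dominated_convergence)
      show "integrable lborel (\<lambda>\<tau>. \<rho> \<tau> * M)" using \<rho>(1) by simp
      have "(\<lambda>n. complex_of_real (\<rho> \<tau>) * I (a n * \<tau>)) \<longlonglongrightarrow> complex_of_real (\<rho> \<tau>) * L" for \<tau>
      proof (cases "\<tau> > 0")
        case True
        have "(\<lambda>n. a n * \<tau>) \<longlonglongrightarrow> 0 * \<tau>" by (intro tendsto_intros alim)
        then have "filterlim (\<lambda>n. a n * \<tau>) (at_right 0) sequentially"
          using a0 True by (auto simp: filterlim_at order.strict_implies_not_eq intro!: always_eventually) (metis less_irrefl)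
        from filterlim_compose[OF Ilim this] show ?thesis by (intro tendsto_intros)
      next
        case False then have "\<rho> \<tau> = 0" by (auto simp: \<rho>_def indicator_def)
        then show ?thesis by simp
      qed
      then show "AE \<tau> in lborel. (\<lambda>n. complex_of_real (\<rho> \<tau>) * I (a n * \<tau>)) \<longlonglongrightarrow> complex_of_real (\<rho> \<tau>) * L" by simp
      have "norm (complex_of_real (\<rho> \<tau>) * I (a n * \<tau>)) \<le> \<rho> \<tau> * M" for n \<tau>
      proof (cases "\<tau> > 0")
        case True
        then show ?thesis using \<rho>(3)[of \<tau>] M[of "a n * \<tau>"] a0[of n] by (auto simp: norm_mult intro!: mult_left_mono)
      next
        case False then have "\<rho> \<tau> = 0" by (auto simp: \<rho>_def indicator_def)
        then show ?thesis by simp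
      qed
      then show "AE \<tau> in lborel. norm (complex_of_real (\<rho> \<tau>) * I (a n * \<tau>)) \<le> \<rho> \<tau> * M" for n by simp
      show "(\<lambda>\<tau>. complex_of_real (\<rho> \<tau>) * I (a n * \<tau>)) \<in> borel_measurable lborel" for n
        unfolding \<rho>_def by measurable
      show "(\<lambda>\<tau>. complex_of_real (\<rho> \<tau>) * L) \<in> borel_measurable lborel"
        unfolding \<rho>_def by measurable
    qed
    then show ?thesis unfolding e by (simp add: \<rho>(2))
  qed
  \<comment> \<open>As its height grows, the smooth truncation vanishes pointwise, and it is
    dominated by the one at height 1.\<close>
  have 2: "(\<lambda>n. \<integral>t. D (real (Suc n)) t \<partial>lborel) \<longlonglongrightarrow> (\<integral>t. 0 \<partial>(lborel :: real measure))"
  proof (rule integral_dominated_convergence)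
    show "integrable lborel (\<lambda>t. norm (D 1 t))" by (intro integrable_norm Dint) simp
    have "(\<lambda>n. D (real (Suc n)) t) \<longlonglongrightarrow> 0" for t
    proof -
      have "(\<lambda>n. t * a n) \<longlonglongrightarrow> t * 0" by (intro tendsto_intros alim)
      then have "(\<lambda>n. t / real (Suc n)) \<longlonglongrightarrow> 0" by (simp add: a_def)
      then have "(\<lambda>n. D (real (Suc n)) t) \<longlonglongrightarrow> \<psi> t * complex_of_real (1 - exp (- 0\<^sup>2 / 2))"
        unfolding D_def by (intro tendsto_intros) auto
      then show ?thesis by simp
    qed
    then show "AE t in lborel. (\<lambda>n. D (real (Suc n)) t) \<longlonglongrightarrow> 0" by simp
    have "norm (D (real (Suc n)) t) \<le> norm (D 1 t)" for n t
    proof -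
      have "\<bar>t / real (Suc n)\<bar> \<le> \<bar>t\<bar> / 1" unfolding abs_divide by (intro divide_left_mono) auto
      then have "(t / real (Suc n))\<^sup>2 \<le> (t / 1)\<^sup>2" by (simp only: abs_le_square_iff[symmetric] div_by_1)
      then show ?thesis unfolding Dnorm by (intro mult_left_mono) auto
    qed
    then show "AE t in lborel. norm (D (real (Suc n)) t) \<le> norm (D 1 t)" for n by simp
  qed measurable
  have k: "(\<integral>t. complex_of_real (hilbert_kernel (1 / real (Suc n)) (real (Suc n)) t) * \<phi> t \<partial>lborel)
      = complex_of_real (1 / pi) * ((\<integral>t. D (a n) t \<partial>lborel) - (\<integral>t. D (real (Suc n)) t \<partial>lborel))" for n
  proof -
    have "complex_of_real (hilbert_kernel (1 / real (Suc n)) (real (Suc n)) t) * \<phi> t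
       = complex_of_real (1 / pi) * (D (a n) t - D (real (Suc n)) t)" for t
    proof -
      have "complex_of_real ((u - v) / (pi * t)) * z
          = complex_of_real (1 / pi) * (z / t * complex_of_real (1 - v) - z / t * complex_of_real (1 - u))" for u v z
        by (simp add: diff_divide_distrib left_diff_distrib right_diff_distrib mult_ac)
      then show ?thesis unfolding hilbert_kernel_def D_def \<psi>_def a_def .
    qed
    then show ?thesis
      using Dint[OF a0[of n]] Dint[of "real (Suc n)"] by (simp add: Bochner_Integration.integral_diff del: of_nat_Suc of_real_divide)
  qed
  have "(\<lambda>n. complex_of_real (1 / pi) * ((\<integral>t. D (a n) t \<partial>lborel) - (\<integral>t. D (real (Suc n)) t \<partial>lborel)))
      \<longlonglongrightarrow> complex_of_real (1 / pi) * (L - (\<integral>t. 0 \<partial>(lborel :: real measure)))"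
    by (intro tendsto_intros 1 2)
  then show ?thesis unfolding k by simp
qed

subsection \<open>The upper bound\<close>

text \<open>The operator \<open>directional_hilbert\<close> with its direction freed from the form
  (v, 1), for the same reason as in \<open>line_conv\<close>.\<close>

definition pv_hilbert :: "'a::euclidean_space \<Rightarrow> ('a \<Rightarrow> complex) \<Rightarrow> 'a \<Rightarrow> complex"
  where "pv_hilbert w f x =
    (let I = (\<lambda>\<epsilon>. complex_of_real (1 / pi) * (LBINT t:{t. \<bar>t\<bar> > \<epsilon>}. f (x - t *\<^sub>R w) / complex_of_real t))
     in if \<exists>l. (I \<longlongrightarrow> l) (at_right 0) then Lim (at_right 0) I else 0)"

lemma directional_hilbert_eq_pv_hilbert: "directional_hilbert v f x = pv_hilbert (v, 1) f x"
  by (simp only: directional_hilbert_def pv_hilbert_def truncated_hilbert_def Let_def)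

text \<open>Either the sharp truncations converge and the smooth kernels follow them, or the value
  is the default 0. The disjunction suits an upper bound, for which a zero value costs
  nothing.\<close>

lemma line_conv_tendsto_pv_hilbert:
  fixes f :: "'a::euclidean_space \<Rightarrow> complex" and w :: 'a
  assumes [measurable]: "f \<in> borel_measurable borel"
    and f: "(\<integral>\<^sup>+x. ennreal ((norm (f x))\<^sup>2) \<partial>lborel) < \<infinity>"
  shows "AE x in lborel. pv_hilbert w f x = 0 \<or>
    (\<lambda>n. line_conv (hilbert_kernel (1 / real (Suc n)) (real (Suc n))) w f x) \<longlonglongrightarrow> pv_hilbert w f x"
proof -
  have "AE x in lborel. integrable lborel (\<lambda>t. indicator {-1..1} t * norm (f (x - t *\<^sub>R w)))"
    by (rule AE_integrable_along_lines[OF _ _ f])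
       (auto intro!: integrable_real_indicator simp: emeasure_lborel_Icc_eq)
  then show ?thesis
  proof eventually_elim
    case (elim x)
    define \<phi> where "\<phi> t = f (x - t *\<^sub>R w)" for t
    have [measurable]: "\<phi> \<in> borel_measurable borel" unfolding \<phi>_def by measurable
    define I where "I \<epsilon> = (LBINT t:{t. \<bar>t\<bar> > \<epsilon>}. \<phi> t / complex_of_real t)" for \<epsilon> :: real
    have pv: "pv_hilbert w f x = (if \<exists>l. ((\<lambda>\<epsilon>. complex_of_real (1 / pi) * I \<epsilon>) \<longlongrightarrow> l) (at_right 0)
        then Lim (at_right 0) (\<lambda>\<epsilon>. complex_of_real (1 / pi) * I \<epsilon>) else 0)"
      unfolding pv_hilbert_def Let_def I_def \<phi>_def ..
    have loc: "set_integrable lborel {-1..1} \<phi>"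
      unfolding set_integrable_def
      by (rule Bochner_Integration.integrable_bound[OF elim]) (auto simp: \<phi>_def)
    consider "\<And>\<epsilon>. \<epsilon> > 0 \<Longrightarrow> set_integrable lborel {t. \<bar>t\<bar> > \<epsilon>} (\<lambda>t. \<phi> t / complex_of_real t)"
      | \<epsilon>0 where "\<epsilon>0 > 0" "\<not> set_integrable lborel {t. \<bar>t\<bar> > \<epsilon>0} (\<lambda>t. \<phi> t / complex_of_real t)"
      by blast
    then show ?case
    proof cases
      case 1
      show ?thesis
      proof (cases "\<exists>l. ((\<lambda>\<epsilon>. complex_of_real (1 / pi) * I \<epsilon>) \<longlongrightarrow> l) (at_right 0)")
        case True
        then obtain l where l: "((\<lambda>\<epsilon>. complex_of_real (1 / pi) * I \<epsilon>) \<longlongrightarrow> l) (at_right 0)" by blast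
        then have pvl: "pv_hilbert w f x = l" unfolding pv by (auto intro!: tendsto_Lim)
        have "((\<lambda>\<epsilon>. complex_of_real pi * (complex_of_real (1 / pi) * I \<epsilon>)) \<longlongrightarrow> complex_of_real pi * l) (at_right 0)"
          by (intro tendsto_intros l)
        then have "(I \<longlongrightarrow> complex_of_real pi * l) (at_right 0)" by simp
        from kernel_integral_tendsto_principal_value[OF _ loc 1 this[unfolded I_def]]
        have "(\<lambda>n. \<integral>t. complex_of_real (hilbert_kernel (1 / real (Suc n)) (real (Suc n)) t) * \<phi> t \<partial>lborel)
           \<longlonglongrightarrow> complex_of_real (1 / pi) * (complex_of_real pi * l)" by simp
        then show ?thesis unfolding pvl line_conv_def \<phi>_def by simp
      qed (simp add: pv)
    next
      case 2
      \<comment> \<open>The Bochner integral of a non-integrable function is 0. Failure of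
        integrability on one truncation set persists on every larger one, so all truncations at
        smaller \<epsilon> are 0, and so is their limit.\<close>
      have "I \<epsilon> = 0" if "0 < \<epsilon>" "\<epsilon> < \<epsilon>0" for \<epsilon>
      proof -
        have "\<not> set_integrable lborel {t. \<bar>t\<bar> > \<epsilon>} (\<lambda>t. \<phi> t / complex_of_real t)"
        proof
          assume "set_integrable lborel {t. \<bar>t\<bar> > \<epsilon>} (\<lambda>t. \<phi> t / complex_of_real t)"
          then have "set_integrable lborel {t. \<bar>t\<bar> > \<epsilon>0} (\<lambda>t. \<phi> t / complex_of_real t)"
            by (rule set_integrable_subset) (use that in auto)
          with 2 show False by simp
        qed
        then show ?thesis
          unfolding I_def set_lebesgue_integral_def set_integrable_def by (rule not_integrable_integral_eq)
      qed
      then have "((\<lambda>\<epsilon>. complex_of_real (1 / pi) * I \<epsilon>) \<longlongrightarrow> 0) (at_right 0)"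
        using 2(1) by (intro tendsto_eventually) (auto simp: eventually_at_right_field)
      then have "pv_hilbert w f x = 0" unfolding pv by (auto intro!: tendsto_Lim)
      then show ?thesis ..
    qed
  qed
qed

text \<open>A measurable majorant is produced because the bounds for different progressions will be
  added under the integral. The liminf of the maximal functions of the smooth kernels serves, and
  Fatou bounds its integral.\<close>

lemma maximal_pv_hilbert_bound:
  fixes f :: "'a::euclidean_space \<Rightarrow> complex" and w e :: 'a
  assumes [measurable]: "f \<in> borel_measurable borel"
    and f: "(\<integral>\<^sup>+x. ennreal ((norm (f x))\<^sup>2) \<partial>lborel) < \<infinity>"
  obtains G where "G \<in> borel_measurable borel"
    "AE x in lborel. (SUP j\<in>{..<2 ^ m}. ennreal ((norm (pv_hilbert (w + real j *\<^sub>R e) f x))\<^sup>2)) \<le> G x"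
    "(\<integral>\<^sup>+x. G x \<partial>lborel) \<le> ennreal (32 * (1 + (real m)\<^sup>2)) * (\<integral>\<^sup>+x. ennreal ((norm (f x))\<^sup>2) \<partial>lborel)"
proof -
  define k where "k n = hilbert_kernel (1 / real (Suc n)) (real (Suc n))" for n
  have ab: "0 < 1 / real (Suc n)" "1 / real (Suc n) \<le> real (Suc n)" for n
  proof -
    have "1 / real (Suc n) \<le> 1" by simp
    also have "1 \<le> real (Suc n)" by simp
    finally show "1 / real (Suc n) \<le> real (Suc n)" .
  qed simp
  define S where "S n x = (SUP j\<in>{..<2 ^ m}. ennreal ((norm (line_conv (k n) (w + real j *\<^sub>R e) f x))\<^sup>2))" for n x
  have [measurable]: "k n \<in> borel_measurable borel" for n unfolding k_def by measurable
  have [measurable]: "S n \<in> borel_measurable borel" for n unfolding S_def by measurable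
  have "AE x in lborel. \<forall>j\<in>{..<2 ^ m}. pv_hilbert (w + real j *\<^sub>R e) f x = 0 \<or>
      (\<lambda>n. line_conv (k n) (w + real j *\<^sub>R e) f x) \<longlonglongrightarrow> pv_hilbert (w + real j *\<^sub>R e) f x"
    unfolding k_def by (intro AE_finite_allI line_conv_tendsto_pv_hilbert f) auto
  then have 1: "AE x in lborel. (SUP j\<in>{..<2 ^ m}. ennreal ((norm (pv_hilbert (w + real j *\<^sub>R e) f x))\<^sup>2)) \<le> liminf (\<lambda>n. S n x)"
  proof eventually_elim
    case (elim x)
    show ?case
    proof (rule SUP_least)
      fix j :: nat assume j: "j \<in> {..<2 ^ m}"
      show "ennreal ((norm (pv_hilbert (w + real j *\<^sub>R e) f x))\<^sup>2) \<le> liminf (\<lambda>n. S n x)"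
      proof (cases "pv_hilbert (w + real j *\<^sub>R e) f x = 0")
        case False
        with elim j have "(\<lambda>n. ennreal ((norm (line_conv (k n) (w + real j *\<^sub>R e) f x))\<^sup>2)) \<longlonglongrightarrow> ennreal ((norm (pv_hilbert (w + real j *\<^sub>R e) f x))\<^sup>2)"
          by (intro tendsto_intros) auto
        then have "ennreal ((norm (pv_hilbert (w + real j *\<^sub>R e) f x))\<^sup>2) = liminf (\<lambda>n. ennreal ((norm (line_conv (k n) (w + real j *\<^sub>R e) f x))\<^sup>2))"
          by (intro lim_imp_Liminf[symmetric]) auto
        also have "\<dots> \<le> liminf (\<lambda>n. S n x)"
          unfolding S_def by (intro Liminf_mono always_eventually allI SUP_upper j)
        finally show ?thesis .
      qed simp
    qed
  qed
  have "(\<integral>\<^sup>+x. liminf (\<lambda>n. S n x) \<partial>lborel) \<le> liminf (\<lambda>n. \<integral>\<^sup>+x. S n x \<partial>lborel)"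
    by (rule nn_integral_liminf) measurable
  also have "\<dots> \<le> liminf (\<lambda>n. ennreal (32 * (1 + (real m)\<^sup>2)) * (\<integral>\<^sup>+x. ennreal ((norm (f x))\<^sup>2) \<partial>lborel))"
  proof (intro Liminf_mono always_eventually allI)
    fix n
    show "(\<integral>\<^sup>+x. S n x \<partial>lborel) \<le> ennreal (32 * (1 + (real m)\<^sup>2)) * (\<integral>\<^sup>+x. ennreal ((norm (f x))\<^sup>2) \<partial>lborel)"
      unfolding S_def k_def
      by (rule maximal_line_conv_extend[OF _ hilbert_kernel_integrable[OF ab] maximal_line_conv_test_function[OF ab] assms(1) f])
         simp_all
  qed
  also have "\<dots> = ennreal (32 * (1 + (real m)\<^sup>2)) * (\<integral>\<^sup>+x. ennreal ((norm (f x))\<^sup>2) \<partial>lborel)" by (simp add: Liminf_const)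
  finally have 2: "(\<integral>\<^sup>+x. liminf (\<lambda>n. S n x) \<partial>lborel) \<le> ennreal (32 * (1 + (real m)\<^sup>2)) * (\<integral>\<^sup>+x. ennreal ((norm (f x))\<^sup>2) \<partial>lborel)" .
  have "(\<lambda>x. liminf (\<lambda>n. S n x)) \<in> borel_measurable borel" by measurable
  from that[OF this 1 2] show thesis .
qed

section \<open>Norm criteria and the grid as a finite product\<close>

lemma L2_norm_leI:
  assumes "(\<integral>\<^sup>+ x. (g x)\<^sup>2 \<partial>lborel) \<le> ennreal (c\<^sup>2)" "c \<ge> 0"
  shows "L2_norm g \<le> ennreal c"
proof -
  let ?I = "\<integral>\<^sup>+ x. (g x)\<^sup>2 \<partial>lborel"
  have fin: "?I \<noteq> \<infinity>" using assms(1) by (auto simp: top_unique)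
  have "enn2real ?I \<le> c\<^sup>2" using enn2real_mono[OF assms(1)] by simp
  then have "sqrt (enn2real ?I) \<le> c" using assms(2) by (simp add: real_le_lsqrt)
  then show ?thesis using fin by (simp add: L2_norm_def Let_def ennreal_leI)
qed

lemma L2_norm_geI:
  assumes "ennreal (c\<^sup>2) \<le> (\<integral>\<^sup>+ x. (g x)\<^sup>2 \<partial>lborel)" "c \<ge> 0"
  shows "ennreal c \<le> L2_norm g"
proof (cases "(\<integral>\<^sup>+ x. (g x)\<^sup>2 \<partial>lborel) = \<infinity>")
  case False
  let ?I = "\<integral>\<^sup>+ x. (g x)\<^sup>2 \<partial>lborel"
  have "c\<^sup>2 \<le> enn2real ?I" using enn2real_mono[OF assms(1)] False by (simp add: less_top)
  then have "c \<le> sqrt (enn2real ?I)" by (rule real_le_rsqrt)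
  then show ?thesis using False by (simp add: L2_norm_def Let_def ennreal_leI)
qed (simp add: L2_norm_def)

lemma L2_norm_le_one_iff: "L2_norm g \<le> 1 \<longleftrightarrow> (\<integral>\<^sup>+ x. (g x)\<^sup>2 \<partial>lborel) \<le> 1"
proof
  assume "(\<integral>\<^sup>+ x. (g x)\<^sup>2 \<partial>lborel) \<le> 1"
  then show "L2_norm g \<le> 1" using L2_norm_leI[of g 1] by simp
next
  let ?I = "\<integral>\<^sup>+ x. (g x)\<^sup>2 \<partial>lborel"
  assume l: "L2_norm g \<le> 1"
  then have fin: "?I \<noteq> \<infinity>" by (auto simp: L2_norm_def Let_def top_unique)
  then have "ennreal (sqrt (enn2real ?I)) \<le> ennreal 1" using l by (simp add: L2_norm_def Let_def)
  then have "enn2real ?I \<le> 1" by (subst (asm) ennreal_le_iff) auto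
  then have "ennreal (enn2real ?I) \<le> ennreal 1" by (rule ennreal_leI)
  then show "?I \<le> 1" using fin by (simp add: less_top)
qed

text \<open>A finite non-empty supremum is attained, so a bound on each square passes to the square
  of the supremum; over the empty set the supremum is 0.\<close>

lemma SUP_square_le:
  fixes a :: "'i \<Rightarrow> ennreal"
  assumes "finite \<Omega>" "\<And>v. v \<in> \<Omega> \<Longrightarrow> (a v)\<^sup>2 \<le> Y"
  shows "(SUP v\<in>\<Omega>. a v)\<^sup>2 \<le> Y"
proof (cases "\<Omega> = {}")
  case False
  then have "Max (a ` \<Omega>) \<in> a ` \<Omega>" using assms(1) by (intro Max_in) auto
  moreover have "Max (a ` \<Omega>) = (SUP v\<in>\<Omega>. a v)" using False assms(1) by (intro Max_Sup) auto
  ultimately show ?thesis using assms(2) by auto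
qed (simp add: bot_ennreal)

lemma uniform_grid_eq_image:
  fixes M :: "'n::finite \<Rightarrow> nat"
  shows "uniform_grid M = (\<lambda>g. \<chi> i. real (g i) / real (M i)) ` (PiE UNIV (\<lambda>i. {1..M i}))"
proof (intro equalityI subsetI)
  fix v assume "v \<in> uniform_grid M"
  then have "\<forall>i. \<exists>j. v $ i = real j / real (M i) \<and> 1 \<le> j \<and> j \<le> M i"
    by (simp add: uniform_grid_def uniform_points_def)
  then obtain g where "\<And>i. v $ i = real (g i) / real (M i) \<and> 1 \<le> g i \<and> g i \<le> M i" by metis
  then show "v \<in> (\<lambda>g. \<chi> i. real (g i) / real (M i)) ` (PiE UNIV (\<lambda>i. {1..M i}))"
    by (intro image_eqI[of _ _ g]) (auto simp: vec_eq_iff)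
next
  fix v assume "v \<in> (\<lambda>g. \<chi> i. real (g i) / real (M i)) ` (PiE UNIV (\<lambda>i. {1..M i}))"
  then obtain g where g: "g \<in> PiE UNIV (\<lambda>i. {1..M i})" "v = (\<chi> i. real (g i) / real (M i))" by blast
  then have "v $ i = real (g i) / real (M i) \<and> 1 \<le> g i \<and> g i \<le> M i" for i
    using PiE_mem[OF g(1), of i] by simp
  then show "v \<in> uniform_grid M" unfolding uniform_grid_def uniform_points_def by blast
qed

lemma card_uniform_grid:
  fixes M :: "'n::finite \<Rightarrow> nat"
  shows "finite (uniform_grid M)" "card (uniform_grid M) = (\<Prod>i\<in>UNIV. M i)"
proof -
  show "finite (uniform_grid M)" unfolding uniform_grid_eq_image by (intro finite_imageI finite_PiE) auto
  have "inj_on (\<lambda>g. \<chi> i. real (g i) / real (M i)) (PiE UNIV (\<lambda>i. {1..M i}))"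
  proof (rule inj_onI, rule ext)
    fix g h i assume g: "g \<in> PiE UNIV (\<lambda>i. {1..M i})"
      and eq: "(\<chi> i. real (g i) / real (M i)) = (\<chi> i. real (h i) / real (M i))"
    then have "M i > 0" by (auto dest!: PiE_mem[of _ _ _ i])
    moreover have "real (g i) / real (M i) = real (h i) / real (M i)" using eq by (simp add: vec_eq_iff)
    ultimately show "g i = h i" by simp
  qed
  then show "card (uniform_grid M) = (\<Prod>i\<in>UNIV. M i)"
    unfolding uniform_grid_eq_image by (simp add: card_image card_PiE)
qed

text \<open>The square of the supremum over the grid is at most the sum, over the values of the
  other coordinates, of the squared suprema along coordinate \<open>i0\<close>. Hence the number of
  progressions enters only through its square root.\<close>

lemma maximal_hilbert_upper:
  fixes M :: "'n::finite \<Rightarrow> nat"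
  assumes m: "M i0 < 2 ^ m"
  shows "L2_operator_norm (maximal_hilbert (uniform_grid M))
    \<le> ennreal (sqrt (real (\<Prod>i\<in>UNIV - {i0}. M i) * (32 * (1 + (real m)\<^sup>2))))"
  unfolding L2_operator_norm_def
proof (rule SUP_least)
  fix f :: "(real^'n) \<times> real \<Rightarrow> complex"
  assume "f \<in> {f \<in> borel_measurable lborel. L2_norm (\<lambda>x. ennreal (norm (f x))) \<le> 1}"
  then have [measurable]: "f \<in> borel_measurable borel"
    and f1: "(\<integral>\<^sup>+x. ennreal ((norm (f x))\<^sup>2) \<partial>lborel) \<le> 1"
    by (auto simp: L2_norm_le_one_iff ennreal_power)
  define A where "A = PiE (UNIV - {i0}) (\<lambda>i. {1..M i})"
  have A: "finite A" "card A = (\<Prod>i\<in>UNIV - {i0}. M i)" by (auto simp: A_def card_PiE intro!: finite_PiE)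
  define w :: "('n \<Rightarrow> nat) \<Rightarrow> (real^'n) \<times> real"
    where "w g = ((\<chi> i. if i = i0 then 0 else real (g i) / real (M i)), 1)" for g
  \<comment> \<open>One step moves coordinate \<open>i0\<close> by \<open>1 / M i0\<close>. The base
    point \<open>w g\<close> has 0 there, so j = 0 is an extra direction outside the grid, and
    \<open>M i0 < 2 ^ m\<close> brings the last index j = \<open>M i0\<close> into range.\<close>
  define e :: "(real^'n) \<times> real" where "e = (axis i0 (1 / real (M i0)), 0)"
  define S where "S g x = (SUP j\<in>{..<2 ^ m}. ennreal ((norm (pv_hilbert (w g + real j *\<^sub>R e) f x))\<^sup>2))" for g x
  define C where "C = 32 * (1 + (real m)\<^sup>2)"
  have "\<forall>g. \<exists>G. G \<in> borel_measurable borel \<and> (AE x in lborel. S g x \<le> G x) \<and> (\<integral>\<^sup>+x. G x \<partial>lborel) \<le> ennreal C"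
  proof
    fix g
    obtain G where G: "G \<in> borel_measurable borel" "AE x in lborel. S g x \<le> G x"
      "(\<integral>\<^sup>+x. G x \<partial>lborel) \<le> ennreal C * (\<integral>\<^sup>+x. ennreal ((norm (f x))\<^sup>2) \<partial>lborel)"
      unfolding S_def C_def
      by (rule maximal_pv_hilbert_bound[OF \<open>f \<in> borel_measurable borel\<close> le_less_trans[OF f1]]) auto
    note G(3)
    also have "ennreal C * (\<integral>\<^sup>+x. ennreal ((norm (f x))\<^sup>2) \<partial>lborel) \<le> ennreal C * 1"
      by (intro mult_left_mono f1) auto
    finally show "\<exists>G. G \<in> borel_measurable borel \<and> (AE x in lborel. S g x \<le> G x) \<and> (\<integral>\<^sup>+x. G x \<partial>lborel) \<le> ennreal C"
      using G(1,2) by (intro exI[of _ G]) simp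
  qed
  from choice[OF this] obtain G where "\<forall>g. G g \<in> borel_measurable borel \<and> (AE x in lborel. S g x \<le> G g x) \<and> (\<integral>\<^sup>+x. G g x \<partial>lborel) \<le> ennreal C"
    by (rule exE)
  then have [measurable]: "\<And>g. G g \<in> borel_measurable borel"
    and SG: "\<And>g. AE x in lborel. S g x \<le> G g x" and G: "\<And>g. (\<integral>\<^sup>+x. G g x \<partial>lborel) \<le> ennreal C"
    by simp_all
  have ptw: "(maximal_hilbert (uniform_grid M) f x)\<^sup>2 \<le> (\<Sum>g\<in>A. S g x)" for x
    unfolding maximal_hilbert_def
  proof (rule SUP_square_le[OF card_uniform_grid(1)])
    fix v assume "v \<in> uniform_grid M"
    then obtain g where g: "g \<in> PiE UNIV (\<lambda>i. {1..M i})" "v = (\<chi> i. real (g i) / real (M i))"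
      unfolding uniform_grid_eq_image by blast
    \<comment> \<open>The elements of \<open>A\<close> are extensional off \<open>i0\<close>, so the
      index function is restricted before it can name a progression.\<close>
    define g' where "g' = restrict g (UNIV - {i0})"
    have g': "g' \<in> A" using g(1) by (auto simp: A_def g'_def)
    have j: "g i0 \<in> {..<2 ^ m}" using PiE_mem[OF g(1), of i0] m by simp
    have v: "(v, 1) = w g' + real (g i0) *\<^sub>R e"
      by (simp add: g(2) w_def e_def g'_def vec_eq_iff axis_def)
    have "(ennreal (norm (directional_hilbert v f x)))\<^sup>2 = ennreal ((norm (pv_hilbert (w g' + real (g i0) *\<^sub>R e) f x))\<^sup>2)"
      unfolding directional_hilbert_eq_pv_hilbert v by (simp add: ennreal_power)
    also have "\<dots> \<le> S g' x" unfolding S_def by (rule SUP_upper[OF j])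
    also have "\<dots> \<le> (\<Sum>g\<in>A. S g x)" by (rule member_le_sum[OF g' _ A(1)]) simp
    finally show "(ennreal (norm (directional_hilbert v f x)))\<^sup>2 \<le> (\<Sum>g\<in>A. S g x)" .
  qed
  have X: "0 \<le> real (card A) * C" unfolding C_def by (intro mult_nonneg_nonneg) auto
  have "L2_norm (maximal_hilbert (uniform_grid M) f) \<le> ennreal (sqrt (real (card A) * C))"
  proof (rule L2_norm_leI)
    have "AE x in lborel. \<forall>g\<in>A. S g x \<le> G g x" by (intro AE_finite_allI A(1) SG)
    then have "AE x in lborel. (maximal_hilbert (uniform_grid M) f x)\<^sup>2 \<le> (\<Sum>g\<in>A. G g x)"
      by eventually_elim (rule order_trans[OF ptw], rule sum_mono, blast)
    then have "(\<integral>\<^sup>+ x. (maximal_hilbert (uniform_grid M) f x)\<^sup>2 \<partial>lborel) \<le> (\<integral>\<^sup>+ x. (\<Sum>g\<in>A. G g x) \<partial>lborel)"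
      by (rule nn_integral_mono_AE)
    also have "\<dots> = (\<Sum>g\<in>A. (\<integral>\<^sup>+x. G g x \<partial>lborel))" by (rule nn_integral_sum) measurable
    also have "\<dots> \<le> (\<Sum>g\<in>A. ennreal C)" by (rule sum_mono) (rule G)
    also have "\<dots> = ennreal (real (card A) * C)" by (simp add: C_def ennreal_mult' ennreal_of_nat_eq_real_of_nat)
    finally show "(\<integral>\<^sup>+ x. (maximal_hilbert (uniform_grid M) f x)\<^sup>2 \<partial>lborel) \<le> ennreal ((sqrt (real (card A) * C))\<^sup>2)"
      unfolding real_sqrt_pow2[OF X] .
    show "0 \<le> sqrt (real (card A) * C)" using X by (rule real_sqrt_ge_zero)
  qed
  then show "L2_norm (maximal_hilbert (uniform_grid M) f)
      \<le> ennreal (sqrt (real (\<Prod>i\<in>UNIV - {i0}. M i) * (32 * (1 + (real m)\<^sup>2))))"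
    unfolding A(2) C_def .
qed

subsection \<open>The lower bound\<close>

lemma
  fixes a b :: "'n::finite \<Rightarrow> real"
  assumes "\<And>i. a i \<le> b i"
  shows emeasure_lborel_cbox_vec: "emeasure lborel (cbox (\<chi> i. a i) (\<chi> i. b i)) = ennreal (\<Prod>i\<in>UNIV. b i - a i)"
    and emeasure_lborel_box_vec: "emeasure lborel (box (\<chi> i. a i) (\<chi> i. b i)) = ennreal (\<Prod>i\<in>UNIV. b i - a i)"
proof -
  let ?a = "(\<chi> i. a i) :: real^'n" and ?b = "(\<chi> i. b i) :: real^'n"
  have ne: "cbox ?a ?b \<noteq> {}" using assms by (simp add: interval_ne_empty_cart)
  have le: "?a \<bullet> k \<le> ?b \<bullet> k" if "k \<in> Basis" for k using ne that by (simp add: box_ne_empty)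
  have m: "measure lborel (cbox ?a ?b) = (\<Prod>i\<in>UNIV. b i - a i)" using content_cbox_cart[OF ne] by simp
  then show "emeasure lborel (cbox ?a ?b) = ennreal (\<Prod>i\<in>UNIV. b i - a i)"
    using emeasure_bounded_finite[OF bounded_cbox, of ?a ?b] by (subst emeasure_eq_ennreal_measure) auto
  moreover have "emeasure lborel (box ?a ?b) = emeasure lborel (cbox ?a ?b)"
    using le by (simp add: emeasure_lborel_box_eq emeasure_lborel_cbox_eq)
  ultimately show "emeasure lborel (box ?a ?b) = ennreal (\<Prod>i\<in>UNIV. b i - a i)" by simp
qed

lemma nn_integral_scaled_inverse:
  fixes p q D :: real
  assumes "0 < p" "p \<le> q" "0 \<le> D"
  shows "(\<integral>\<^sup>+r. ennreal (D * (1 / r)) * indicator {p..q} r \<partial>lborel) = ennreal (D * ln q - D * ln p)"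
proof (rule nn_integral_FTC_Icc)
  fix r assume "r \<in> {p..q}"
  then have r: "r > 0" using assms by simp
  then show "((\<lambda>r. D * ln r) has_real_derivative D * (1 / r)) (at r)" by (auto intro!: derivative_eq_intros)
  show "0 \<le> D * (1 / r)" using r assms by simp
qed (use assms in auto)

text \<open>The last coordinate is -s, hence the minus signs. The half-widths leave room for lines
  with slopes in [0, 1]: in coordinate \<open>i0\<close> an offset at most 1 and a drift at most s
  stay within 2 s, since s \<ge> 1; elsewhere an offset and a drift at most L stay within 2 L. The
  weight 1 / s makes all dyadic ranges of s contribute comparably, both to the squared norm and to
  the integral along such a line.\<close>

definition needle :: "'n::finite \<Rightarrow> real \<Rightarrow> (real^'n) \<times> real \<Rightarrow> real"
  where "needle i0 L p = (if snd p \<in> {-L..-1} \<and> fst p \<in> cbox (\<chi> i. if i = i0 then 2 * snd p else - 2 * L) (\<chi> i. if i = i0 then - 2 * snd p else 2 * L)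
    then - 1 / snd p else 0)"

lemma needle_mem_iff:
  fixes z :: "real^'n::finite"
  shows
  "z \<in> cbox (\<chi> i. if i = i0 then 2 * u else - 2 * L) (\<chi> i. if i = i0 then - 2 * u else 2 * L)
    \<longleftrightarrow> (\<forall>i. (if i = i0 then 2 * u else - 2 * L) \<le> z $ i \<and> z $ i \<le> (if i = i0 then - 2 * u else 2 * L))"
  by (simp add: mem_box_cart)

lemma needle_measurable [measurable]: "needle (i0::'n::finite) L \<in> borel_measurable borel"
proof -
  have [measurable]: "(\<lambda>p::(real^'n) \<times> real. fst p $ i) \<in> borel_measurable borel" for i
    by (intro borel_measurable_continuous_onI continuous_intros)
  have [measurable]: "snd \<in> borel_measurable (borel :: ((real^'n) \<times> real) measure)"
    by (intro borel_measurable_continuous_onI continuous_intros)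
  have [measurable]: "Measurable.pred borel (\<lambda>p::(real^'n) \<times> real. (if i = i0 then 2 * snd p else - 2 * L) \<le> fst p $ i \<and> fst p $ i \<le> (if i = i0 then - 2 * snd p else 2 * L))" for i
    by (cases "i = i0") simp_all
  show ?thesis unfolding needle_def[abs_def] needle_mem_iff by measurable
qed

text \<open>The slice at height u has volume 4 |u| (4 L)^(n - 1), and |u| / u^2 integrates to ln
  L.\<close>

lemma nn_integral_needle_square:
  fixes i0 :: "'n::finite"
  assumes L: "L > 1"
  shows "(\<integral>\<^sup>+p. ennreal ((needle i0 L p)\<^sup>2) \<partial>lborel) = ennreal (4 ^ CARD('n) * L ^ (CARD('n) - 1) * ln L)"
proof -
  have "(\<integral>\<^sup>+p. ennreal ((needle i0 L p)\<^sup>2) \<partial>lborel) = (\<integral>\<^sup>+u. (\<integral>\<^sup>+z. ennreal ((needle i0 L (z, u))\<^sup>2) \<partial>lborel) \<partial>lborel)"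
    unfolding lborel_prod[symmetric] by (rule lborel_pair.nn_integral_snd[symmetric]) (simp add: lborel_prod)
  also have "\<dots> = (\<integral>\<^sup>+u. ennreal (4 ^ CARD('n) * L ^ (CARD('n) - 1) * (- 1 / u)) * indicator {-L..-1} u \<partial>lborel)"
  proof (intro nn_integral_cong)
    fix u :: real
    let ?a = "\<lambda>i. if i = i0 then 2 * u else - 2 * L" and ?b = "\<lambda>i. if i = i0 then - 2 * u else 2 * L"
    show "(\<integral>\<^sup>+z. ennreal ((needle i0 L (z, u))\<^sup>2) \<partial>lborel) = ennreal (4 ^ CARD('n) * L ^ (CARD('n) - 1) * (- 1 / u)) * indicator {-L..-1} u"
    proof (cases "u \<in> {-L..-1}")
      case True
      then have u: "u \<le> -1" by simp
      have "(\<integral>\<^sup>+z. ennreal ((needle i0 L (z, u))\<^sup>2) \<partial>lborel) = (\<integral>\<^sup>+z. ennreal (1 / u\<^sup>2) * indicator (cbox (\<chi> i. ?a i) (\<chi> i. ?b i)) z \<partial>lborel)"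
        unfolding needle_def fst_conv snd_conv
        using True by (intro nn_integral_cong) (simp add: power_divide indicator_def)
      also have "\<dots> = ennreal (1 / u\<^sup>2) * ennreal (\<Prod>i\<in>UNIV. ?b i - ?a i)"
        using L u by (simp add: nn_integral_cmult_indicator emeasure_lborel_cbox_vec)
      also have "(\<Prod>i\<in>(UNIV::'n set). ?b i - ?a i) = (- 4 * u) * (\<Prod>i\<in>UNIV - {i0}. 4 * L)"
        by (subst prod.remove[of _ i0]) auto
      also have "\<dots> = 4 ^ CARD('n) * L ^ (CARD('n) - 1) * (- u)"
        using power_minus_mult[of "CARD('n)" "4::real"] by (simp add: power_mult_distrib card_Diff_singleton mult_ac)
      also have "ennreal (1 / u\<^sup>2) * ennreal (4 ^ CARD('n) * L ^ (CARD('n) - 1) * (- u)) = ennreal (4 ^ CARD('n) * L ^ (CARD('n) - 1) * (- 1 / u))"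
      proof (subst ennreal_mult[symmetric])
        show "0 \<le> 4 ^ CARD('n) * L ^ (CARD('n) - 1) * (- u)" using u L by (intro mult_nonneg_nonneg) auto
      qed (use u in \<open>simp_all add: power2_eq_square\<close>)
      finally show ?thesis using True by simp
    next
      case False
      then have "needle i0 L (z, u) = 0" for z by (auto simp: needle_def)
      then show ?thesis using False by simp
    qed
  qed
  also have "\<dots> = ennreal ((- (4 ^ CARD('n) * L ^ (CARD('n) - 1)) * ln (- (-1))) - (- (4 ^ CARD('n) * L ^ (CARD('n) - 1)) * ln (- (- L))))"
    by (rule nn_integral_FTC_Icc)
       (use L in \<open>auto intro!: derivative_eq_intros simp: divide_le_0_iff mult_le_0_iff\<close>)
  finally show ?thesis using L by simp
qed

text \<open>The vector z - r v is where the line through (z, r) crosses height 0, and the hypotheses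
  place it near the origin. Continuing downwards, the line meets the support exactly for t between r
  + 1 and r + L. There 1 / t is at least 1 / (2 r), because L \<le> r, and all contributions are
  nonnegative.\<close>

lemma directional_hilbert_ge:
  fixes i0 :: "'n::finite" and z v :: "real^'n"
  assumes L: "L > 1" and c: "c \<ge> 0" and r: "r \<ge> L"
    and v0: "\<bar>z $ i0 - r * v $ i0\<bar> \<le> 1" "0 \<le> v $ i0" "v $ i0 \<le> 1"
    and v: "\<And>i. i \<noteq> i0 \<Longrightarrow> 0 \<le> z $ i - r * v $ i \<and> z $ i - r * v $ i \<le> L \<and> 0 \<le> v $ i \<and> v $ i \<le> 1"
  shows "c * ln L / (2 * pi * r) \<le> norm (directional_hilbert v (\<lambda>p. complex_of_real (c * needle i0 L p)) (z, r))"
proof -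
  define f where "f p = complex_of_real (c * needle i0 L p)" for p
  have e: "(z, r) - t *\<^sub>R (v, 1) = (z - t *\<^sub>R v, r - t)" for t by simp
  have needle: "needle i0 L ((z, r) - t *\<^sub>R (v, 1)) = indicator {r + 1..r + L} t * (1 / (t - r))" for t
  proof (cases "t \<in> {r + 1..r + L}")
    case True
    define s where "s = t - r"
    have s: "1 \<le> s" "s \<le> L" using True by (auto simp: s_def)
    have eq: "(z - t *\<^sub>R v) $ i = (z $ i - r * v $ i) - s * v $ i" "r - t = - s" for i
      by (simp_all add: s_def algebra_simps)
    have sv: "0 \<le> s * v $ i" "s * v $ i \<le> s" for i
    proof -
      have "0 \<le> v $ i \<and> v $ i \<le> 1" using v0(2,3) v[of i] by (cases "i = i0") auto
      then show "0 \<le> s * v $ i" "s * v $ i \<le> s" using s mult_left_mono[of "v $ i" 1 s] by auto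
    qed
    have "z - t *\<^sub>R v \<in> cbox (\<chi> i. if i = i0 then 2 * (r - t) else - 2 * L) (\<chi> i. if i = i0 then - 2 * (r - t) else 2 * L)"
      unfolding needle_mem_iff
    proof
      fix i
      show "(if i = i0 then 2 * (r - t) else - 2 * L) \<le> (z - t *\<^sub>R v) $ i \<and> (z - t *\<^sub>R v) $ i \<le> (if i = i0 then - 2 * (r - t) else 2 * L)"
      proof (cases "i = i0")
        case True
        have "- 2 * s \<le> z $ i0 - r * v $ i0 - s * v $ i0" "z $ i0 - r * v $ i0 - s * v $ i0 \<le> 2 * s"
          using v0(1) sv[of i0] s by linarith+
        then show ?thesis unfolding eq using True by simp
      next
        case False
        have "- 2 * L \<le> z $ i - r * v $ i - s * v $ i" "z $ i - r * v $ i - s * v $ i \<le> 2 * L"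
          using v[OF False] sv[of i] s by linarith+
        then show ?thesis unfolding eq using False by simp
      qed
    qed
    then show ?thesis unfolding e needle_def fst_conv snd_conv using True by (simp add: minus_divide_right)
  next
    case False then show ?thesis unfolding e by (auto simp: needle_def)
  qed
  define h where "h t = indicator {r + 1..r + L} t *\<^sub>R (c / ((t - r) * t))" for t
  have fh: "f ((z, r) - t *\<^sub>R (v, 1)) / complex_of_real t = complex_of_real (h t)" for t
    unfolding f_def needle h_def by (simp add: divide_inverse)
  \<comment> \<open>No truncation below r touches the support, so the truncated integrals are
    eventually constant and the principal value is an ordinary integral.\<close>
  have "truncated_hilbert \<epsilon> v f (z, r) = complex_of_real ((1 / pi) * (\<integral>t. h t \<partial>lborel))" if "\<epsilon> < r" for \<epsilon>
  proof -
    have "(LBINT t:{t. \<bar>t\<bar> > \<epsilon>}. f ((z, r) - t *\<^sub>R (v, 1)) / complex_of_real t) = (\<integral>t. complex_of_real (h t) \<partial>lborel)"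
      unfolding set_lebesgue_integral_def fh
      using that by (intro Bochner_Integration.integral_cong refl) (auto simp: h_def indicator_def)
    then show ?thesis unfolding truncated_hilbert_def integral_complex_of_real by simp
  qed
  then have "((\<lambda>\<epsilon>. truncated_hilbert \<epsilon> v f (z, r)) \<longlongrightarrow> complex_of_real ((1 / pi) * (\<integral>t. h t \<partial>lborel))) (at_right 0)"
    using L r by (intro tendsto_eventually) (auto simp: eventually_at_right_field intro!: exI[of _ r])
  then have "directional_hilbert v f (z, r) = complex_of_real ((1 / pi) * (\<integral>t. h t \<partial>lborel))"
    unfolding directional_hilbert_def by (auto intro!: tendsto_Lim)
  then have nH: "norm (directional_hilbert v f (z, r)) = \<bar>(1 / pi) * (\<integral>t. h t \<partial>lborel)\<bar>" by (simp only: norm_of_real)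
  have hi: "integrable lborel h"
    unfolding h_def by (rule borel_integrable_atLeastAtMost'[unfolded set_integrable_def])
      (use L r in \<open>auto intro!: continuous_intros\<close>)
  have "c / (2 * r) * ln L = (\<integral>t. indicator {r + 1..r + L} t *\<^sub>R (c / (2 * r) * (1 / (t - r))) \<partial>lborel)"
  proof -
    have "(\<integral>t. indicator {r + 1..r + L} t *\<^sub>R (c / (2 * r) * (1 / (t - r))) \<partial>lborel)
        = c / (2 * r) * ln (r + L - r) - c / (2 * r) * ln (r + 1 - r)"
    proof (rule integral_FTC_Icc)
      fix t assume t: "r + 1 \<le> t" "t \<le> r + L"
      have "((\<lambda>t. c / (2 * r) * ln (t - r)) has_real_derivative c / (2 * r) * (1 / (t - r))) (at t)"
        using t L r by (auto intro!: derivative_eq_intros)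
      then show "((\<lambda>t. c / (2 * r) * ln (t - r)) has_vector_derivative c / (2 * r) * (1 / (t - r))) (at t within {r + 1..r + L})"
        by (simp add: has_real_derivative_iff_has_vector_derivative has_vector_derivative_at_within)
    qed (use L r in \<open>auto intro!: continuous_intros\<close>)
    then show ?thesis by simp
  qed
  also have "\<dots> \<le> (\<integral>t. h t \<partial>lborel)"
  proof (rule integral_mono)
    show "integrable lborel (\<lambda>t. indicator {r + 1..r + L} t *\<^sub>R (c / (2 * r) * (1 / (t - r))))"
      by (rule borel_integrable_atLeastAtMost'[unfolded set_integrable_def])
        (use L r in \<open>auto intro!: continuous_intros\<close>)
    fix t
    show "indicator {r + 1..r + L} t *\<^sub>R (c / (2 * r) * (1 / (t - r))) \<le> h t"
    proof (cases "t \<in> {r + 1..r + L}")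
      case True
      then have t: "0 < t - r" "0 < t" "t \<le> 2 * r" using L r by auto
      have "c / ((t - r) * (2 * r)) \<le> c / ((t - r) * t)"
        using t c by (intro divide_left_mono mult_left_mono mult_pos_pos) auto
      then show ?thesis using True by (simp add: h_def mult.commute)
    qed (simp add: h_def)
  qed (rule hi)
  finally have "c / (2 * r) * ln L \<le> (\<integral>t. h t \<partial>lborel)" .
  then have "1 / pi * (c / (2 * r) * ln L) \<le> 1 / pi * (\<integral>t. h t \<partial>lborel)" by (intro mult_left_mono) auto
  also have "\<dots> \<le> norm (directional_hilbert v f (z, r))" unfolding nH by (rule abs_ge_self)
  finally show ?thesis unfolding f_def[abs_def] by (simp add: mult_ac)
qed

text \<open>The two ends of the range of heights have separate reasons: r \<ge> K L gives
  neighbouring boxes the spacing r / K \<ge> L, which makes them disjoint, while r \<le> N1 keeps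
  the rounding error r / N1 of the long coordinate at most 1, the offset tolerated there. The
  squared pointwise bound times the volume of a box is proportional to 1 / r, and integrating it
  gives the second logarithm.\<close>

lemma maximal_hilbert_lower:
  fixes i0 :: "'n::finite" and K N1 :: nat and L :: real
  assumes L: "L > 1" and K: "K > 0" and N1: "real K * L < real N1"
  defines "M \<equiv> \<lambda>i::'n. if i = i0 then N1 else K" and "d \<equiv> CARD('n) - 1"
  shows "ennreal (sqrt (real K ^ d * ln L * ln (real N1 / (real K * L)) / (4 * pi\<^sup>2 * 4 ^ CARD('n))))
    \<le> L2_operator_norm (maximal_hilbert (uniform_grid M))"
proof -
  define B where "B = 4 ^ CARD('n) * L ^ d * ln L"
  have B: "B > 0" using L by (simp add: B_def)
  define c where "c = 1 / sqrt B"
  have c: "c > 0" "c\<^sup>2 = 1 / B" using B by (simp_all add: c_def power_divide)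
  define f where "f p = complex_of_real (c * needle i0 L p)" for p
  have [measurable]: "f \<in> borel_measurable borel" unfolding f_def by measurable
  have KL: "real K * L > 0" "L \<le> real K * L" using K L by auto
  have N1p: "real N1 > 0" using KL N1 by linarith
  have "(\<integral>\<^sup>+p. (ennreal (norm (f p)))\<^sup>2 \<partial>lborel) = (\<integral>\<^sup>+p. ennreal (c\<^sup>2) * ennreal ((needle i0 L p)\<^sup>2) \<partial>lborel)"
    by (intro nn_integral_cong)
       (simp add: f_def norm_mult ennreal_power power_mult_distrib ennreal_mult del: of_real_mult)
  also have "\<dots> = ennreal (c\<^sup>2) * ennreal B"
    by (subst nn_integral_cmult) (auto simp: nn_integral_needle_square[OF L] B_def d_def)
  also have "\<dots> = 1" using B by (simp add: c(2) ennreal_mult[symmetric])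
  finally have f1: "L2_norm (\<lambda>p. ennreal (norm (f p))) \<le> 1" by (simp add: L2_norm_le_one_iff)
  define A where "A = PiE (UNIV - {i0}) (\<lambda>i. {1..K})"
  have A: "finite A" "card A = K ^ d" by (auto simp: A_def d_def card_PiE card_Diff_singleton intro!: finite_PiE)
  define a where "a r g i = (if i = i0 then 0 else r * real (g i) / real K)" for r :: real and g i
  define b where "b r g i = (if i = i0 then r else r * real (g i) / real K + L)" for r :: real and g i
  \<comment> \<open>For z in this box the short slopes \<open>g i / K\<close> lead back to offsets
    between 0 and L at height 0. The long coordinate ranges over an interval of length r because the
    slopes \<open>j / N1\<close> are dense enough to follow it.\<close>
  define Q where "Q r g = box (\<chi> i. a r g i) (\<chi> i. b r g i)" for r and g :: "'n \<Rightarrow> nat"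
  have Qmem: "z \<in> Q r g \<longleftrightarrow> (\<forall>i. a r g i < z $ i \<and> z $ i < b r g i)" for z r g
    by (simp add: Q_def mem_box_cart)
  define R where "R r = c * ln L / (2 * pi * r)" for r
  have ptw: "(\<Sum>g\<in>A. ennreal ((R r)\<^sup>2) * indicator (Q r g) z) \<le> (maximal_hilbert (uniform_grid M) f (z, r))\<^sup>2"
    if r: "r \<in> {real K * L..real N1}" for z r
  proof (cases "\<exists>g\<in>A. z \<in> Q r g")
    case False
    then have "(\<Sum>g\<in>A. ennreal ((R r)\<^sup>2) * indicator (Q r g) z) = (\<Sum>g\<in>A. 0)" by (intro sum.cong) auto
    then show ?thesis by simp
  next
    case True
    then obtain g where g: "g \<in> A" "z \<in> Q r g" by blast
    have r0: "r \<ge> L" "r > 0" "r \<le> real N1" using r KL by auto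
    have rK: "r / real K \<ge> L" using r K by (auto simp: field_simps)
    have uniq: "z \<notin> Q r h" if h: "h \<in> A - {g}" for h
    proof
      assume zh: "z \<in> Q r h"
      from h g(1) have "\<exists>i. i \<noteq> i0 \<and> h i \<noteq> g i" unfolding A_def by (auto dest: PiE_ext)
      then obtain i where i: "i \<noteq> i0" "h i \<noteq> g i" by blast
      \<comment> \<open>Corners belonging to different indices are at least r / K \<ge> L apart, and
        L is the side of a box in the short directions.\<close>
      have sep: False if "p < q" "r * real q / real K < z $ i" "z $ i < r * real p / real K + L" for p q :: nat
      proof -
        have "r / real K * (real p + 1) \<le> r / real K * real q" using that(1) r0(2) by (intro mult_left_mono) auto
        then have "r * real p / real K + r / real K \<le> r * real q / real K"
          by (simp add: algebra_simps add_divide_distrib)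
        with that rK show False by linarith
      qed
      show False using sep[of "h i" "g i"] sep[of "g i" "h i"] zh g(2) i unfolding Qmem a_def b_def
        by (metis nat_neq_iff)
    qed
    have "(\<Sum>g\<in>A. ennreal ((R r)\<^sup>2) * indicator (Q r g) z) = ennreal ((R r)\<^sup>2)"
      using g uniq by (subst sum.remove[OF A(1) g(1)]) simp
    \<comment> \<open>Rounding up gives j \<ge> 1 because \<open>z $ i0\<close> is positive, and r j
      / N1 exceeds \<open>z $ i0\<close> by at most r / N1.\<close>
    moreover define j where "j = nat \<lceil>z $ i0 * real N1 / r\<rceil>"
    have z0: "0 < z $ i0" "z $ i0 < r" using g(2) unfolding Qmem a_def b_def by (auto dest: spec[of _ i0])
    have p: "0 < z $ i0 * real N1 / r" "z $ i0 * real N1 / r \<le> real N1"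
      using z0 N1p r0 by (auto simp: field_simps)
    have j: "1 \<le> j" "j \<le> N1" "z $ i0 * real N1 / r \<le> real j" "real j \<le> z $ i0 * real N1 / r + 1"
      using p unfolding j_def by linarith+
    define v where "v = (\<chi> i. if i = i0 then real j / real N1 else real (g i) / real K)"
    have gi: "1 \<le> g i" "g i \<le> K" if "i \<noteq> i0" for i using g(1) that unfolding A_def by (auto dest!: PiE_mem[of _ _ _ i])
    have vM: "v \<in> uniform_grid M"
      using j gi by (auto simp: uniform_grid_def uniform_points_def v_def M_def)
    have "R r \<le> norm (directional_hilbert v f (z, r))"
      unfolding R_def f_def
    proof (rule directional_hilbert_ge[OF L less_imp_le[OF c(1)] r0(1)])
      have "z $ i0 \<le> r * (real j / real N1)" using j(3) r0 N1p by (simp add: field_simps)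
      moreover have "r * (real j / real N1) \<le> r / real N1 * (z $ i0 * real N1 / r + 1)"
        using mult_left_mono[OF j(4), of "r / real N1"] r0 N1p by simp
      moreover have "\<dots> = z $ i0 + r / real N1" using r0 N1p by (simp add: field_simps)
      moreover have "r / real N1 \<le> 1" using r0 N1p by simp
      ultimately show "\<bar>z $ i0 - r * v $ i0\<bar> \<le> 1" by (simp add: v_def)
      show "0 \<le> v $ i0" "v $ i0 \<le> 1" using j N1p by (auto simp: v_def)
      fix i assume i: "i \<noteq> i0"
      then show "0 \<le> z $ i - r * v $ i \<and> z $ i - r * v $ i \<le> L \<and> 0 \<le> v $ i \<and> v $ i \<le> 1"
        using g(2) gi[OF i] K unfolding Qmem a_def b_def v_def by (auto dest!: spec[of _ i])
    qed
    then have "ennreal (R r) \<le> maximal_hilbert (uniform_grid M) f (z, r)"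
      unfolding maximal_hilbert_def by (intro SUP_upper2[OF vM] ennreal_leI)
    then have "(ennreal (R r))\<^sup>2 \<le> (maximal_hilbert (uniform_grid M) f (z, r))\<^sup>2" by (rule power_mono) simp
    moreover have "R r \<ge> 0" using c r0 L by (simp add: R_def)
    ultimately show ?thesis by (simp add: ennreal_power)
  qed
  \<comment> \<open>An explicit Borel minorant of the squared maximal function, to which Tonelli
    applies slice by slice.\<close>
  define P where "P = (\<lambda>p. indicator {real K * L..real N1} (snd p) * (\<Sum>g\<in>A. ennreal ((R (snd p))\<^sup>2) * indicator {p. fst p \<in> Q (snd p) g} p) :: ennreal)"
  have [measurable]: "P \<in> borel_measurable borel"
  proof -
    have [measurable]: "(\<lambda>p::(real^'n) \<times> real. fst p $ i) \<in> borel_measurable borel" for i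
      by (intro borel_measurable_continuous_onI continuous_intros)
    have [measurable]: "snd \<in> borel_measurable (borel :: ((real^'n) \<times> real) measure)"
      by (intro borel_measurable_continuous_onI continuous_intros)
    have [measurable]: "{p. fst p \<in> Q (snd p) g} \<in> sets borel" for g
      unfolding Qmem a_def b_def by measurable
    show ?thesis unfolding P_def R_def by measurable
  qed
  have "(\<integral>\<^sup>+p. P p \<partial>lborel) \<le> (\<integral>\<^sup>+p. (maximal_hilbert (uniform_grid M) f p)\<^sup>2 \<partial>lborel)"
  proof (intro nn_integral_mono)
    fix p :: "(real^'n) \<times> real"
    obtain z r where p: "p = (z, r)" by fastforce
    show "P p \<le> (maximal_hilbert (uniform_grid M) f p)\<^sup>2"
      using ptw[of r z] by (cases "r \<in> {real K * L..real N1}") (auto simp: P_def p indicator_def)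
  qed
  moreover have "(\<integral>\<^sup>+p. P p \<partial>lborel) = ennreal (real K ^ d * ln L * ln (real N1 / (real K * L)) / (4 * pi\<^sup>2 * 4 ^ CARD('n)))"
  proof -
    have "(\<integral>\<^sup>+p. P p \<partial>lborel) = (\<integral>\<^sup>+r. (\<integral>\<^sup>+z. P (z, r) \<partial>lborel) \<partial>lborel)"
      unfolding lborel_prod[symmetric] by (rule lborel_pair.nn_integral_snd[symmetric]) (simp add: lborel_prod)
    also have "\<dots> = (\<integral>\<^sup>+r. ennreal (real K ^ d * ln L / (4 * pi\<^sup>2 * 4 ^ CARD('n)) * (1 / r)) * indicator {real K * L..real N1} r \<partial>lborel)"
    proof (intro nn_integral_cong)
      fix r :: real
      show "(\<integral>\<^sup>+z. P (z, r) \<partial>lborel) = ennreal (real K ^ d * ln L / (4 * pi\<^sup>2 * 4 ^ CARD('n)) * (1 / r)) * indicator {real K * L..real N1} r"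
      proof (cases "r \<in> {real K * L..real N1}")
        case True
        then have r: "r > 0" using KL by auto
        have "(\<integral>\<^sup>+z. P (z, r) \<partial>lborel) = (\<integral>\<^sup>+z. (\<Sum>g\<in>A. ennreal ((R r)\<^sup>2) * indicator (Q r g) z) \<partial>lborel)"
          using True by (intro nn_integral_cong) (simp add: P_def indicator_def)
        also have "\<dots> = (\<Sum>g\<in>A. ennreal ((R r)\<^sup>2) * emeasure lborel (Q r g))"
          by (subst nn_integral_sum) (auto simp: Q_def nn_integral_cmult_indicator)
        also have "\<dots> = (\<Sum>g\<in>A. ennreal ((R r)\<^sup>2) * ennreal (r * L ^ d))"
        proof (intro sum.cong refl arg_cong2[of _ _ _ _ times])
          fix g
          have "emeasure lborel (Q r g) = ennreal (\<Prod>i\<in>UNIV. b r g i - a r g i)"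
            unfolding Q_def by (rule emeasure_lborel_box_vec) (use r L in \<open>auto simp: a_def b_def\<close>)
          also have "(\<Prod>i\<in>UNIV. b r g i - a r g i) = r * (\<Prod>i\<in>UNIV - {i0}. L)"
            by (subst prod.remove[of _ i0]) (auto simp: a_def b_def)
          finally show "emeasure lborel (Q r g) = ennreal (r * L ^ d)" by (simp add: d_def card_Diff_singleton)
        qed
        also have "\<dots> = ennreal (real (K ^ d) * ((R r)\<^sup>2 * (r * L ^ d)))"
          using r L by (simp add: A(2) ennreal_mult ennreal_of_nat_eq_real_of_nat del: of_nat_power)
        \<comment> \<open>The normalisation \<open>c\<^sup>2 = 1 / B\<close> cancels the factor L^d
          of the box volume and one of the two factors ln L in \<open>(R r)\<^sup>2\<close>.\<close>
        also have "real (K ^ d) * ((R r)\<^sup>2 * (r * L ^ d)) = real K ^ d * ln L / (4 * pi\<^sup>2 * 4 ^ CARD('n)) * (1 / r)"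
        proof -
          have "(R r)\<^sup>2 = 1 / B * (ln L)\<^sup>2 / (4 * pi\<^sup>2 * r\<^sup>2)"
            by (simp add: R_def power_divide power_mult_distrib c(2))
          moreover have "ln L \<noteq> 0" "L ^ d \<noteq> 0" using L by auto
          ultimately show ?thesis using r by (simp add: B_def power2_eq_square)
        qed
        finally show ?thesis using True by simp
      qed (simp add: P_def)
    qed
    also have "\<dots> = ennreal (real K ^ d * ln L / (4 * pi\<^sup>2 * 4 ^ CARD('n)) * ln (real N1) - real K ^ d * ln L / (4 * pi\<^sup>2 * 4 ^ CARD('n)) * ln (real K * L))"
      using KL N1 L K by (intro nn_integral_scaled_inverse) auto
    also have "real K ^ d * ln L / (4 * pi\<^sup>2 * 4 ^ CARD('n)) * ln (real N1) - real K ^ d * ln L / (4 * pi\<^sup>2 * 4 ^ CARD('n)) * ln (real K * L)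
        = real K ^ d * ln L * ln (real N1 / (real K * L)) / (4 * pi\<^sup>2 * 4 ^ CARD('n))"
      using KL N1p K L by (simp add: ln_div right_diff_distrib diff_divide_distrib)
    finally show ?thesis .
  qed
  moreover have X: "0 \<le> real K ^ d * ln L * ln (real N1 / (real K * L)) / (4 * pi\<^sup>2 * 4 ^ CARD('n))"
    using L N1 KL by (intro divide_nonneg_nonneg mult_nonneg_nonneg) auto
  ultimately have "ennreal (sqrt (real K ^ d * ln L * ln (real N1 / (real K * L)) / (4 * pi\<^sup>2 * 4 ^ CARD('n))))
      \<le> L2_norm (maximal_hilbert (uniform_grid M) f)"
    by (intro L2_norm_geI real_sqrt_ge_zero) (simp_all only: real_sqrt_pow2)
  also have "\<dots> \<le> L2_operator_norm (maximal_hilbert (uniform_grid M))"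
    unfolding L2_operator_norm_def by (rule SUP_upper) (use f1 in simp)
  finally show ?thesis .
qed

subsection \<open>Choice of the grid\<close>

lemma eventually_ln_powr_le_powr:
  fixes a B c :: real
  assumes "a > 0"
  shows "eventually (\<lambda>N::nat. B * ln (real N) powr c \<le> real N powr a) sequentially"
proof -
  have "((\<lambda>x. B * (ln x powr c / x powr a)) \<longlongrightarrow> B * 0) at_top"
    using assms by (intro tendsto_intros) real_asymp
  then have "eventually (\<lambda>x. B * (ln x powr c / x powr a) < 1) at_top"
    by (rule order_tendstoD) simp
  then have "eventually (\<lambda>x. B * ln x powr c \<le> x powr a) at_top"
    using eventually_gt_at_top[of 0] by eventually_elim (simp add: divide_simps)
  then show ?thesis
    by (rule eventually_compose_filterlim[OF _ filterlim_real_sequentially])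
qed

text \<open>\<kappa> is the exact real value wanted for K, and \<eta> measures the slack in the
  condition on \<alpha>: since \<kappa>^(d + 1) is N^(1 - \<eta>) up to logarithms, N1 / K is about
  N^\<eta>. Half of this power absorbs logarithms and rounding constants, the other half is left for
  the lower bound.\<close>

lemma product_grid_parameters:
  fixes \<alpha> \<beta> :: real and d :: nat
  assumes d: "d > 0" and \<alpha>: "0 < \<alpha>" "\<alpha> < real d / (2 * (real d + 1))"
  defines "\<eta> \<equiv> 1 - 2 * \<alpha> * (real d + 1) / real d"
  shows "eventually (\<lambda>N::nat. \<exists>K N1 :: nat. K > 0 \<and> N1 > 0 \<and> N1 * K ^ d \<le> N \<and> real N \<le> 2 * real (N1 * K ^ d)
      \<and> real N powr (2 * \<alpha>) * ln (real N) powr (2 * \<beta> - 2) \<le> real K ^ d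
      \<and> real K ^ d \<le> 2 ^ d * (real N powr (2 * \<alpha>) * ln (real N) powr (2 * \<beta> - 2))
      \<and> real K * real N powr (\<eta> / 2) \<le> real N1 \<and> 1 \<le> ln (real N)) sequentially"
proof -
  have \<eta>: "\<eta> > 0" using \<alpha> d by (simp add: \<eta>_def field_simps)
  \<comment> \<open>Ensures \<kappa> \<ge> 1, also when the exponent 2 \<beta> - 2 is negative, so
    that rounding up at most doubles \<kappa>.\<close>
  have "eventually (\<lambda>N::nat. 1 * ln (real N) powr (- ((2 * \<beta> - 2) / d)) \<le> real N powr (2 * \<alpha> / d)) sequentially"
    by (rule eventually_ln_powr_le_powr) (use \<alpha> d in simp)
  \<comment> \<open>The constant \<open>2 ^ (d + 2)\<close> is made of \<open>2 ^ (d + 1)\<close>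
    from K \<le> 2 \<kappa> and of 2 from rounding N / K^d down to an integer.\<close>
  moreover have "eventually (\<lambda>N::nat. 2 ^ (d + 2) * ln (real N) powr ((2 * \<beta> - 2) / d * (d + 1)) \<le> real N powr (\<eta> / 2)) sequentially"
    by (rule eventually_ln_powr_le_powr) (use \<eta> in simp)
  moreover have "eventually (\<lambda>N::nat. 1 \<le> ln (real N)) sequentially" by real_asymp
  moreover have "eventually (\<lambda>N::nat. N > 0) sequentially" by (rule eventually_gt_at_top)
  ultimately show ?thesis
  proof eventually_elim
    case (elim N)
    have lnN: "ln (real N) > 0" using elim(3) by simp
    have N: "real N > 0" using elim(4) by simp
    define \<kappa> where "\<kappa> = real N powr (2 * \<alpha> / d) * ln (real N) powr ((2 * \<beta> - 2) / d)"
    have "ln (real N) powr (- ((2 * \<beta> - 2) / d)) * ln (real N) powr ((2 * \<beta> - 2) / d)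
        \<le> real N powr (2 * \<alpha> / d) * ln (real N) powr ((2 * \<beta> - 2) / d)"
      using elim(1) by (intro mult_right_mono) auto
    then have \<kappa>1: "\<kappa> \<ge> 1" using lnN by (simp add: \<kappa>_def flip: powr_add)
    have \<kappa>d: "\<kappa> ^ d = real N powr (2 * \<alpha>) * ln (real N) powr (2 * \<beta> - 2)"
      using d N lnN by (simp add: \<kappa>_def power_mult_distrib powr_powr flip: powr_realpow)
    have \<kappa>d1: "\<kappa> ^ (d + 1) = real N powr (1 - \<eta>) * ln (real N) powr ((2 * \<beta> - 2) / d * (d + 1))"
    proof -
      have "\<kappa> ^ (d + 1) = real N powr (2 * \<alpha> / d * (d + 1)) * ln (real N) powr ((2 * \<beta> - 2) / d * (d + 1))"
        unfolding \<kappa>_def power_mult_distrib using N lnN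
        by (subst (1 2) powr_realpow[symmetric]) (simp_all add: powr_powr)
      also have "2 * \<alpha> / d * (d + 1) = 1 - \<eta>" by (simp add: \<eta>_def)
      finally show ?thesis .
    qed
    define K where "K = nat \<lceil>\<kappa>\<rceil>"
    have K: "\<kappa> \<le> real K" "real K \<le> 2 * \<kappa>" "K \<ge> 1" using \<kappa>1 unfolding K_def by linarith+
    have Kd: "\<kappa> ^ d \<le> real K ^ d" "real K ^ d \<le> 2 ^ d * \<kappa> ^ d"
      using power_mono[OF K(1), of d] power_mono[OF K(2), of d] \<kappa>1 by (auto simp: power_mult_distrib)
    have "2 * real K ^ (d + 1) * real N powr (\<eta> / 2) \<le> 2 * (2 * \<kappa>) ^ (d + 1) * real N powr (\<eta> / 2)"
      using power_mono[OF K(2), of "d + 1"] by (intro mult_right_mono mult_left_mono) auto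
    also have "\<dots> = (2 ^ (d + 2) * ln (real N) powr ((2 * \<beta> - 2) / d * (d + 1))) * (real N powr (1 - \<eta>) * real N powr (\<eta> / 2))"
      unfolding power_mult_distrib \<kappa>d1 by (simp add: mult_ac)
    also have "\<dots> \<le> real N powr (\<eta> / 2) * (real N powr (1 - \<eta>) * real N powr (\<eta> / 2))"
      using elim(2) by (intro mult_right_mono) auto
    also have "\<dots> = real N" using N by (simp flip: powr_add)
    finally have big: "2 * real K ^ (d + 1) * real N powr (\<eta> / 2) \<le> real N" .
    have pw: "1 \<le> real N powr (\<eta> / 2)" using \<eta> elim(4) by (intro ge_one_powr_ge_zero) auto
    have "real K ^ d \<le> real N"
    proof -
      have "real K ^ d * 1 * 1 \<le> real K ^ d * (2 * real K) * real N powr (\<eta> / 2)"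
        using K pw by (intro mult_mono) auto
      also have "\<dots> = 2 * real K ^ (d + 1) * real N powr (\<eta> / 2)" by (simp add: mult_ac)
      finally show ?thesis using big by linarith
    qed
    then have KN: "K ^ d \<le> N" unfolding of_nat_power[symmetric] of_nat_le_iff .
    define N1 where "N1 = N div K ^ d"
    have Kpos: "K ^ d > 0" using K by simp
    have N1: "N1 \<ge> 1" unfolding N1_def using KN Kpos by (simp add: div_greater_zero_iff Suc_le_eq)
    have le: "N1 * K ^ d \<le> N" unfolding N1_def by simp
    have "N < (N1 + 1) * K ^ d" unfolding N1_def using Kpos by (simp add: dividend_less_div_times)
    also have "\<dots> \<le> (2 * N1) * K ^ d" using N1 by (intro mult_right_mono) auto
    finally have "N \<le> 2 * (N1 * K ^ d)" by simp
    then have ge: "real N \<le> 2 * real (N1 * K ^ d)" by (simp only: of_nat_le_iff[symmetric, where 'a=real] of_nat_mult of_nat_numeral)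
    have "real K * real N powr (\<eta> / 2) \<le> real N1"
    proof -
      have "2 * real (K ^ d) * (real K * real N powr (\<eta> / 2)) \<le> 2 * real (K ^ d) * real N1"
        using big ge by (simp add: mult_ac)
      moreover have "0 < 2 * real (K ^ d)" using Kpos by simp
      ultimately show ?thesis by (simp only: mult_le_cancel_left_pos)
    qed
    then show ?case
      using K N1 le ge Kd elim(3) unfolding \<kappa>d by (intro exI[of _ K] exI[of _ N1]) auto
  qed
qed

theorem corollary3p4:
  fixes \<alpha> :: real
  assumes "CARD('n::finite) \<ge> 2"
    and "0 < \<alpha>" and "\<alpha> < (real CARD('n) - 1) / (2 * real CARD('n))"
  shows "\<exists>C::real. C > 0 \<and> (\<forall>\<beta>::real. \<beta> \<ge> 0 \<longrightarrow>
    (\<exists>N0::nat. \<forall>N::nat. N \<ge> N0 \<longrightarrow>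
      (\<exists>(M :: 'n \<Rightarrow> nat) (\<Omega> :: (real^'n) set).
        (\<forall>i. M i > 0) \<and> \<Omega> = uniform_grid M \<and>
        real N / 2 ^ CARD('n) \<le> real (card \<Omega>) \<and>
        real (card \<Omega>) \<le> 2 ^ CARD('n) * real N \<and>
        ennreal (inverse C * real N powr \<alpha> * ln (real N) powr \<beta>)
          \<le> L2_operator_norm (maximal_hilbert \<Omega>) \<and>
        L2_operator_norm (maximal_hilbert \<Omega>)
          \<le> ennreal (C * real N powr \<alpha> * ln (real N) powr \<beta>))))"
proof -
  define d where "d = CARD('n) - 1"
  have d: "d > 0" "CARD('n) = d + 1" using assms(1) by (auto simp: d_def)
  have \<alpha>: "\<alpha> < real d / (2 * (real d + 1))" using assms(3) by (simp add: d(2) add.commute)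
  define \<eta> where "\<eta> = 1 - 2 * \<alpha> * (real d + 1) / real d"
  have \<eta>: "\<eta> > 0" using \<alpha> d(1) by (simp add: \<eta>_def field_simps)
  \<comment> \<open>\<eta> / 4 will be the exponent of L in terms of N, so each of the two
    logarithms in the lower bound is at least (\<eta> / 4) ln N; the denominator is that of
    \<open>maximal_hilbert_lower\<close>.\<close>
  define c where "c = (\<eta> / 4)\<^sup>2 / (4 * pi\<^sup>2 * 4 ^ CARD('n))"
  have c: "c > 0" using \<eta> by (simp add: c_def)
  \<comment> \<open>For the second entry, the upper bound has 32 (1 + k^2) with k \<le> 3 ln N and 1
    \<le> ln N, at most 32 * 10 (ln N)^2, and \<open>2 ^ d\<close> is lost in rounding K. Neither
    entry involves \<beta>.\<close>
  define C where "C = max (1 / sqrt c) (sqrt (320 * 2 ^ d))"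
  have C: "C > 0" "C \<ge> sqrt (320 * 2 ^ d)" "inverse C \<le> sqrt c"
  proof -
    have "1 / sqrt c > 0" using c by simp
    then show "C > 0" by (simp add: C_def less_max_iff_disj)
    have "1 / sqrt c \<le> C" by (simp add: C_def)
    then show "inverse C \<le> sqrt c" using \<open>C > 0\<close> c by (simp add: field_simps)
  qed (simp add: C_def)
  \<comment> \<open>Any coordinate may serve as the long one.\<close>
  obtain i0 :: 'n where True by simp
  show ?thesis
  proof (intro exI[of _ C] conjI C(1) allI impI)
    fix \<beta> :: real assume "\<beta> \<ge> 0"
    from product_grid_parameters[OF d(1) assms(2) \<alpha>, of \<beta>, folded \<eta>_def]
    obtain N0 where N0: "\<And>N. N \<ge> N0 \<Longrightarrow> \<exists>K N1 :: nat. K > 0 \<and> N1 > 0 \<and> N1 * K ^ d \<le> N \<and> real N \<le> 2 * real (N1 * K ^ d)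
      \<and> real N powr (2 * \<alpha>) * ln (real N) powr (2 * \<beta> - 2) \<le> real K ^ d
      \<and> real K ^ d \<le> 2 ^ d * (real N powr (2 * \<alpha>) * ln (real N) powr (2 * \<beta> - 2))
      \<and> real K * real N powr (\<eta> / 2) \<le> real N1 \<and> 1 \<le> ln (real N)"
      unfolding eventually_sequentially by blast
    show "\<exists>N0::nat. \<forall>N::nat. N \<ge> N0 \<longrightarrow>
      (\<exists>(M :: 'n \<Rightarrow> nat) (\<Omega> :: (real^'n) set).
        (\<forall>i. M i > 0) \<and> \<Omega> = uniform_grid M \<and>
        real N / 2 ^ CARD('n) \<le> real (card \<Omega>) \<and>
        real (card \<Omega>) \<le> 2 ^ CARD('n) * real N \<and>
        ennreal (inverse C * real N powr \<alpha> * ln (real N) powr \<beta>)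
          \<le> L2_operator_norm (maximal_hilbert \<Omega>) \<and>
        L2_operator_norm (maximal_hilbert \<Omega>)
          \<le> ennreal (C * real N powr \<alpha> * ln (real N) powr \<beta>))"
    proof (intro exI[of _ N0] allI impI)
      fix N assume "N \<ge> N0"
      from N0[OF this] obtain K N1 :: nat where K: "K > 0" and N1: "N1 > 0"
        and card: "N1 * K ^ d \<le> N" "real N \<le> 2 * real (N1 * K ^ d)"
        and Kd: "real N powr (2 * \<alpha>) * ln (real N) powr (2 * \<beta> - 2) \<le> real K ^ d"
          "real K ^ d \<le> 2 ^ d * (real N powr (2 * \<alpha>) * ln (real N) powr (2 * \<beta> - 2))"
        and KN1: "real K * real N powr (\<eta> / 2) \<le> real N1" and lnN: "1 \<le> ln (real N)"
        by blast
      define X where "X = real N powr (2 * \<alpha>) * ln (real N) powr (2 * \<beta> - 2)"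
      define Y where "Y = real N powr \<alpha> * ln (real N) powr \<beta>"
      have "N > 0" using lnN by (cases "N = 0") auto
      then have "0 < real N" by simp
      with lnN have N: "real N > 1" using ln_gt_zero_iff[of "real N"] by linarith
      have Y: "Y \<ge> 0" by (simp add: Y_def)
      \<comment> \<open>The exponent 2 \<beta> - 2 was chosen for this identity: both norm bounds
        supply the missing (ln N)^2.\<close>
      have XY: "X * (ln (real N))\<^sup>2 = Y\<^sup>2"
      proof -
        have "X * (ln (real N))\<^sup>2 = real N powr (2 * \<alpha>) * (ln (real N) powr (2 * \<beta> - 2) * ln (real N) powr 2)"
          using lnN by (simp add: X_def powr_numeral)
        also have "ln (real N) powr (2 * \<beta> - 2) * ln (real N) powr 2 = ln (real N) powr (\<beta> + \<beta>)"
          by (simp flip: powr_add)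
        also have "real N powr (2 * \<alpha>) = real N powr (\<alpha> + \<alpha>)" by simp
        finally show ?thesis unfolding powr_add by (simp add: Y_def power2_eq_square)
      qed
      define M where "M = (\<lambda>i::'n. if i = i0 then N1 else K)"
      have prodM: "(\<Prod>i\<in>UNIV - {i0}. M i) = K ^ d"
        by (simp add: M_def d_def card_Diff_singleton)
      have cardM: "card (uniform_grid M) = N1 * K ^ d"
        unfolding card_uniform_grid(2) by (subst prod.remove[of _ i0]) (simp_all add: prodM, simp add: M_def)
      have "real N / 2 ^ CARD('n) \<le> real N / 2"
        using assms(1) N by (intro divide_left_mono self_le_power) auto
      also have "\<dots> \<le> real (card (uniform_grid M))" using card by (simp add: cardM)
      finally have 1: "real N / 2 ^ CARD('n) \<le> real (card (uniform_grid M))" .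
      have "real (card (uniform_grid M)) \<le> 1 * real N" unfolding cardM using card(1) by (simp only: of_nat_le_iff mult_1)
      also have "\<dots> \<le> 2 ^ CARD('n) * real N" by (intro mult_right_mono) auto
      finally have 2: "real (card (uniform_grid M)) \<le> 2 ^ CARD('n) * real N" .
      have 3: "ennreal (inverse C * real N powr \<alpha> * ln (real N) powr \<beta>) \<le> L2_operator_norm (maximal_hilbert (uniform_grid M))"
      proof -
        \<comment> \<open>With this exponent L^2 is the power of N in \<open>KN1\<close>, so K L^2
          \<le> N1, and the ratio N1 / (K L) is again at least L.\<close>
        define L where "L = real N powr (\<eta> / 4)"
        have L: "L > 1" unfolding L_def using N \<eta> by simp
        have LL: "real N powr (\<eta> / 2) = L * L" unfolding L_def by (simp flip: powr_add)
        have KL: "real K * L > 0" using K L by simp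
        have L': "L \<le> real N1 / (real K * L)" using KN1 KL by (simp add: LL pos_le_divide_eq mult_ac)
        have "real K * L < real N1" using order.strict_trans2[OF L L'] KL by (simp add: pos_less_divide_eq)
        note low = maximal_hilbert_lower[OF L K this, of i0, folded M_def d_def]
        have lnL: "ln L = \<eta> / 4 * ln (real N)" unfolding L_def using N by (simp add: ln_powr)
        have "ln L \<le> ln (real N1 / (real K * L))" using L' L by (intro ln_mono) auto
        then have "X * (ln L * ln L) \<le> real K ^ d * (ln L * ln (real N1 / (real K * L)))"
          using Kd(1) L by (intro mult_mono mult_left_mono) (auto simp: X_def)
        then have "X * (ln L * ln L) / (4 * pi\<^sup>2 * 4 ^ CARD('n)) \<le> real K ^ d * (ln L * ln (real N1 / (real K * L))) / (4 * pi\<^sup>2 * 4 ^ CARD('n))"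
          by (rule divide_right_mono) simp
        moreover have "X * (ln L * ln L) / (4 * pi\<^sup>2 * 4 ^ CARD('n)) = c * (X * (ln (real N))\<^sup>2)"
          by (simp add: lnL c_def power2_eq_square)
        ultimately have "c * Y\<^sup>2 \<le> real K ^ d * ln L * ln (real N1 / (real K * L)) / (4 * pi\<^sup>2 * 4 ^ CARD('n))"
          by (simp add: XY mult.assoc)
        then have "sqrt (c * Y\<^sup>2) \<le> sqrt (real K ^ d * ln L * ln (real N1 / (real K * L)) / (4 * pi\<^sup>2 * 4 ^ CARD('n)))"
          by (rule real_sqrt_le_mono)
        moreover have "inverse C * Y \<le> sqrt c * Y" using C(3) Y by (rule mult_right_mono)
        moreover have "sqrt (c * Y\<^sup>2) = sqrt c * Y" using Y by (simp add: real_sqrt_mult)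
        ultimately have "inverse C * Y \<le> sqrt (real K ^ d * ln L * ln (real N1 / (real K * L)) / (4 * pi\<^sup>2 * 4 ^ CARD('n)))" by simp
        then show ?thesis using low by (intro order_trans[OF ennreal_leI low]) (simp add: Y_def mult.assoc)
      qed
      have 4: "L2_operator_norm (maximal_hilbert (uniform_grid M)) \<le> ennreal (C * real N powr \<alpha> * ln (real N) powr \<beta>)"
      proof -
        \<comment> \<open>The length of the progression is measured through N \<ge> N1, since the
          bound is wanted in terms of ln N.\<close>
        obtain m where m: "2 ^ m \<le> N" "N < 2 ^ (m + 1)"
          using ex_power_ivl1[of 2 N] N by auto
        have "N1 \<le> N1 * K ^ d" using K by simp
        then have "N1 < 2 ^ (m + 1)" using m(2) card(1) by linarith
        then have "M i0 < 2 ^ (m + 1)" by (simp only: M_def if_True simp_thms)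
        note up = maximal_hilbert_upper[of M i0 "m + 1", OF this]
        have "real (2 ^ m) \<le> real N" using m(1) by (simp only: of_nat_le_iff)
        then have "ln (2 ^ m) \<le> ln (real N)" by (intro ln_mono) auto
        then have "real m * ln 2 \<le> ln (real N)" by (simp add: ln_realpow)
        moreover have "real m * (2 / 3) \<le> real m * ln 2" using ln2_ge_two_thirds by (intro mult_left_mono) auto
        ultimately have "real (m + 1) \<le> 3 * ln (real N)" using lnN by simp
        then have "(real (m + 1))\<^sup>2 \<le> (3 * ln (real N))\<^sup>2" by (intro power_mono) auto
        moreover have "1 \<le> (ln (real N))\<^sup>2" using lnN by (simp add: one_le_power)
        ultimately have b: "32 * (1 + (real (m + 1))\<^sup>2) \<le> 320 * (ln (real N))\<^sup>2" by (simp add: power_mult_distrib)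
        have "real (K ^ d) \<le> 2 ^ d * X" using Kd(2) by (simp add: X_def)
        from mult_mono[OF this b] have "real (K ^ d) * (32 * (1 + (real (m + 1))\<^sup>2)) \<le> (2 ^ d * X) * (320 * (ln (real N))\<^sup>2)"
          by (simp add: X_def)
        also have "\<dots> = 320 * 2 ^ d * Y\<^sup>2" by (simp flip: XY)
        finally have "sqrt (real (K ^ d) * (32 * (1 + (real (m + 1))\<^sup>2))) \<le> sqrt (320 * 2 ^ d * Y\<^sup>2)"
          by (rule real_sqrt_le_mono)
        also have "\<dots> = sqrt (320 * 2 ^ d) * Y" using Y by (simp add: real_sqrt_mult)
        also have "\<dots> \<le> C * Y" using C(2) Y by (rule mult_right_mono)
        finally have "sqrt (real (K ^ d) * (32 * (1 + (real (m + 1))\<^sup>2))) \<le> C * real N powr \<alpha> * ln (real N) powr \<beta>"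
          by (simp add: Y_def mult.assoc)
        then show ?thesis using up unfolding prodM by (intro order_trans[OF up[unfolded prodM] ennreal_leI])
      qed
      have "\<forall>i. M i > 0" using K N1 by (simp add: M_def)
      with 1 2 3 4 show "\<exists>(M :: 'n \<Rightarrow> nat) (\<Omega> :: (real^'n) set).
        (\<forall>i. M i > 0) \<and> \<Omega> = uniform_grid M \<and>
        real N / 2 ^ CARD('n) \<le> real (card \<Omega>) \<and>
        real (card \<Omega>) \<le> 2 ^ CARD('n) * real N \<and>
        ennreal (inverse C * real N powr \<alpha> * ln (real N) powr \<beta>)
          \<le> L2_operator_norm (maximal_hilbert \<Omega>) \<and>
        L2_operator_norm (maximal_hilbert \<Omega>)
          \<le> ennreal (C * real N powr \<alpha> * ln (real N) powr \<beta>)" by blast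
    qed
  qed
qed

end
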